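(* Let $1\le p_1<p_0\le\infty$, $0<\theta<1$, and let $p^{-1}=(1-\theta)p_0^{-1}+\theta p_1^{-1}$. Then $$\Bigl(\ell_{p_0}\bigl(\bigoplus_n\ell_2^n\bigr),\ \ell_{p_1}\bigl(\bigoplus_n\ell_2^n\bigr)\Bigr)_\theta=\ell_p\bigl(\bigoplus_k\ell_2^k\bigr)$$ with associated centralizer $$\Omega(x)=\left(\left(\frac p{p_1}-\frac p{p_0}\right)\log\left(\frac{\|x^k\|_2}{\|x\|}\right)x^k\right)_k,\qquad x=(x^k)_k,\ x^k\in\ell_2^k.$$ Consequently, if $p_1<p_0<2$ then $\Omega$ is disjointly singular but not super disjointly singular.
   Context: $\ell_q(\bigoplus_n\ell_2^n)$ is the $\ell_q$-sum of the Euclidean spaces $\ell_2^n$, $n\ge1$, viewed as a Köthe sequence space through its natural 1-unconditional basis (the union of the canonical bases of the $\ell_2^n$); supports and disjointness refer to this basis. $(X_0,X_1)_\theta$ denotes complex interpolation. In the formula for $\Omega$, $\|x\|$ is the norm in $\ell_p(\bigoplus\ell_2^k)$, with the convention that the $k$-th coordinate is $0$ if $x^k=0$, and $\Omega(0)=0$. Associated centralizer: if $\mathcal C$ is the Calderón space of analytic functions on the strip $0<\mathrm{Re}\,z<1$ for the couple $(X_0,X_1)$, and $B:X_\theta\to\mathcal C$ is a homogeneous bounded selection with $B(x)(\theta)=x$, the associated centralizer is $\Omega_\theta(x)=B(x)'(\theta)$; it is determined up to a bounded homogeneous map $X_\theta\to X_\theta$. For a centralizer $\Omega$ on a Köthe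 sequence space $X$ (so $\Omega$ takes values in the space $\omega$ of all scalar sequences), $\Omega$ is trivial on a subspace $H$ if there is a linear (not necessarily continuous) map $L:H\to\omega$ with $\Omega x-Lx\in X$ for $x\in H$ and $\sup\{\|\Omega x-Lx\|_X:x\in H,\|x\|\le1\}<\infty$. $\Omega$ is disjointly singular if it is not trivial on any infinite-dimensional subspace generated by (closed linear span of) a disjointly supported sequence. The modulus of superdisjoint singularity is $\psi_\Omega(n)=\inf_{E_n}\inf_L\sup\{\|\Omega x-Lx\|_X:x\in E_n,\|x\|\le1\}$, where $E_n$ runs over all $n$-dimensional subspaces of $X$ generated by disjointly supported vectors and $L:E_n\to\omega$ over all linear maps. $\Omega$ is super disjointly singular if $\lim_n\psi_\Omega(n)=+\infty$. *)

theory Defs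
  imports "HOL-Analysis.Analysis" "HOL-Library.Function_Algebras"
begin

text \<open>The space \<open>\<omega>\<close> of all scalar sequences over an index set is the full function type
  \<open>'i \<Rightarrow> complex\<close>, with pointwise addition. A normed space of sequences is given by its set of
  vectors and its norm; the norm is only meaningful on that set.\<close>

definition cscale :: "complex \<Rightarrow> ('i \<Rightarrow> complex) \<Rightarrow> 'i \<Rightarrow> complex" where
  "cscale c x = (\<lambda>j. c * x j)"

interpretation cseq: vector_space "cscale :: complex \<Rightarrow> ('i \<Rightarrow> complex) \<Rightarrow> 'i \<Rightarrow> complex"
  by unfold_locales (auto simp: cscale_def fun_eq_iff algebra_simps)

record 'i seq_space =
  vecs :: "('i \<Rightarrow> complex) set"
  nrm :: "('i \<Rightarrow> complex) \<Rightarrow> real"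

definition same_space :: "'i seq_space \<Rightarrow> 'i seq_space \<Rightarrow> bool" where
  "same_space X Y \<longleftrightarrow> vecs X = vecs Y \<and> (\<forall>x\<in>vecs X. nrm X x = nrm Y x)"

definition extended_nrm :: "'i seq_space \<Rightarrow> ('i \<Rightarrow> complex) \<Rightarrow> ennreal" where
  "extended_nrm X x = (if x \<in> vecs X then ennreal (nrm X x) else \<infinity>)"

definition supp :: "('i \<Rightarrow> complex) \<Rightarrow> 'i set" where
  "supp x = {j. x j \<noteq> 0}"

definition closed_span :: "'i seq_space \<Rightarrow> ('i \<Rightarrow> complex) set \<Rightarrow> ('i \<Rightarrow> complex) set" where
  "closed_span X U = {x \<in> vecs X. \<forall>e>0. \<exists>y\<in>cseq.span U. y \<in> vecs X \<and> nrm X (x - y) < e}"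

definition infinite_dimensional :: "('i \<Rightarrow> complex) set \<Rightarrow> bool" where
  "infinite_dimensional H \<longleftrightarrow> \<not> (\<exists>B. finite B \<and> H \<subseteq> cseq.span B)"

definition linear_on_seq :: "('i \<Rightarrow> complex) set \<Rightarrow> (('i \<Rightarrow> complex) \<Rightarrow> 'i \<Rightarrow> complex) \<Rightarrow> bool" where
  "linear_on_seq H L \<longleftrightarrow>
     (\<forall>x\<in>H. \<forall>y\<in>H. L (x + y) = L x + L y) \<and> (\<forall>c. \<forall>x\<in>H. L (cscale c x) = cscale c (L x))"

definition sum_space :: "'i seq_space \<Rightarrow> 'i seq_space \<Rightarrow> 'i seq_space" where
  "sum_space X Y =
     \<lparr>vecs = {a + b | a b. a \<in> vecs X \<and> b \<in> vecs Y},
      nrm = (\<lambda>x. Inf {nrm X a + nrm Y b | a b. a \<in> vecs X \<and> b \<in> vecs Y \<and> x = a + b})\<rparr>"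

definition seq_continuous_on ::
    "'i seq_space \<Rightarrow> 'a::topological_space set \<Rightarrow> ('a \<Rightarrow> 'i \<Rightarrow> complex) \<Rightarrow> bool" where
  "seq_continuous_on X S F \<longleftrightarrow>
     F ` S \<subseteq> vecs X \<and> (\<forall>z\<in>S. ((\<lambda>w. nrm X (F w - F z)) \<longlongrightarrow> 0) (at z within S))"

definition seq_bounded_on :: "'i seq_space \<Rightarrow> 'a set \<Rightarrow> ('a \<Rightarrow> 'i \<Rightarrow> complex) \<Rightarrow> bool" where
  "seq_bounded_on X S F \<longleftrightarrow> F ` S \<subseteq> vecs X \<and> (\<exists>K. \<forall>z\<in>S. nrm X (F z) \<le> K)"

definition has_seq_derivative ::
    "'i seq_space \<Rightarrow> (complex \<Rightarrow> 'i \<Rightarrow> complex) \<Rightarrow> ('i \<Rightarrow> complex) \<Rightarrow> complex \<Rightarrow> bool" where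
  "has_seq_derivative X F D z \<longleftrightarrow>
     D \<in> vecs X \<and> ((\<lambda>w. nrm X (cscale (inverse (w - z)) (F w - F z) - D)) \<longlongrightarrow> 0) (at z)"

definition seq_deriv ::
    "'i seq_space \<Rightarrow> (complex \<Rightarrow> 'i \<Rightarrow> complex) \<Rightarrow> complex \<Rightarrow> 'i \<Rightarrow> complex" where
  "seq_deriv X F z = (THE D. has_seq_derivative X F D z)"

definition closed_strip :: "complex set" where
  "closed_strip = {z. 0 \<le> Re z \<and> Re z \<le> 1}"

definition open_strip :: "complex set" where
  "open_strip = {z. 0 < Re z \<and> Re z < 1}"

text \<open>The Calderon space: bounded continuous functions from the closed strip to \<open>X\<^sub>0 + X\<^sub>1\<close>, analytic
  inside, whose boundary values on \<open>Re z = k\<close> form a bounded continuous function into \<open>X\<^sub>k\<close>.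
  Values of \<open>F\<close> off the closed strip are irrelevant.\<close>

definition calderon :: "'i seq_space \<Rightarrow> 'i seq_space \<Rightarrow> (complex \<Rightarrow> 'i \<Rightarrow> complex) set" where
  "calderon X0 X1 = {F.
     seq_continuous_on (sum_space X0 X1) closed_strip F \<and>
     seq_bounded_on (sum_space X0 X1) closed_strip F \<and>
     (\<forall>z\<in>open_strip. \<exists>D. has_seq_derivative (sum_space X0 X1) F D z) \<and>
     seq_continuous_on X0 UNIV (\<lambda>t::real. F (Complex 0 t)) \<and>
     seq_bounded_on X0 UNIV (\<lambda>t::real. F (Complex 0 t)) \<and>
     seq_continuous_on X1 UNIV (\<lambda>t::real. F (Complex 1 t)) \<and>
     seq_bounded_on X1 UNIV (\<lambda>t::real. F (Complex 1 t))}"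

definition calderon_norm ::
    "'i seq_space \<Rightarrow> 'i seq_space \<Rightarrow> (complex \<Rightarrow> 'i \<Rightarrow> complex) \<Rightarrow> real" where
  "calderon_norm X0 X1 F =
     max (SUP t::real. nrm X0 (F (Complex 0 t))) (SUP t::real. nrm X1 (F (Complex 1 t)))"

definition interp_space :: "'i seq_space \<Rightarrow> 'i seq_space \<Rightarrow> real \<Rightarrow> 'i seq_space" where
  "interp_space X0 X1 \<theta> =
     \<lparr>vecs = {F (of_real \<theta>) | F. F \<in> calderon X0 X1},
      nrm = (\<lambda>x. Inf {calderon_norm X0 X1 F | F. F \<in> calderon X0 X1 \<and> F (of_real \<theta>) = x})\<rparr>"

definition bounded_homogeneous_selection ::
    "'i seq_space \<Rightarrow> 'i seq_space \<Rightarrow> real \<Rightarrow> (('i \<Rightarrow> complex) \<Rightarrow> complex \<Rightarrow> 'i \<Rightarrow> complex) \<Rightarrow> bool" where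
  "bounded_homogeneous_selection X0 X1 \<theta> B \<longleftrightarrow>
     (\<forall>x \<in> vecs (interp_space X0 X1 \<theta>). B x \<in> calderon X0 X1 \<and> B x (of_real \<theta>) = x) \<and>
     (\<forall>c. \<forall>x \<in> vecs (interp_space X0 X1 \<theta>). \<forall>z\<in>closed_strip. B (cscale c x) z = cscale c (B x z)) \<and>
     (\<exists>K. \<forall>x \<in> vecs (interp_space X0 X1 \<theta>).
        calderon_norm X0 X1 (B x) \<le> K * nrm (interp_space X0 X1 \<theta>) x)"

definition bounded_homogeneous_map ::
    "'i seq_space \<Rightarrow> (('i \<Rightarrow> complex) \<Rightarrow> 'i \<Rightarrow> complex) \<Rightarrow> bool" where
  "bounded_homogeneous_map X T \<longleftrightarrow>
     (\<forall>x\<in>vecs X. T x \<in> vecs X) \<and>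
     (\<forall>c. \<forall>x\<in>vecs X. T (cscale c x) = cscale c (T x)) \<and>
     (\<exists>K. \<forall>x\<in>vecs X. nrm X (T x) \<le> K * nrm X x)"

text \<open>The centralizer \<open>x \<mapsto> B(x)'(\<theta>)\<close> depends on the selection \<open>B\<close> only up to a bounded homogeneous
  map, so being the associated centralizer means agreeing, up to such a map, with the one
  obtained from any selection. Existence of a selection is required so that this is not vacuous.\<close>

definition associated_centralizer ::
    "'i seq_space \<Rightarrow> 'i seq_space \<Rightarrow> real \<Rightarrow> (('i \<Rightarrow> complex) \<Rightarrow> 'i \<Rightarrow> complex) \<Rightarrow> bool" where
  "associated_centralizer X0 X1 \<theta> \<Omega> \<longleftrightarrow>
     (\<exists>B. bounded_homogeneous_selection X0 X1 \<theta> B) \<and>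
     (\<forall>B. bounded_homogeneous_selection X0 X1 \<theta> B \<longrightarrow>
        bounded_homogeneous_map (interp_space X0 X1 \<theta>)
          (\<lambda>x. \<Omega> x - seq_deriv (sum_space X0 X1) (B x) (of_real \<theta>)))"

definition trivial_on ::
    "'i seq_space \<Rightarrow> (('i \<Rightarrow> complex) \<Rightarrow> 'i \<Rightarrow> complex) \<Rightarrow> ('i \<Rightarrow> complex) set \<Rightarrow> bool" where
  "trivial_on X \<Omega> H \<longleftrightarrow>
     (\<exists>L. linear_on_seq H L \<and> (\<forall>x\<in>H. \<Omega> x - L x \<in> vecs X) \<and>
        (\<exists>K. \<forall>x\<in>H. nrm X x \<le> 1 \<longrightarrow> nrm X (\<Omega> x - L x) \<le> K))"

definition disjointly_singular ::
    "'i seq_space \<Rightarrow> (('i \<Rightarrow> complex) \<Rightarrow> 'i \<Rightarrow> complex) \<Rightarrow> bool" where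
  "disjointly_singular X \<Omega> \<longleftrightarrow>
     (\<forall>u :: nat \<Rightarrow> 'i \<Rightarrow> complex.
        range u \<subseteq> vecs X \<and> disjoint_family (\<lambda>n. supp (u n)) \<and>
        infinite_dimensional (closed_span X (range u)) \<longrightarrow>
        \<not> trivial_on X \<Omega> (closed_span X (range u)))"

definition disjoint_subspaces :: "'i seq_space \<Rightarrow> nat \<Rightarrow> ('i \<Rightarrow> complex) set set" where
  "disjoint_subspaces X n =
     {E. \<exists>U. finite U \<and> U \<subseteq> vecs X \<and> disjoint_family_on supp U \<and>
             E = cseq.span U \<and> cseq.dim E = n}"

definition superdisjoint_modulus ::
    "'i seq_space \<Rightarrow> (('i \<Rightarrow> complex) \<Rightarrow> 'i \<Rightarrow> complex) \<Rightarrow> nat \<Rightarrow> ennreal" where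
  "superdisjoint_modulus X \<Omega> n =
     (INF E \<in> disjoint_subspaces X n. INF L \<in> {L. linear_on_seq E L}.
        SUP x \<in> {x \<in> E. nrm X x \<le> 1}. extended_nrm X (\<Omega> x - L x))"

definition super_disjointly_singular ::
    "'i seq_space \<Rightarrow> (('i \<Rightarrow> complex) \<Rightarrow> 'i \<Rightarrow> complex) \<Rightarrow> bool" where
  "super_disjointly_singular X \<Omega> \<longleftrightarrow> (superdisjoint_modulus X \<Omega> \<longlonglongrightarrow> \<infinity>)"

text \<open>The natural basis: the pair \<open>(n, i)\<close> stands for the \<open>i\<close>-th canonical basis vector of \<open>\<ell>\<^sub>2\<^sup>n\<close>.\<close>

typedef basis_index = "{(n, i). 1 \<le> i \<and> i \<le> n} :: (nat \<times> nat) set"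
  by (rule exI[of _ "(1, 1)"]) simp

definition block :: "basis_index \<Rightarrow> nat" where
  "block j = fst (Rep_basis_index j)"

lemma block_eq_image: "{j. block j = n} = (\<lambda>i. Abs_basis_index (n, i)) ` {1..n}"
proof (intro equalityI subsetI)
  fix j assume "j \<in> {j. block j = n}"
  then show "j \<in> (\<lambda>i. Abs_basis_index (n, i)) ` {1..n}"
    using Rep_basis_index[of j]
    by (auto simp: block_def split: prod.splits
        intro!: image_eqI[of _ _ "snd (Rep_basis_index j)"])
       (metis Rep_basis_index_inverse prod.collapse)
qed (auto simp: block_def Abs_basis_index_inverse)

lemma finite_block: "finite {j. block j = n}"
  by (simp add: block_eq_image)

lemma card_block: "card {j. block j = n} = n"
proof -
  have "inj_on (\<lambda>i. Abs_basis_index (n, i)) {1..n}"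
    by (auto simp: inj_on_def Abs_basis_index_inject)
  then show ?thesis
    by (simp add: block_eq_image card_image)
qed

text \<open>\<open>block_norm x n\<close> is the Euclidean norm of the component \<open>x\<^sup>n \<in> \<ell>\<^sub>2\<^sup>n\<close>. There is no block of
  index 0, so \<open>block_norm x 0 = 0\<close> contributes nothing to the sums and suprema below.\<close>

definition block_norm :: "(basis_index \<Rightarrow> complex) \<Rightarrow> nat \<Rightarrow> real" where
  "block_norm x n = L2_set (\<lambda>j. cmod (x j)) {j. block j = n}"

definition l_sum :: "ereal \<Rightarrow> basis_index seq_space" where
  "l_sum q =
     (if q = \<infinity> then
        \<lparr>vecs = {x. bdd_above (range (block_norm x))},
         nrm = (\<lambda>x. SUP n. block_norm x n)\<rparr>
      else
        \<lparr>vecs = {x. summable (\<lambda>n. block_norm x n powr real_of_ereal q)},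
         nrm = (\<lambda>x. (\<Sum>n. block_norm x n powr real_of_ereal q) powr (1 / real_of_ereal q))\<rparr>)"

text \<open>In a block with \<open>x\<^sup>k = 0\<close>, in particular everywhere if \<open>x = 0\<close>, the factor \<open>x j\<close> makes the value
  0, as the convention demands.\<close>

definition Omega :: "ereal \<Rightarrow> ereal \<Rightarrow> ereal \<Rightarrow> (basis_index \<Rightarrow> complex) \<Rightarrow> basis_index \<Rightarrow> complex" where
  "Omega p0 p1 p x = (\<lambda>j.
     of_real (real_of_ereal (p / p1 - p / p0) * ln (block_norm x (block j) / nrm (l_sum p) x)) * x j)"

end

theory Submission imports Defs "HOL-Complex_Analysis.Complex_Analysis" begin

text \<open>Write \<open>i0 = 1 / p0 < i1 = 1 / p1\<close> and \<open>\<beta> = i1 - i0\<close>, so that \<open>1 / p = i0 + \<beta> \<theta>\<close>, and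
attach to a vector \<open>x\<close> of the \<open>p\<close>-sum the masses \<open>c k = (block_norm x k / nrm x) powr p\<close>, which add
up to 1 unless \<open>x = 0\<close>. Only these masses matter, never the position of \<open>x\<close> inside a block.

Interpolation. Multiplying the block \<open>k\<close> of \<open>x\<close> by \<open>c k powr (\<beta> (z - \<theta>))\<close> gives an analytic function of \<open>z\<close>
that equals \<open>x\<close> at \<open>\<theta>\<close>, has derivative \<open>\<beta> ln (c k) x = \<Omega> x\<close> there, and has block norms
\<open>nrm x * c k powr i0\<close> and \<open>nrm x * c k powr i1\<close> on the two edges of the strip, hence norm \<open>nrm x\<close>
in either end space. This gives one inequality between the norms. For the other one, pair an arbitrary function
with the same construction for the conjugate exponents: Hoelder's inequality bounds the pairing on the
edges, the maximum principle bounds it inside, and at \<open>\<theta>\<close> it recovers the norm of a truncation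
(\<open>dual_function_exists\<close>, \<open>interpolation_estimate\<close>). If the function vanishes at \<open>\<theta>\<close>, Cauchy's
inequality bounds its derivative there in the same way (\<open>derivative_estimate\<close>). Applied to the difference of any
selection and the extremal function, this says that the derivative of the selection differs from
\<open>\<Omega>\<close> by a bounded map.

For \<open>p0 = \<infinity>\<close> the extremal function is not norm continuous on the left edge: its nonzero blocks all
have the same norm there and oscillate with unbounded frequencies. Replacing the masses by \<open>c k / v k\<close>, where
\<open>v\<close> tends to 0 so slowly that the new masses still add up to at most a prescribed \<open>B > 1\<close>
(\<open>vanishing_weight_exists\<close>), makes the tails uniformly small and costs only the factor \<open>B powr i1\<close>.
As \<open>v\<close> depends on the masses alone, and these do not change under scaling, this also yields a
homogeneous selection.

Singularity. On vectors living in a single block, the logarithm in \<open>\<Omega>\<close> is \<open>ln 1 = 0\<close>; the block \<open>n\<close> is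
spanned by \<open>n\<close> disjoint unit vectors, so the modulus of superdisjoint singularity is identically 0.
For an infinite disjoint sequence, only finitely many members touch a given finite set of blocks, so a
gliding hump yields normalized \<open>w i\<close> in its span that are almost supported in consecutive disjoint intervals of
blocks (\<open>hump_extraction\<close>). For any signs, \<open>\<Omega>\<close> of the signed sum of \<open>w 0, \<dots>, w (n - 1)\<close> differs from
the signed sum of the \<open>\<Omega> (w i)\<close> by about \<open>\<beta> ln n\<close> times a vector of norm about \<open>n powr (1 / p)\<close>
(\<open>Omega_sum_deviation_lower_bound\<close>). If \<open>L\<close> were a linear map at bounded distance from \<open>\<Omega>\<close>, this
difference would be at most the sum of two terms, of which one is \<open>O (n powr (1 / p))\<close> since the norm of
the signed sum is, and the other is a signed sum of bounded vectors \<open>\<Omega> (w i) - L (w i)\<close>. For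
\<open>p \<le> 2\<close> the space has type \<open>p\<close>, so some choice of signs makes the second term
\<open>O (n powr (1 / p))\<close> as well (\<open>sign_choice\<close>), and the logarithm gives a contradiction.\<close>

section \<open>Block norms and the unit balls of the sums\<close>

lemma block_norm_nonneg [simp]: "0 \<le> block_norm x k"
  by (simp add: block_norm_def)

lemma block_norm_zero [simp]: "block_norm 0 k = 0"
  by (simp add: block_norm_def L2_set_def zero_fun_def)

lemma block_norm_eq_0_iff: "block_norm x k = 0 \<longleftrightarrow> (\<forall>j. block j = k \<longrightarrow> x j = 0)"
  by (auto simp: block_norm_def L2_set_eq_0_iff finite_block)

lemma cmod_le_block_norm: "cmod (x j) \<le> block_norm x (block j)"
  unfolding block_norm_def by (intro member_le_L2_set) (auto simp: finite_block)

lemma block_norm_mono: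
  assumes "\<And>j. block j = k \<Longrightarrow> cmod (x j) \<le> cmod (y j)"
  shows "block_norm x k \<le> block_norm y k"
  unfolding block_norm_def by (intro L2_set_mono) (auto simp: assms)

lemma block_norm_cong:
  assumes "\<And>j. block j = k \<Longrightarrow> cmod (x j) = cmod (y j)"
  shows "block_norm x k = block_norm y k"
  unfolding block_norm_def by (intro L2_set_cong) (auto simp: assms)

lemma block_norm_scaled:
  assumes "0 \<le> c" "\<And>j. block j = k \<Longrightarrow> cmod (y j) = c * cmod (x j)"
  shows "block_norm y k = c * block_norm x k"
  unfolding block_norm_def L2_set_right_distrib[OF assms(1)]
  by (intro L2_set_cong) (auto simp: assms)

lemma block_norm_cscale: "block_norm (cscale c x) k = cmod c * block_norm x k"
  by (rule block_norm_scaled) (auto simp: cscale_def norm_mult)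

lemma block_norm_triangle: "block_norm (x + y) k \<le> block_norm x k + block_norm y k"
proof -
  have "block_norm (x + y) k \<le> L2_set (\<lambda>j. cmod (x j) + cmod (y j)) {j. block j = k}"
    unfolding block_norm_def by (intro L2_set_mono) (auto simp: norm_triangle_ineq)
  also have "\<dots> \<le> block_norm x k + block_norm y k"
    unfolding block_norm_def by (rule L2_set_triangle_ineq)
  finally show ?thesis .
qed

lemma block_norm_uminus: "block_norm (- x) k = block_norm x k"
  by (rule block_norm_cong) auto

lemma block_norm_triangle_diff: "block_norm (x - y) k \<le> block_norm x k + block_norm y k"
  using block_norm_triangle[of x "- y" k] by (simp add: block_norm_uminus)

lemma block_norm_power2: "(block_norm x k)\<^sup>2 = (\<Sum>j | block j = k. (cmod (x j))\<^sup>2)"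
  by (simp add: block_norm_def L2_set_def sum_nonneg)

text \<open>The closed ball of radius \<open>M\<close> in \<open>\<ell>\<^sub>q\<close>, for nonnegative sequences. It is phrased by partial sums, so that
membership and norm bound come in one condition and neither convergence nor the root has to be handled again;
\<open>lq_le_iff\<close> is the dictionary.\<close>

definition lq_le :: "ereal \<Rightarrow> (nat \<Rightarrow> real) \<Rightarrow> real \<Rightarrow> bool" where
  "lq_le q t M \<longleftrightarrow> 0 \<le> M \<and>
     (if q = \<infinity> then \<forall>k. t k \<le> M
      else \<forall>N. (\<Sum>k<N. t k powr real_of_ereal q) \<le> M powr real_of_ereal q)"

lemma lq_le_infty: "lq_le \<infinity> t M \<longleftrightarrow> 0 \<le> M \<and> (\<forall>k. t k \<le> M)"
  by (simp add: lq_le_def)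

lemma lq_le_ereal: "lq_le (ereal r) t M \<longleftrightarrow> 0 \<le> M \<and> (\<forall>N. (\<Sum>k<N. t k powr r) \<le> M powr r)"
  by (simp add: lq_le_def)

lemma lq_le_nonneg: "lq_le q t M \<Longrightarrow> 0 \<le> M"
  by (simp add: lq_le_def)

lemma exponent_cases:
  fixes q :: ereal
  assumes "1 \<le> q"
  obtains "q = \<infinity>" | r where "q = ereal r" "1 \<le> r"
  using assms by (cases q) auto

lemma lq_le_iff:
  assumes "1 \<le> q"
  shows "lq_le q (block_norm x) M \<longleftrightarrow> x \<in> vecs (l_sum q) \<and> nrm (l_sum q) x \<le> M"
  using assms
proof (cases rule: exponent_cases)
  case 1
  show ?thesis
  proof
    assume "lq_le q (block_norm x) M"
    then show "x \<in> vecs (l_sum q) \<and> nrm (l_sum q) x \<le> M"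
      by (auto simp: 1 lq_le_infty l_sum_def intro!: bdd_aboveI2 cSUP_least)
  next
    assume *: "x \<in> vecs (l_sum q) \<and> nrm (l_sum q) x \<le> M"
    then have "block_norm x k \<le> M" for k
      using cSUP_upper[of k UNIV "block_norm x"] by (force simp: 1 l_sum_def)
    then show "lq_le q (block_norm x) M"
      using order_trans[OF block_norm_nonneg] by (auto simp: 1 lq_le_infty)
  qed
next
  case (2 r)
  let ?f = "\<lambda>n. block_norm x n powr r"
  show ?thesis
  proof
    assume *: "lq_le q (block_norm x) M"
    then have s: "summable ?f"
      by (intro bounded_imp_summable[of _ "M powr r"])
         (auto simp: 2 lq_le_ereal lessThan_Suc_atMost[symmetric] simp del: sum.lessThan_Suc)
    have "suminf ?f \<le> M powr r"
      using * by (intro suminf_le_const s) (auto simp: 2 lq_le_ereal)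
    then have "suminf ?f powr (1/r) \<le> (M powr r) powr (1/r)"
      using 2 by (intro powr_mono2 suminf_nonneg s) auto
    then show "x \<in> vecs (l_sum q) \<and> nrm (l_sum q) x \<le> M"
      using s * 2 by (auto simp: l_sum_def powr_powr lq_le_ereal)
  next
    assume *: "x \<in> vecs (l_sum q) \<and> nrm (l_sum q) x \<le> M"
    then have s: "summable ?f" and le: "suminf ?f powr (1/r) \<le> M"
      by (auto simp: 2 l_sum_def)
    have M: "0 \<le> M" using le order_trans powr_ge_zero by blast
    have "suminf ?f = (suminf ?f powr (1/r)) powr r"
      using 2 s by (simp add: powr_powr suminf_nonneg)
    also have "\<dots> \<le> M powr r"
      using 2 le by (intro powr_mono2) auto
    finally have "suminf ?f \<le> M powr r" .
    moreover have "(\<Sum>k<N. ?f k) \<le> suminf ?f" for N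
      by (intro sum_le_suminf s) auto
    ultimately show "lq_le q (block_norm x) M"
      using M order_trans by (auto simp: 2 lq_le_ereal)
  qed
qed

lemma lq_le_nrm: "1 \<le> q \<Longrightarrow> x \<in> vecs (l_sum q) \<Longrightarrow> lq_le q (block_norm x) (nrm (l_sum q) x)"
  by (simp add: lq_le_iff)

lemma lq_le_mono:
  assumes "1 \<le> q" "lq_le q t M" "\<And>k. 0 \<le> s k" "\<And>k. s k \<le> t k" "M \<le> M'"
  shows "lq_le q s M'"
  using assms(1)
proof (cases rule: exponent_cases)
  case 1
  then show ?thesis using assms by (force simp: lq_le_infty intro: order_trans)
next
  case (2 r)
  have "(\<Sum>k<N. s k powr r) \<le> M' powr r" for N
  proof -
    have "(\<Sum>k<N. s k powr r) \<le> (\<Sum>k<N. t k powr r)"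
      using assms 2 by (intro sum_mono powr_mono2) auto
    also have "\<dots> \<le> M powr r" using assms 2 by (simp add: lq_le_ereal)
    also have "\<dots> \<le> M' powr r" using assms 2 by (intro powr_mono2) (auto simp: lq_le_ereal)
    finally show ?thesis .
  qed
  then show ?thesis using assms 2 by (auto simp: lq_le_ereal)
qed

lemma lq_le_component:
  assumes "1 \<le> q" "lq_le q t M" "\<And>k. 0 \<le> t k"
  shows "t k \<le> M"
  using assms(1)
proof (cases rule: exponent_cases)
  case 1
  then show ?thesis using assms by (auto simp: lq_le_infty)
next
  case (2 r)
  have "t k powr r \<le> (\<Sum>k<Suc k. t k powr r)"
    by (intro member_le_sum) auto
  also have "\<dots> \<le> M powr r" using assms 2 by (simp add: lq_le_ereal del: sum.lessThan_Suc)
  finally show ?thesis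
    using 2 assms by (meson lq_le_nonneg less_le_trans linorder_not_less powr_less_mono2 zero_less_one)
qed

lemma lq_le_scale:
  assumes "1 \<le> q" "lq_le q t M" "0 \<le> c" "\<And>k. 0 \<le> t k"
  shows "lq_le q (\<lambda>k. c * t k) (c * M)"
  using assms(1)
proof (cases rule: exponent_cases)
  case 1
  then show ?thesis using assms by (auto simp: lq_le_infty mult_left_mono)
next
  case (2 r)
  have "(\<Sum>k<N. (c * t k) powr r) \<le> (c * M) powr r" for N
    using assms 2 by (auto simp: powr_mult lq_le_ereal sum_distrib_left[symmetric] mult_left_mono)
  then show ?thesis using assms 2 by (auto simp: lq_le_ereal)
qed

text \<open>The convexity of \<open>x powr r\<close> on the closed half line; the endpoint 0 has to be added by hand to the open half line.\<close>

lemma powr_convex_combination: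
  fixes u v :: real
  assumes "1 \<le> r" "0 \<le> u" "0 \<le> v" "0 \<le> a" "0 \<le> b" "a + b = 1"
  shows "(a * u + b * v) powr r \<le> a * u powr r + b * v powr r"
proof -
  have shrink: "(c * w) powr r \<le> c * w powr r" if "0 \<le> c" "c \<le> 1" "0 \<le> w" for c w
  proof -
    have "c powr r \<le> c powr 1" using assms that by (intro powr_mono') auto
    then show ?thesis using that by (simp add: powr_mult mult_right_mono)
  qed
  consider "u = 0" | "v = 0" | "0 < u" "0 < v" using assms by linarith
  then show ?thesis
  proof cases
    case 3
    then show ?thesis
      using powr_convex[OF assms(1)] assms by (auto simp: convex_on_def)
  qed (use assms shrink in auto)
qed

text \<open>Minkowski's inequality. After division by the radii, \<open>(s + t) / (A + B)\<close> is a convex combination of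
\<open>s / A\<close> and \<open>t / B\<close>, so convexity of the power function applies term by term.\<close>

lemma lq_le_add:
  assumes "1 \<le> q" "lq_le q s A" "lq_le q t B" "\<And>k. 0 \<le> s k" "\<And>k. 0 \<le> t k"
  shows "lq_le q (\<lambda>k. s k + t k) (A + B)"
  using assms(1)
proof (cases rule: exponent_cases)
  case 1
  then show ?thesis using assms by (auto simp: lq_le_infty add_mono)
next
  case (2 r)
  have AB: "0 \<le> A" "0 \<le> B" using assms lq_le_nonneg by auto
  have "(\<Sum>k<N. (s k + t k) powr r) \<le> (A + B) powr r" for N
  proof (cases "A = 0 \<or> B = 0")
    case True
    then show ?thesis
    proof
      assume "A = 0"
      then have "s k = 0" for k
        using lq_le_component[OF assms(1,2,4), of k] assms(4)[of k] by simp
      then show ?thesis using assms 2 \<open>A = 0\<close> by (auto simp: lq_le_ereal)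
    next
      assume "B = 0"
      then have "t k = 0" for k
        using lq_le_component[OF assms(1,3,5), of k] assms(5)[of k] by simp
      then show ?thesis using assms 2 \<open>B = 0\<close> by (auto simp: lq_le_ereal)
    qed
  next
    case False
    with AB have pos: "0 < A" "0 < B" by auto
    define a b where "a = A / (A + B)" and "b = B / (A + B)"
    have ab: "0 \<le> a" "0 \<le> b" "a + b = 1"
      using pos by (auto simp: a_def b_def add_divide_distrib[symmetric])
    have pointwise: "(s k + t k) powr r \<le>
        (A + B) powr r * (a * (s k powr r / A powr r) + b * (t k powr r / B powr r))" for k
    proof -
      have "s k + t k = (A + B) * (a * (s k / A) + b * (t k / B))"
        using pos by (simp add: a_def b_def distrib_left)
      then have "(s k + t k) powr r = (A + B) powr r * (a * (s k / A) + b * (t k / B)) powr r"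
        using pos assms(4)[of k] assms(5)[of k] ab
        by (simp add: powr_mult)
      also have "\<dots> \<le> (A + B) powr r * (a * (s k / A) powr r + b * (t k / B) powr r)"
        using pos 2 ab assms(4)[of k] assms(5)[of k]
        by (intro mult_left_mono powr_convex_combination) auto
      finally show ?thesis
        using pos assms(4)[of k] assms(5)[of k] by (simp add: powr_divide)
    qed
    have "(\<Sum>k<N. (s k + t k) powr r) \<le> (\<Sum>k<N. (A + B) powr r *
        (a * (s k powr r / A powr r) + b * (t k powr r / B powr r)))"
      by (intro sum_mono pointwise)
    also have "\<dots> = (A + B) powr r *
        (a * ((\<Sum>k<N. s k powr r) / A powr r) + b * ((\<Sum>k<N. t k powr r) / B powr r))"
      by (simp add: sum_distrib_left sum.distrib sum_divide_distrib distrib_left)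
    also have "\<dots> \<le> (A + B) powr r * (a * 1 + b * 1)"
      using pos ab assms 2 by (intro mult_left_mono add_mono) (auto simp: lq_le_ereal)
    finally show ?thesis using ab by simp
  qed
  then show ?thesis using AB 2 by (auto simp: lq_le_ereal)
qed

text \<open>All terms are at most \<open>M\<close>, so the surplus power \<open>r' - r\<close> can be estimated by \<open>M\<close>.\<close>

lemma lq_le_exponent_mono:
  assumes "1 \<le> q" "q \<le> q'" "lq_le q t M" "\<And>k. 0 \<le> t k"
  shows "lq_le q' t M"
proof -
  have M: "0 \<le> M" using assms lq_le_nonneg by auto
  have comp: "t k \<le> M" for k using lq_le_component assms by metis
  have q': "1 \<le> q'" using assms by order
  show ?thesis
    using q'
  proof (cases rule: exponent_cases)
    case 1
    then show ?thesis using M comp by (simp add: lq_le_infty)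
  next
    case (2 r')
    then obtain r where r: "q = ereal r" "1 \<le> r" "r \<le> r'"
      using assms by (cases q) auto
    have "(\<Sum>k<N. t k powr r') \<le> M powr r'" for N
    proof -
      have "(\<Sum>k<N. t k powr r') \<le> (\<Sum>k<N. M powr (r' - r) * t k powr r)"
      proof (rule sum_mono)
        fix k
        have "t k powr r' = t k powr (r' - r) * t k powr r" by (simp add: powr_add[symmetric])
        also have "\<dots> \<le> M powr (r' - r) * t k powr r"
          using comp assms r by (intro mult_right_mono powr_mono2) auto
        finally show "t k powr r' \<le> M powr (r' - r) * t k powr r" .
      qed
      also have "\<dots> \<le> M powr (r' - r) * M powr r"
        unfolding sum_distrib_left[symmetric]
        using assms r by (intro mult_left_mono) (auto simp: lq_le_ereal)
      finally show ?thesis by (simp add: powr_add[symmetric])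
    qed
    then show ?thesis using M 2 by (simp add: lq_le_ereal)
  qed
qed

lemma lq_le_finite_sum:
  assumes "1 \<le> q" "\<And>k. 0 \<le> t k"
  shows "lq_le q (\<lambda>k. if k < K then t k else 0) (\<Sum>k<K. t k)"
proof (rule lq_le_exponent_mono[of 1])
  have "(\<Sum>k<N. (if k < K then t k else 0)) \<le> (\<Sum>k<K. t k)" for N
  proof -
    have "(\<Sum>k<N. (if k < K then t k else 0)) = (\<Sum>k \<in> {..<N} \<inter> {..<K}. t k)"
      by (simp add: sum.inter_restrict)
    also have "\<dots> \<le> (\<Sum>k<K. t k)"
      using assms by (intro sum_mono2) auto
    finally show ?thesis .
  qed
  moreover have "(\<Sum>k<N. (if k < K then t k else 0) powr 1) = (\<Sum>k<N. (if k < K then t k else 0))" for N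
    using assms by (intro sum.cong) auto
  ultimately show "lq_le 1 (\<lambda>k. if k < K then t k else 0) (\<Sum>k<K. t k)"
    using assms by (auto simp: one_ereal_def lq_le_ereal sum_nonneg simp del: powr_one')
qed (use assms in auto)

lemma l_sum_nrm_nonneg:
  assumes "1 \<le> q" "x \<in> vecs (l_sum q)"
  shows "0 \<le> nrm (l_sum q) x"
  using lq_le_nrm[OF assms] lq_le_nonneg by blast

lemma l_sum_add:
  assumes "1 \<le> q" "x \<in> vecs (l_sum q)" "y \<in> vecs (l_sum q)"
  shows "x + y \<in> vecs (l_sum q) \<and> nrm (l_sum q) (x + y) \<le> nrm (l_sum q) x + nrm (l_sum q) y"
  unfolding lq_le_iff[OF assms(1), symmetric]
  by (rule lq_le_mono[OF assms(1) lq_le_add[OF assms(1) lq_le_nrm[OF assms(1,2)] lq_le_nrm[OF assms(1,3)]]])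
     (use assms block_norm_triangle in auto)

lemma l_sum_cscale_le:
  assumes "1 \<le> q" "x \<in> vecs (l_sum q)"
  shows "cscale c x \<in> vecs (l_sum q) \<and> nrm (l_sum q) (cscale c x) \<le> cmod c * nrm (l_sum q) x"
  unfolding lq_le_iff[OF assms(1), symmetric] block_norm_cscale
  using lq_le_scale[OF assms(1) lq_le_nrm] assms by simp

lemma l_sum_cscale:
  assumes "1 \<le> q" "x \<in> vecs (l_sum q)"
  shows "nrm (l_sum q) (cscale c x) = cmod c * nrm (l_sum q) x"
proof (cases "c = 0")
  case True
  then show ?thesis
    using l_sum_cscale_le[OF assms, of c] l_sum_nrm_nonneg[of q "cscale c x"] assms by auto
next
  case False
  have "nrm (l_sum q) (cscale (inverse c) (cscale c x)) \<le> cmod (inverse c) * nrm (l_sum q) (cscale c x)"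
    using l_sum_cscale_le assms by blast
  moreover have "cscale (inverse c) (cscale c x) = x"
    using False by (simp add: cscale_def fun_eq_iff)
  ultimately have "cmod c * nrm (l_sum q) x \<le> nrm (l_sum q) (cscale c x)"
    using False by (simp add: norm_inverse norm_divide field_simps)
  then show ?thesis using l_sum_cscale_le[OF assms, of c] by simp
qed

lemma l_sum_minus:
  assumes "1 \<le> q" "x \<in> vecs (l_sum q)" "y \<in> vecs (l_sum q)"
  shows "x - y \<in> vecs (l_sum q) \<and> nrm (l_sum q) (x - y) \<le> nrm (l_sum q) x + nrm (l_sum q) y"
  unfolding lq_le_iff[OF assms(1), symmetric]
  by (rule lq_le_mono[OF assms(1) lq_le_add[OF assms(1) lq_le_nrm[OF assms(1,2)] lq_le_nrm[OF assms(1,3)]]])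
     (use assms block_norm_triangle_diff in auto)

lemma l_sum_zero: 
  assumes "1 \<le> q" shows "0 \<in> vecs (l_sum q)" "nrm (l_sum q) 0 = 0"
proof -
  have "lq_le q (block_norm 0) 0"
    using assms by (cases rule: exponent_cases) (auto simp: lq_le_infty lq_le_ereal)
  then show "0 \<in> vecs (l_sum q)" "nrm (l_sum q) 0 = 0"
    using l_sum_nrm_nonneg[OF assms] by (auto simp: lq_le_iff[OF assms] intro: antisym)
qed

lemma l_sum_exponent_mono:
  assumes "1 \<le> q" "q \<le> q'" "x \<in> vecs (l_sum q)"
  shows "x \<in> vecs (l_sum q') \<and> nrm (l_sum q') x \<le> nrm (l_sum q) x"
proof -
  have "1 \<le> q'" using assms by order
  then show ?thesis
    using lq_le_exponent_mono[OF assms(1,2) lq_le_nrm] assms by (simp add: lq_le_iff[symmetric])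
qed

lemma cmod_le_nrm:
  assumes "1 \<le> q" "x \<in> vecs (l_sum q)"
  shows "cmod (x j) \<le> nrm (l_sum q) x"
  using cmod_le_block_norm[of x j] lq_le_component[OF assms(1) lq_le_nrm[OF assms], of "block j"]
  by simp

lemma finitely_supported_in_l_sum:
  assumes "1 \<le> q" "\<And>j. K \<le> block j \<Longrightarrow> x j = 0"
  shows "x \<in> vecs (l_sum q)"
proof -
  have "block_norm x = (\<lambda>k. if k < K then block_norm x k else 0)"
    using assms(2) by (force simp: block_norm_eq_0_iff)
  then have "lq_le q (block_norm x) (\<Sum>k<K. block_norm x k)"
    using lq_le_finite_sum[OF assms(1), of "block_norm x" K] by simp
  then show ?thesis using lq_le_iff[OF assms(1)] by blast
qed

text \<open>For finite \<open>q\<close> this is just membership in \<open>\<ell>\<^sub>q\<close>; for \<open>q = \<infinity>\<close> it describes \<open>c\<^sub>0\<close>. It is what a majorant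
needs for dominated convergence in norm.\<close>

definition lq_vanishing_tails :: "ereal \<Rightarrow> (nat \<Rightarrow> real) \<Rightarrow> bool" where
  "lq_vanishing_tails q d \<longleftrightarrow> (\<forall>e>0. \<exists>K. lq_le q (\<lambda>k. if k < K then 0 else d k) e)"

text \<open>Dominated convergence: beyond some block the majorant is small, and finitely many coordinates remain.\<close>

lemma l_sum_dominated_tendsto_0:
  assumes "1 \<le> q" "lq_vanishing_tails q d"
    and dom: "eventually (\<lambda>w. \<forall>k. block_norm (G w) k \<le> d k) F"
    and lim: "\<And>j. ((\<lambda>w. G w j) \<longlongrightarrow> 0) F"
  shows "((\<lambda>w. nrm (l_sum q) (G w)) \<longlongrightarrow> 0) F"
proof (rule tendstoI)
  fix e :: real assume "0 < e"
  then obtain K where K: "lq_le q (\<lambda>k. if k < K then 0 else d k) (e/2)"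
    using assms(2) by (auto simp: lq_vanishing_tails_def dest: spec[of _ "e/2"])
  have "((\<lambda>w. block_norm (G w) k) \<longlongrightarrow> 0) F" for k
  proof -
    have "((\<lambda>w. sqrt (\<Sum>j | block j = k. (cmod (G w j))\<^sup>2)) \<longlongrightarrow> 
        sqrt (\<Sum>j | block j = k. (cmod 0)\<^sup>2)) F"
      by (intro tendsto_intros lim)
    then show ?thesis by (simp add: block_norm_def L2_set_def)
  qed
  then have "((\<lambda>w. \<Sum>k<K. block_norm (G w) k) \<longlongrightarrow> (\<Sum>k<K. 0)) F"
    by (intro tendsto_sum) auto
  then have "eventually (\<lambda>w. (\<Sum>k<K. block_norm (G w) k) < e/2) F"
    using \<open>0 < e\<close> by (intro order_tendstoD(2)) auto
  with dom show "eventually (\<lambda>w. dist (nrm (l_sum q) (G w)) 0 < e) F"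
  proof eventually_elim
    case (elim w)
    let ?S = "\<Sum>k<K. block_norm (G w) k"
    have tail: "lq_le q (\<lambda>k. if k < K then 0 else block_norm (G w) k) (e/2)"
      by (rule lq_le_mono[OF assms(1) K]) (use elim in auto)
    have "lq_le q (block_norm (G w)) (?S + e/2)"
      by (rule lq_le_mono[OF assms(1) lq_le_add[OF assms(1) lq_le_finite_sum[OF assms(1), of "block_norm (G w)" K] tail]])
         auto
    then have "G w \<in> vecs (l_sum q) \<and> nrm (l_sum q) (G w) \<le> ?S + e/2"
      using lq_le_iff[OF assms(1)] by blast
    then show ?case using elim l_sum_nrm_nonneg[OF assms(1)] by (auto simp: dist_norm)
  qed
qed

lemma lq_vanishing_tails_scale:
  assumes "1 \<le> q" "lq_vanishing_tails q d" "0 < c" "\<And>k. 0 \<le> d k"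
  shows "lq_vanishing_tails q (\<lambda>k. c * d k)"
  unfolding lq_vanishing_tails_def
proof (intro allI impI)
  fix e :: real assume "0 < e"
  then obtain K where K: "lq_le q (\<lambda>k. if k < K then 0 else d k) (e / c)"
    using assms by (auto simp: lq_vanishing_tails_def dest!: spec[of _ "e / c"])
  have "lq_le q (\<lambda>k. c * (if k < K then 0 else d k)) (c * (e / c))"
    using assms by (intro lq_le_scale[OF assms(1) K]) auto
  then have "lq_le q (\<lambda>k. if k < K then 0 else c * d k) e"
    using assms by (simp add: if_distrib cong: if_cong)
  then show "\<exists>K. lq_le q (\<lambda>k. if k < K then 0 else c * d k) e" ..
qed

lemma lq_vanishing_tails_mono:
  assumes "1 \<le> q" "lq_vanishing_tails q d" "\<And>k. 0 \<le> s k" "\<And>k. s k \<le> d k"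
  shows "lq_vanishing_tails q s"
  unfolding lq_vanishing_tails_def
proof (intro allI impI)
  fix e :: real assume "0 < e"
  then obtain K where K: "lq_le q (\<lambda>k. if k < K then 0 else d k) e"
    using assms by (auto simp: lq_vanishing_tails_def)
  have "lq_le q (\<lambda>k. if k < K then 0 else s k) e"
    by (rule lq_le_mono[OF assms(1) K]) (use assms in auto)
  then show "\<exists>K. lq_le q (\<lambda>k. if k < K then 0 else s k) e" ..
qed

lemma lq_vanishing_tails_infty:
  assumes "d \<longlonglongrightarrow> 0"
  shows "lq_vanishing_tails \<infinity> d"
  unfolding lq_vanishing_tails_def
proof (intro allI impI)
  fix e :: real assume "0 < e"
  then obtain K where "\<And>k. K \<le> k \<Longrightarrow> \<bar>d k\<bar> < e"
    using LIMSEQ_D[OF assms] by fastforce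
  then have "lq_le \<infinity> (\<lambda>k. if k < K then 0 else d k) e"
    using \<open>0 < e\<close> by (force simp: lq_le_infty not_less)
  then show "\<exists>K. lq_le \<infinity> (\<lambda>k. if k < K then 0 else d k) e" ..
qed

lemma lq_vanishing_tails_ereal:
  assumes "1 \<le> r" "lq_le (ereal r) d M"
  shows "lq_vanishing_tails (ereal r) d"
  unfolding lq_vanishing_tails_def
proof (intro allI impI)
  fix e :: real assume "0 < e"
  have s: "summable (\<lambda>k. d k powr r)"
    using assms(2) by (intro bounded_imp_summable[of _ "M powr r"])
      (auto simp: lq_le_ereal lessThan_Suc_atMost[symmetric] simp del: sum.lessThan_Suc)
  obtain K where K: "norm (\<Sum>i. d (i + K) powr r) < e powr r"
    using suminf_exist_split[OF _ s, of "e powr r"] \<open>0 < e\<close> by auto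
  have "(\<Sum>k<N. (if k < K then 0 else d k) powr r) \<le> e powr r" for N
  proof -
    define g where "g = (\<lambda>k. (if k < K then 0 else d k) powr r)"
    have "(\<Sum>k<N. g k) \<le> (\<Sum>k<K + N. g k)"
      by (rule sum_mono2) (auto simp: g_def)
    also have "\<dots> = (\<Sum>k<K. g k) + (\<Sum>i<N. g (i + K))"
      using sum.atLeastLessThan_concat[of 0 K "K + N" g] sum.shift_bounds_nat_ivl[of g 0 K N]
      by (simp add: atLeast0LessThan add.commute)
    also have "\<dots> = (\<Sum>i<N. d (i + K) powr r)"
      by (simp add: g_def)
    also have "\<dots> \<le> (\<Sum>i. d (i + K) powr r)"
      by (rule sum_le_suminf) (simp_all add: summable_ignore_initial_segment[OF s])
    finally show ?thesis unfolding g_def using K by simp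
  qed
  then have "lq_le (ereal r) (\<lambda>k. if k < K then 0 else d k) e"
    using \<open>0 < e\<close> by (simp add: lq_le_ereal)
  then show "\<exists>K. lq_le (ereal r) (\<lambda>k. if k < K then 0 else d k) e" ..
qed

section \<open>The maximum principle on the strip\<close>

lemma open_open_strip: "open open_strip"
  unfolding open_strip_def by (intro open_Collect_conj open_halfspace_Re_gt open_halfspace_Re_lt)

text \<open>The strip is unbounded, so \<open>g\<close> is first multiplied by \<open>exp (e (z\<^sup>2 - 1))\<close>, which has modulus at most
\<open>exp (- e (Im z)\<^sup>2)\<close> on the strip. On a sufficiently high rectangle the product is bounded by \<open>M + e\<close> on all
four sides; then \<open>e\<close> tends to 0.\<close>

lemma strip_maximum_principle:
  assumes cont: "continuous_on closed_strip g" and hol: "g holomorphic_on open_strip"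
    and bdd: "\<And>z. z \<in> closed_strip \<Longrightarrow> cmod (g z) \<le> K"
    and left: "\<And>t. cmod (g (Complex 0 t)) \<le> M" and right: "\<And>t. cmod (g (Complex 1 t)) \<le> M"
    and z: "z \<in> closed_strip"
  shows "cmod (g z) \<le> M"
proof -
  have K: "0 \<le> K" using bdd[OF z] norm_ge_zero order_trans by blast
  have M: "0 \<le> M" using left[of 0] norm_ge_zero order_trans by blast
  have cmod_exp: "cmod (exp (of_real e * (w\<^sup>2 - 1))) = exp (e * ((Re w)\<^sup>2 - (Im w)\<^sup>2 - 1))" for e w
    by (simp add: power2_eq_square)
  have bound: "cmod (g z) * exp (e * ((Re z)\<^sup>2 - (Im z)\<^sup>2 - 1)) \<le> M + e" if "0 < e" for e
  proof -
    \<comment> \<open>The height makes \<open>K exp (- e R\<^sup>2) \<le> e\<close> on the horizontal sides, as \<open>exp (e R\<^sup>2) \<ge> e R\<^sup>2 \<ge> e R\<close>.\<close>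
    define R where "R = max (\<bar>Im z\<bar>) (K / e\<^sup>2 + 1)"
    define u where "u = (\<lambda>w. g w * exp (of_real e * (w\<^sup>2 - 1)))"
    define S where "S = cbox (Complex 0 (-R)) (Complex 1 R)"
    have R: "\<bar>Im z\<bar> \<le> R" "K / e\<^sup>2 \<le> R" "1 \<le> R"
      using divide_nonneg_nonneg[OF K, of "e\<^sup>2"] by (auto simp: R_def)
    have S_sub: "S \<subseteq> closed_strip" and box_sub: "box (Complex 0 (-R)) (Complex 1 R) \<subseteq> open_strip"
      by (auto simp: S_def closed_strip_def open_strip_def in_cbox_complex_iff in_box_complex_iff)
    have "cmod (u z) \<le> M + e"
    proof (rule maximum_modulus_frontier[of u S])
      show "u holomorphic_on interior S"
        unfolding u_def S_def interior_cbox
        by (intro holomorphic_intros holomorphic_on_subset[OF hol box_sub])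
      show "continuous_on (closure S) u"
        unfolding u_def using continuous_on_subset[OF cont S_sub]
        by (auto simp: S_def intro!: continuous_intros)
      show "bounded S" by (simp add: S_def)
      show "z \<in> S"
        using z R by (auto simp: S_def closed_strip_def in_cbox_complex_iff)
    next
      fix w assume "w \<in> frontier S"
      then have w: "w \<in> S" and wb: "w \<notin> box (Complex 0 (-R)) (Complex 1 R)"
        by (auto simp: S_def frontier_def)
      then have wst: "0 \<le> Re w" "Re w \<le> 1"
        by (auto simp: S_def in_cbox_complex_iff)
      then have "(Re w)\<^sup>2 \<le> 1" by (simp add: power_le_one)
      then have le: "e * ((Re w)\<^sup>2 - (Im w)\<^sup>2 - 1) \<le> - (e * (Im w)\<^sup>2)"
        using \<open>0 < e\<close> mult_left_mono[of "(Re w)\<^sup>2 - (Im w)\<^sup>2 - 1" "- (Im w)\<^sup>2" e] by simp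
      have norm_u: "cmod (u w) = cmod (g w) * exp (e * ((Re w)\<^sup>2 - (Im w)\<^sup>2 - 1))"
        by (simp only: u_def norm_mult cmod_exp)
      consider "w = Complex 0 (Im w)" | "w = Complex 1 (Im w)" | "\<bar>Im w\<bar> = R"
        using w wb by (force simp: S_def in_cbox_complex_iff in_box_complex_iff complex_eq_iff)
      then show "cmod (u w) \<le> M + e"
      proof cases
        case 3
        then have "(Im w)\<^sup>2 = R\<^sup>2" by (metis power2_abs)
        have "e * R\<^sup>2 < exp (e * R\<^sup>2)" using exp_ge_add_one_self[of "e * R\<^sup>2"] by linarith
        moreover have "K \<le> e * (e * R\<^sup>2)"
        proof -
          have "K \<le> e\<^sup>2 * R" using R \<open>0 < e\<close> by (simp add: field_simps)
          also have "\<dots> \<le> e\<^sup>2 * R\<^sup>2"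
            using R by (intro mult_left_mono) (auto simp: power2_eq_square)
          finally show ?thesis by (simp add: power2_eq_square mult_ac)
        qed
        ultimately have "K \<le> e * exp (e * R\<^sup>2)"
          using \<open>0 < e\<close> by (smt (verit) mult_left_mono)
        then have "K * exp (- (e * R\<^sup>2)) \<le> e" by (simp add: exp_minus field_simps)
        moreover have "cmod (u w) \<le> K * exp (- (e * R\<^sup>2))"
          unfolding norm_u using le \<open>(Im w)\<^sup>2 = R\<^sup>2\<close> bdd[of w] w S_sub K
          by (intro mult_mono) auto
        ultimately show ?thesis using M by linarith
      next
        case 1
        have "cmod (u w) \<le> M * 1"
          unfolding norm_u using left[of "Im w"] 1 le \<open>0 < e\<close> M
          by (intro mult_mono) (auto intro: order_trans)
        then show ?thesis using \<open>0 < e\<close> by simp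
      next
        case 2
        have "cmod (u w) \<le> M * 1"
          unfolding norm_u using right[of "Im w"] 2 le \<open>0 < e\<close> M
          by (intro mult_mono) (auto intro: order_trans)
        then show ?thesis using \<open>0 < e\<close> by simp
      qed
    qed
    then show ?thesis by (simp only: u_def norm_mult cmod_exp)
  qed
  show ?thesis
  proof (rule tendsto_le[OF trivial_limit_at_right_real])
    show "((\<lambda>e. M + e) \<longlongrightarrow> M) (at_right 0)" by real_asymp
    show "((\<lambda>e. cmod (g z) * exp (e * ((Re z)\<^sup>2 - (Im z)\<^sup>2 - 1))) \<longlongrightarrow> cmod (g z)) (at_right 0)"
      by (auto intro!: tendsto_eq_intros)
    show "\<forall>\<^sub>F e in at_right 0. cmod (g z) * exp (e * ((Re z)\<^sup>2 - (Im z)\<^sup>2 - 1)) \<le> M + e"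
      using bound by (auto simp: eventually_at_right_less eventually_at_filter)
  qed
qed

section \<open>Duality and the interpolation inequality\<close>

definition recip :: "ereal \<Rightarrow> real" where
  "recip q = real_of_ereal (inverse q)"

lemma recip_simps [simp]: "recip \<infinity> = 0" "recip (ereal r) = 1 / r"
  by (auto simp: recip_def divide_inverse)

text \<open>Hoelder's inequality with the second factor written as \<open>w powr (1 - 1 / q)\<close>. In this form the conjugate exponent
never appears, and \<open>q = 1\<close> and \<open>q = \<infinity>\<close> are covered as well.\<close>

lemma lq_le_holder:
  assumes "1 \<le> q" "lq_le q t M" "\<And>k. 0 \<le> t k" "\<And>k. 0 \<le> w k" "(\<Sum>k<N. w k) \<le> 1"
  shows "(\<Sum>k<N. t k * w k powr (1 - recip q)) \<le> M"
  using assms(1)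
proof (cases rule: exponent_cases)
  case 1
  have "(\<Sum>k<N. t k * w k powr (1 - recip q)) \<le> (\<Sum>k<N. M * w k)"
    using assms by (intro sum_mono) (auto simp: 1 lq_le_infty mult_right_mono)
  also have "\<dots> \<le> M * 1"
    unfolding sum_distrib_left[symmetric] using assms lq_le_nonneg by (intro mult_left_mono) auto
  finally show ?thesis by simp
next
  case (2 r)
  show ?thesis
  proof (cases "M = 0")
    case True
    then have "t k = 0" for k using lq_le_component[OF assms(1-3), of k] assms(3)[of k] by simp
    then show ?thesis using True by simp
  next
    case False
    then have M: "0 < M" using assms(2) lq_le_nonneg by force
    have "(\<Sum>k<N. t k * w k powr (1 - recip q)) \<le>
        (\<Sum>k<N. M * ((1/r) * (t k powr r / M powr r) + (1 - 1/r) * w k))"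
    proof (rule sum_mono)
      fix k
      have "t k / M * w k powr (1 - 1/r) \<le> (1/r) * (t k powr r / M powr r) + (1 - 1/r) * w k"
      proof (cases "t k = 0 \<or> w k = 0")
        case False
        then have pos: "0 < t k" "0 < w k" using assms(3)[of k] assms(4)[of k] by auto
        have "((t k / M) powr r) powr (1/r) * w k powr (1 - 1/r)
            \<le> (1/r) * (t k / M) powr r + (1 - 1/r) * w k"
          using pos M 2 by (intro Youngs_inequality_0) auto
        then show ?thesis using pos M 2 by (simp add: powr_powr powr_divide)
      qed (use assms(4)[of k] 2 in auto)
      then have "M * (t k / M * w k powr (1 - 1/r)) \<le> M * ((1/r) * (t k powr r / M powr r) + (1 - 1/r) * w k)"
        using M by (intro mult_left_mono) auto
      then show "t k * w k powr (1 - recip q) \<le> M * ((1/r) * (t k powr r / M powr r) + (1 - 1/r) * w k)"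
        using M 2 by simp
    qed
    also have "\<dots> = M * ((1/r) * ((\<Sum>k<N. t k powr r) / M powr r) + (1 - 1/r) * (\<Sum>k<N. w k))"
      by (simp add: sum_distrib_left sum.distrib sum_divide_distrib distrib_left)
    also have "\<dots> \<le> M * ((1/r) * 1 + (1 - 1/r) * 1)"
      using assms 2 M by (intro mult_left_mono add_mono) (auto simp: lq_le_ereal)
    finally show ?thesis by simp
  qed
qed

lemma finite_blocks_below: "finite {j. block j < N}"
proof -
  have "{j. block j < N} = (\<Union>k<N. {j. block j = k})" by auto
  then show ?thesis by (simp add: finite_block)
qed

lemma sum_blocks_below:
  "(\<Sum>j | block j < N. f j) = (\<Sum>k<N. \<Sum>j | block j = k. f j)"
proof -
  have "(\<Sum>j | block j < N. f j) = (\<Sum>k<N. \<Sum>j | j \<in> {j. block j < N} \<and> block j = k. f j)"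
    by (rule sum.group[symmetric]) (auto simp: finite_blocks_below)
  also have "\<dots> = (\<Sum>k<N. \<Sum>j | block j = k. f j)"
    by (intro sum.cong) auto
  finally show ?thesis .
qed

lemma pairing_le:
  "cmod (\<Sum>j | block j < N. v j * h j) \<le> (\<Sum>k<N. block_norm v k * block_norm h k)"
proof -
  have "cmod (\<Sum>j | block j < N. v j * h j) \<le> (\<Sum>k<N. cmod (\<Sum>j | block j = k. v j * h j))"
    unfolding sum_blocks_below by (rule norm_sum)
  also have "\<dots> \<le> (\<Sum>k<N. block_norm v k * block_norm h k)"
  proof (rule sum_mono)
    fix k
    have "cmod (\<Sum>j | block j = k. v j * h j) \<le> (\<Sum>j | block j = k. \<bar>cmod (v j)\<bar> * \<bar>cmod (h j)\<bar>)"
      by (rule order_trans[OF norm_sum]) (simp add: norm_mult)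
    also have "\<dots> \<le> block_norm v k * block_norm h k"
      unfolding block_norm_def by (rule L2_set_mult_ineq)
    finally show "cmod (\<Sum>j | block j = k. v j * h j) \<le> block_norm v k * block_norm h k" .
  qed
  finally show ?thesis .
qed

lemma lq_le_powr_recip:
  assumes "1 \<le> q" "\<And>k. 0 \<le> c k" "\<And>N. (\<Sum>k<N. c k) \<le> B" "0 < B"
  shows "lq_le q (\<lambda>k. c k powr recip q) (B powr recip q)"
  using assms(1)
proof (cases rule: exponent_cases)
  case 1
  then show ?thesis using assms by (simp add: lq_le_infty)
next
  case (2 r)
  then show ?thesis using assms by (simp add: lq_le_ereal powr_powr)
qed

locale interpolation_exponents =
  fixes p0 p1 :: ereal and P \<theta> :: real
  assumes p1: "1 \<le> p1" and p01: "p1 < p0" and \<theta>: "0 < \<theta>" "\<theta> < 1"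
    and P: "1 / P = (1 - \<theta>) * recip p0 + \<theta> * recip p1"
begin

lemma p0: "1 \<le> p0"
  using p1 p01 by order

lemma p1_finite: obtains r where "p1 = ereal r" "1 \<le> r"
  using p1 p01 by (cases p1) auto

lemma recip_less: "0 \<le> recip p0" "recip p0 < recip p1" "recip p1 \<le> 1" "0 < recip p1"
proof -
  obtain r where r: "p1 = ereal r" "1 \<le> r" by (rule p1_finite)
  show "0 \<le> recip p0" "recip p0 < recip p1" "recip p1 \<le> 1" "0 < recip p1"
    using r p01 p0 by (cases p0; auto simp: divide_strict_left_mono)+
qed

lemma recip_P: "recip p0 < 1 / P" "1 / P < recip p1"
proof -
  have "1 / P = recip p0 + \<theta> * (recip p1 - recip p0)" "1 / P = recip p1 - (1 - \<theta>) * (recip p1 - recip p0)"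
    unfolding P by (auto simp: algebra_simps)
  moreover have "0 < \<theta> * (recip p1 - recip p0)" "0 < (1 - \<theta>) * (recip p1 - recip p0)"
    using recip_less \<theta> by auto
  ultimately show "recip p0 < 1 / P" "1 / P < recip p1" by linarith+
qed

lemma P_gt_1: "1 < P"
proof -
  have "0 < 1 / P" "1 / P < 1" using recip_P recip_less by linarith+
  then show ?thesis by (simp add: field_simps split: if_splits)
qed

lemma P_bounds: "p1 < ereal P" "ereal P < p0"
proof -
  obtain r where r: "p1 = ereal r" "1 \<le> r" by (rule p1_finite)
  show "p1 < ereal P" using r recip_P P_gt_1 by (auto simp: field_simps)
  show "ereal P < p0" using recip_P P_gt_1 p0 by (cases p0) (auto simp: field_simps)
qed

lemma P_ereal: "1 \<le> ereal P"
  using P_gt_1 by simp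

text \<open>A coordinatewise version of the Calderon norm, without norm continuity. The extremal function of a vector always
satisfies it with the optimal constant, even when \<open>p0 = \<infinity>\<close>, where that function need not lie in the Calderon space.\<close>

definition strip_bounded :: "real \<Rightarrow> (complex \<Rightarrow> basis_index \<Rightarrow> complex) \<Rightarrow> bool" where
  "strip_bounded M f \<longleftrightarrow>
     (\<forall>j. continuous_on closed_strip (\<lambda>z. f z j) \<and> (\<lambda>z. f z j) holomorphic_on open_strip \<and>
        (\<exists>K. \<forall>z\<in>closed_strip. cmod (f z j) \<le> K)) \<and>
     (\<forall>t. lq_le p0 (block_norm (f (Complex 0 t))) M \<and> lq_le p1 (block_norm (f (Complex 1 t))) M)"

text \<open>\<open>h\<close> is the extremal function of the norming functional of \<open>y\<close>. Let \<open>w k = (block_norm y k / S) powr P\<close>; these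
add up to 1 over \<open>k < N\<close>. The block \<open>k\<close> of \<open>h z\<close> is the unit vector conjugate to \<open>y\<close>, times \<open>w k\<close> to the power
\<open>1 - (1 - z) / p0 - z / p1\<close>. This exponent has real part \<open>1 - 1 / p0\<close> and \<open>1 - 1 / p1\<close> on the edges, as
\<open>lq_le_holder\<close> wants, and it is \<open>1 - 1 / P\<close> at \<open>\<theta>\<close>, where the pairing with \<open>y\<close> gives \<open>S\<close>.\<close>

lemma dual_function_exists:
  assumes S: "0 < S" "S powr P = (\<Sum>k<N. block_norm y k powr P)"
  obtains h :: "complex \<Rightarrow> basis_index \<Rightarrow> complex" where
    "\<And>j. (\<lambda>z. h z j) holomorphic_on UNIV"
    "\<And>z j. z \<in> closed_strip \<Longrightarrow> block j < N \<Longrightarrow> cmod (h z j) \<le> 1"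
    "(\<Sum>j | block j < N. y j * h (of_real \<theta>) j) = of_real S"
    "\<And>v M t. lq_le p0 (block_norm v) M \<Longrightarrow> cmod (\<Sum>j | block j < N. v j * h (Complex 0 t) j) \<le> M"
    "\<And>v M t. lq_le p1 (block_norm v) M \<Longrightarrow> cmod (\<Sum>j | block j < N. v j * h (Complex 1 t) j) \<le> M"
proof -
  define c where "c = block_norm y"
  define w where "w = (\<lambda>k. (c k / S) powr P)"
  define e :: "complex \<Rightarrow> complex" where "e = (\<lambda>z. 1 - (1 - z) * of_real (recip p0) - z * of_real (recip p1))"
  define h where "h = (\<lambda>z j. cnj (y j) / of_real (c (block j)) * exp (e z * of_real (ln (w (block j)))))"
  have c0: "0 \<le> c k" and w0: "0 \<le> w k" for k by (auto simp: c_def w_def)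
  have sum_w: "(\<Sum>k<N. w k) = 1"
    using S c0 by (simp add: w_def powr_divide sum_divide_distrib[symmetric] c_def flip: S(2))
  have w1: "w k \<le> 1" if "k < N" for k
    using member_le_sum[of k "{..<N}" w] that w0 sum_w by simp
  have bn_h: "block_norm (h z) k \<le> w k powr Re (e z)" for z k
  proof (cases "c k = 0")
    case True
    then have "block_norm (h z) k = 0"
      by (auto simp: h_def block_norm_eq_0_iff)
    then show ?thesis by simp
  next
    case False
    then have pos: "0 < c k" "0 < w k" using c0[of k] S by (auto simp: w_def)
    have "block_norm (h z) k = w k powr Re (e z) / c k * block_norm y k"
      using pos by (intro block_norm_scaled) (auto simp: h_def norm_mult norm_divide powr_def)
    then show ?thesis using pos by (simp add: c_def)
  qed
  have Re_e: "Re (e z) = 1 - (1 - Re z) * recip p0 - Re z * recip p1" for z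
    by (simp add: e_def)
  have pair: "cmod (\<Sum>j | block j < N. v j * h z j) \<le> M"
    if v: "lq_le q (block_norm v) M" and q: "1 \<le> q" and z: "Re (e z) = 1 - recip q" for v M q z
  proof -
    have "cmod (\<Sum>j | block j < N. v j * h z j) \<le> (\<Sum>k<N. block_norm v k * block_norm (h z) k)"
      by (rule pairing_le)
    also have "\<dots> \<le> (\<Sum>k<N. block_norm v k * w k powr (1 - recip q))"
      using bn_h[of z] z by (intro sum_mono mult_left_mono) auto
    also have "\<dots> \<le> M"
      by (rule lq_le_holder[OF q v]) (use w0 sum_w in auto)
    finally show ?thesis .
  qed
  show thesis
  proof (rule that[of h])
    show "(\<lambda>z. h z j) holomorphic_on UNIV" for j
      unfolding h_def e_def divide_inverse by (intro holomorphic_intros)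
    show "cmod (h z j) \<le> 1" if "z \<in> closed_strip" "block j < N" for z j
    proof -
      have "0 \<le> Re (e z)"
      proof -
        have "(1 - Re z) * recip p0 + Re z * recip p1 \<le> (1 - Re z) * 1 + Re z * 1"
          using that recip_less by (intro add_mono mult_left_mono) (auto simp: closed_strip_def)
        then show ?thesis unfolding Re_e by simp
      qed
      then have "w (block j) powr Re (e z) \<le> 1"
        using w1[OF that(2)] w0 by (simp add: powr_le1)
      then show ?thesis using cmod_le_block_norm[of "h z" j] bn_h[of z "block j"] by linarith
    qed
    show "cmod (\<Sum>j | block j < N. v j * h (Complex 0 t) j) \<le> M" if "lq_le p0 (block_norm v) M" for v M t
      by (rule pair[OF that p0]) (simp add: Re_e)
    show "cmod (\<Sum>j | block j < N. v j * h (Complex 1 t) j) \<le> M" if "lq_le p1 (block_norm v) M" for v M t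
      by (rule pair[OF that p1]) (simp add: Re_e)
    have "(\<Sum>j | block j = k. y j * h (of_real \<theta>) j) = of_real (S * w k)" for k
    proof (cases "c k = 0")
      case True
      then have "y j = 0" if "block j = k" for j using that by (auto simp: c_def block_norm_eq_0_iff)
      then show ?thesis using True by (simp add: w_def)
    next
      case False
      then have pos: "0 < c k" using c0[of k] by simp
      have e\<theta>: "e (of_real \<theta>) = of_real (1 - 1 / P)"
        unfolding e_def P by (simp add: algebra_simps)
      have "exp (e (of_real \<theta>) * of_real (ln (w k))) = of_real ((c k / S) powr (P - 1))"
      proof -
        have "(1 - 1 / P) * ln (w k) = (P - 1) * ln (c k / S)"
          using pos S P_gt_1 by (simp add: w_def ln_powr field_simps)
        then show ?thesis
          unfolding e\<theta> of_real_mult[symmetric] exp_of_real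
          using pos S(1) by (simp only: powr_def) simp
      qed
      then have "(\<Sum>j | block j = k. y j * h (of_real \<theta>) j)
          = (\<Sum>j | block j = k. of_real ((cmod (y j))\<^sup>2)) * of_real ((c k / S) powr (P - 1) / c k)"
        unfolding h_def sum_distrib_right
        by (intro sum.cong) (auto simp: complex_norm_square simp del: of_real_power)
      also have "\<dots> = of_real ((c k)\<^sup>2 * ((c k / S) powr (P - 1) / c k))"
        by (simp add: c_def block_norm_power2)
      also have "(c k)\<^sup>2 * ((c k / S) powr (P - 1) / c k) = S * ((c k / S) powr (P - 1) * (c k / S) powr 1)"
        using pos S by (simp add: power2_eq_square)
      also have "\<dots> = S * w k"
        unfolding powr_add[symmetric] by (simp add: w_def)
      finally show ?thesis .
    qed
    then have "(\<Sum>j | block j < N. y j * h (of_real \<theta>) j) = (\<Sum>k<N. of_real (S * w k))"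
      by (simp only: sum_blocks_below)
    also have "\<dots> = of_real S"
      using sum_w by (simp flip: of_real_sum sum_distrib_left)
    finally show "(\<Sum>j | block j < N. y j * h (of_real \<theta>) j) = of_real S" .
  qed
qed

lemma strip_bounded_pairing_le:
  assumes f: "strip_bounded M f" and h: "\<And>j. (\<lambda>z. h z j) holomorphic_on UNIV"
    "\<And>z j. z \<in> closed_strip \<Longrightarrow> block j < N \<Longrightarrow> cmod (h z j) \<le> 1"
    "\<And>v M t. lq_le p0 (block_norm v) M \<Longrightarrow> cmod (\<Sum>j | block j < N. v j * h (Complex 0 t) j) \<le> M"
    "\<And>v M t. lq_le p1 (block_norm v) M \<Longrightarrow> cmod (\<Sum>j | block j < N. v j * h (Complex 1 t) j) \<le> M"
  shows "continuous_on closed_strip (\<lambda>z. \<Sum>j | block j < N. f z j * h z j)"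
    "(\<lambda>z. \<Sum>j | block j < N. f z j * h z j) holomorphic_on open_strip"
    "\<And>z. z \<in> closed_strip \<Longrightarrow> cmod (\<Sum>j | block j < N. f z j * h z j) \<le> M"
proof -
  let ?g = "\<lambda>z. \<Sum>j | block j < N. f z j * h z j"
  have f': "continuous_on closed_strip (\<lambda>z. f z j)" "(\<lambda>z. f z j) holomorphic_on open_strip" for j
    using f by (auto simp: strip_bounded_def)
  have h': "continuous_on S (\<lambda>z. h z j)" "(\<lambda>z. h z j) holomorphic_on S" for j S
    using holomorphic_on_subset[OF h(1)] holomorphic_on_imp_continuous_on by blast+
  show c: "continuous_on closed_strip ?g"
    by (intro continuous_intros f' h')
  show hol: "?g holomorphic_on open_strip"
    by (intro holomorphic_intros f' h')
  obtain K where K: "\<And>j z. z \<in> closed_strip \<Longrightarrow> cmod (f z j) \<le> K j"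
    using f unfolding strip_bounded_def by metis
  show "cmod (?g z) \<le> M" if "z \<in> closed_strip" for z
  proof (rule strip_maximum_principle[OF c hol _ _ _ that])
    show "cmod (?g z) \<le> (\<Sum>j | block j < N. K j * 1)" if z: "z \<in> closed_strip" for z
    proof (intro sum_norm_le)
      fix j assume "j \<in> {j. block j < N}"
      then show "cmod (f z j * h z j) \<le> K j * 1"
        unfolding norm_mult using order_trans[OF norm_ge_zero K[OF z]]
        by (intro mult_mono K[OF z] h(2)[OF z]) auto
    qed
  qed (use f h in \<open>auto simp: strip_bounded_def\<close>)
qed

lemma lq_le_from_duality:
  assumes "\<And>N S. 0 < S \<Longrightarrow> S powr P = (\<Sum>k<N. block_norm y k powr P) \<Longrightarrow> S \<le> M" "0 \<le> M"
  shows "lq_le (ereal P) (block_norm y) M"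
proof -
  have "(\<Sum>k<N. block_norm y k powr P) \<le> M powr P" for N
  proof (cases "(\<Sum>k<N. block_norm y k powr P) = 0")
    case False
    let ?s = "\<Sum>k<N. block_norm y k powr P"
    have pos: "0 < ?s" using False by (simp add: sum_nonneg order_less_le)
    then have "?s powr (1/P) \<le> M"
      using P_gt_1 by (intro assms(1)[of _ N]) (auto simp: powr_powr)
    then have "(?s powr (1/P)) powr P \<le> M powr P"
      using P_gt_1 by (intro powr_mono2) auto
    then show ?thesis using P_gt_1 pos by (simp add: powr_powr)
  qed auto
  then show ?thesis using assms by (simp add: lq_le_ereal)
qed

lemma theta_in_strip: "complex_of_real \<theta> \<in> open_strip" "complex_of_real \<theta> \<in> closed_strip"
  using \<theta> by (auto simp: open_strip_def closed_strip_def)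

lemma strip_bounded_nonneg: "strip_bounded M f \<Longrightarrow> 0 \<le> M"
  by (auto simp: strip_bounded_def dest: lq_le_nonneg)

text \<open>The pairing of \<open>f\<close> with the dual function of a truncation of \<open>f \<theta>\<close> is bounded by \<open>M\<close> on the strip, and at \<open>\<theta>\<close> it is
the norm of the truncation.\<close>

lemma interpolation_estimate:
  assumes f: "strip_bounded M f"
  shows "lq_le (ereal P) (block_norm (f (of_real \<theta>))) M"
proof (rule lq_le_from_duality[OF _ strip_bounded_nonneg[OF f]])
  fix N S assume S: "0 < S" "S powr P = (\<Sum>k<N. block_norm (f (of_real \<theta>)) k powr P)"
  obtain h where h: "\<And>j. (\<lambda>z. h z j) holomorphic_on UNIV"
    "\<And>z j. z \<in> closed_strip \<Longrightarrow> block j < N \<Longrightarrow> cmod (h z j) \<le> 1"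
    "(\<Sum>j | block j < N. f (of_real \<theta>) j * h (of_real \<theta>) j) = of_real S"
    "\<And>v M t. lq_le p0 (block_norm v) M \<Longrightarrow> cmod (\<Sum>j | block j < N. v j * h (Complex 0 t) j) \<le> M"
    "\<And>v M t. lq_le p1 (block_norm v) M \<Longrightarrow> cmod (\<Sum>j | block j < N. v j * h (Complex 1 t) j) \<le> M"
    using dual_function_exists[OF S] by blast
  show "S \<le> M"
    using strip_bounded_pairing_le(3)[OF f h(1,2,4,5) theta_in_strip(2)] S unfolding h(3) by simp
qed

text \<open>Now the dual function is that of the derivative. As \<open>f\<close> vanishes at \<open>\<theta>\<close>, the derivative of the pairing there is the pairing
of the derivative of \<open>f\<close>, and Cauchy's inequality applies on the largest disc around \<open>\<theta>\<close> inside the strip.\<close>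

lemma derivative_estimate:
  assumes f: "strip_bounded M f" and zero: "f (of_real \<theta>) = 0"
  shows "lq_le (ereal P) (block_norm (\<lambda>j. deriv (\<lambda>z. f z j) (of_real \<theta>))) (M / min \<theta> (1 - \<theta>))"
proof (rule lq_le_from_duality)
  let ?\<rho> = "min \<theta> (1 - \<theta>)" and ?y = "\<lambda>j. deriv (\<lambda>z. f z j) (of_real \<theta>)"
  have \<rho>: "0 < ?\<rho>" using \<theta> by simp
  fix N S assume S: "0 < S" "S powr P = (\<Sum>k<N. block_norm ?y k powr P)"
  obtain h where h: "\<And>j. (\<lambda>z. h z j) holomorphic_on UNIV"
    "\<And>z j. z \<in> closed_strip \<Longrightarrow> block j < N \<Longrightarrow> cmod (h z j) \<le> 1"
    "(\<Sum>j | block j < N. ?y j * h (of_real \<theta>) j) = of_real S"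
    "\<And>v M t. lq_le p0 (block_norm v) M \<Longrightarrow> cmod (\<Sum>j | block j < N. v j * h (Complex 0 t) j) \<le> M"
    "\<And>v M t. lq_le p1 (block_norm v) M \<Longrightarrow> cmod (\<Sum>j | block j < N. v j * h (Complex 1 t) j) \<le> M"
    using dual_function_exists[OF S] by blast
  define g where "g = (\<lambda>z. \<Sum>j | block j < N. f z j * h z j)"
  have g: "continuous_on closed_strip g" "g holomorphic_on open_strip"
    "\<And>z. z \<in> closed_strip \<Longrightarrow> cmod (g z) \<le> M"
    unfolding g_def by (rule strip_bounded_pairing_le[OF f h(1,2,4,5)]; assumption)+
  have dist: "\<bar>Re z - \<theta>\<bar> \<le> dist (of_real \<theta>) z" for z
    using abs_Re_le_cmod[of "z - of_real \<theta>"] by (simp add: dist_norm norm_minus_commute)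
  have cb: "cball (of_real \<theta>) ?\<rho> \<subseteq> closed_strip" "ball (of_real \<theta>) ?\<rho> \<subseteq> open_strip"
  proof -
    show "cball (of_real \<theta>) ?\<rho> \<subseteq> closed_strip"
    proof
      fix z :: complex assume "z \<in> cball (of_real \<theta>) ?\<rho>"
      then have "\<bar>Re z - \<theta>\<bar> \<le> ?\<rho>" using dist[of z] by simp
      then show "z \<in> closed_strip" by (auto simp: closed_strip_def)
    qed
    show "ball (of_real \<theta>) ?\<rho> \<subseteq> open_strip"
    proof
      fix z :: complex assume "z \<in> ball (of_real \<theta>) ?\<rho>"
      then have "\<bar>Re z - \<theta>\<bar> < ?\<rho>" using dist[of z] by simp
      then show "z \<in> open_strip" by (auto simp: open_strip_def)
    qed
  qed
  have "cmod ((deriv ^^ 1) g (of_real \<theta>)) \<le> fact 1 * M / ?\<rho> ^ 1"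
  proof (rule Cauchy_inequality)
    show "cmod (g z) \<le> M" if "cmod (of_real \<theta> - z) = ?\<rho>" for z
    proof -
      have "z \<in> closed_strip" using that cb(1) by (auto simp: dist_norm)
      then show ?thesis by (rule g(3))
    qed
  qed (use g cb \<rho> continuous_on_subset holomorphic_on_subset in blast)+
  moreover have "deriv g (of_real \<theta>) = of_real S"
  proof -
    have df: "((\<lambda>z. f z j) has_field_derivative ?y j) (at (of_real \<theta>))" for j
      using f open_open_strip theta_in_strip(1) by (intro holomorphic_derivI[of _ open_strip]) (auto simp: strip_bounded_def)
    have dh: "((\<lambda>z. h z j) has_field_derivative deriv (\<lambda>z. h z j) (of_real \<theta>)) (at (of_real \<theta>))" for j
      using h(1) by (intro holomorphic_derivI[of _ UNIV]) auto
    have "(g has_field_derivative (\<Sum>j | block j < N. ?y j * h (of_real \<theta>) j + deriv (\<lambda>z. h z j) (of_real \<theta>) * f (of_real \<theta>) j))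
        (at (of_real \<theta>))"
      unfolding g_def by (intro DERIV_sum DERIV_mult df dh)
    then have "deriv g (of_real \<theta>) = (\<Sum>j | block j < N. ?y j * h (of_real \<theta>) j)"
      using zero by (simp add: DERIV_imp_deriv)
    then show ?thesis using h(3) by simp
  qed
  ultimately show "S \<le> M / ?\<rho>" using S by simp
next
  show "0 \<le> M / min \<theta> (1 - \<theta>)"
    using strip_bounded_nonneg[OF f] \<theta> by simp
qed

end

section \<open>Coordinates of functions in the Calderon space\<close>

context interpolation_exponents
begin

abbreviation "X0 \<equiv> l_sum p0"
abbreviation "X1 \<equiv> l_sum p1"
abbreviation "XP \<equiv> l_sum (ereal P)"
abbreviation "\<Sigma>X \<equiv> sum_space (l_sum p0) (l_sum p1)"

lemma sum_space_eq:
  shows "vecs \<Sigma>X = vecs X0" and "x \<in> vecs X0 \<Longrightarrow> nrm \<Sigma>X x = nrm X0 x"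
proof -
  have emb: "b \<in> vecs X0" "nrm X0 b \<le> nrm X1 b" if "b \<in> vecs X1" for b
    using l_sum_exponent_mono[OF p1 less_imp_le[OF p01] that] by auto
  show "vecs \<Sigma>X = vecs X0"
  proof (intro equalityI subsetI)
    fix x assume "x \<in> vecs \<Sigma>X"
    then obtain a b where "x = a + b" "a \<in> vecs X0" "b \<in> vecs X1" by (auto simp: sum_space_def)
    then show "x \<in> vecs X0" using l_sum_add[OF p0] emb by blast
  next
    fix x assume "x \<in> vecs X0"
    then have "x = x + 0 \<and> x \<in> vecs X0 \<and> (0 :: basis_index \<Rightarrow> complex) \<in> vecs X1"
      using l_sum_zero(1)[OF p1] by simp
    then show "x \<in> vecs \<Sigma>X" unfolding sum_space_def seq_space.simps by blast
  qed
  show "nrm \<Sigma>X x = nrm X0 x" if x: "x \<in> vecs X0"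
  proof -
    let ?A = "{nrm X0 a + nrm X1 b |a b. a \<in> vecs X0 \<and> b \<in> vecs X1 \<and> x = a + b}"
    have mem: "nrm X0 x \<in> ?A"
      using x l_sum_zero[OF p1] by (intro CollectI exI[of _ x] exI[of _ 0]) auto
    have lb: "nrm X0 x \<le> s" if "s \<in> ?A" for s
    proof -
      from that obtain a b where ab: "s = nrm X0 a + nrm X1 b" "a \<in> vecs X0" "b \<in> vecs X1" "x = a + b" by auto
      then show ?thesis using l_sum_add[OF p0 ab(2) emb(1)[OF ab(3)]] emb(2)[OF ab(3)] by simp
    qed
    have "Inf ?A = nrm X0 x" by (rule cInf_eq_minimum[OF mem lb])
    then show ?thesis by (simp add: sum_space_def)
  qed
qed

lemma eventually_open_strip: "z \<in> open_strip \<Longrightarrow> eventually (\<lambda>w. w \<in> open_strip) (at z)"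
  using open_open_strip by (auto simp: eventually_at_topological)

lemma open_strip_subset: "open_strip \<subseteq> closed_strip"
  by (auto simp: open_strip_def closed_strip_def)

text \<open>Evaluation at a coordinate is bounded by the norm, so it carries difference quotients to difference quotients.\<close>

lemma has_seq_derivative_coordinate:
  assumes F: "\<And>w. w \<in> open_strip \<Longrightarrow> F w \<in> vecs X0" and z: "z \<in> open_strip"
    and D: "has_seq_derivative \<Sigma>X F D z"
  shows "((\<lambda>w. F w j) has_field_derivative D j) (at z)"
proof -
  let ?G = "\<lambda>w. cscale (inverse (w - z)) (F w - F z) - D"
  have lim: "((\<lambda>w. nrm \<Sigma>X (?G w)) \<longlongrightarrow> 0) (at z)" and D0: "D \<in> vecs X0"
    using D unfolding has_seq_derivative_def sum_space_eq(1) by blast+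
  have "((\<lambda>w. ?G w j) \<longlongrightarrow> 0) (at z)"
  proof (rule Lim_null_comparison[OF _ lim])
    show "\<forall>\<^sub>F w in at z. norm (?G w j) \<le> nrm \<Sigma>X (?G w)"
      using eventually_open_strip[OF z]
    proof eventually_elim
      case (elim w)
      then have G: "?G w \<in> vecs X0"
        by (intro l_sum_minus[OF p0, THEN conjunct1] l_sum_cscale_le[OF p0, THEN conjunct1] F z D0)
      show ?case using cmod_le_nrm[OF p0 G] by (simp only: sum_space_eq(2)[OF G])
    qed
  qed
  moreover have "?G w j = (F w j - F z j) / (w - z) - D j" for w
    by (simp add: cscale_def divide_inverse mult.commute)
  ultimately have "((\<lambda>w. (F w j - F z j) / (w - z) - D j) \<longlongrightarrow> 0) (at z)"
    by (simp only:)
  then show ?thesis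
    unfolding has_field_derivative_iff by (rule LIM_zero_cancel)
qed

lemma calderon_coordinatewise:
  assumes F: "F \<in> calderon X0 X1"
  shows "\<And>z. z \<in> closed_strip \<Longrightarrow> F z \<in> vecs X0"
    and "\<And>z. z \<in> open_strip \<Longrightarrow> \<exists>D. has_seq_derivative \<Sigma>X F D z"
    and "seq_deriv \<Sigma>X F (of_real \<theta>) = (\<lambda>j. deriv (\<lambda>w. F w j) (of_real \<theta>))"
    and "strip_bounded (calderon_norm X0 X1 F) F"
proof -
  show vec: "F z \<in> vecs X0" if "z \<in> closed_strip" for z
    using F that by (auto simp: calderon_def seq_continuous_on_def sum_space_eq)
  show der: "\<exists>D. has_seq_derivative \<Sigma>X F D z" if "z \<in> open_strip" for z
    using F that by (auto simp: calderon_def)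
  have vec': "F z \<in> vecs X0" if "z \<in> open_strip" for z
    using vec that open_strip_subset by blast
  show "seq_deriv \<Sigma>X F (of_real \<theta>) = (\<lambda>j. deriv (\<lambda>w. F w j) (of_real \<theta>))"
  proof -
    obtain D where D: "has_seq_derivative \<Sigma>X F D (of_real \<theta>)" using der theta_in_strip by blast
    have eq: "D' = (\<lambda>j. deriv (\<lambda>w. F w j) (of_real \<theta>))" if "has_seq_derivative \<Sigma>X F D' (of_real \<theta>)" for D'
    proof
      fix j
      show "D' j = deriv (\<lambda>w. F w j) (of_real \<theta>)"
        by (rule DERIV_imp_deriv[symmetric], rule has_seq_derivative_coordinate[OF vec' theta_in_strip(1) that])
    qed
    show ?thesis unfolding seq_deriv_def using D eq[OF D] by (intro the_equality) (simp_all add: eq)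
  qed
  show "strip_bounded (calderon_norm X0 X1 F) F"
    unfolding strip_bounded_def
  proof (intro allI conjI)
    fix j
    show "continuous_on closed_strip (\<lambda>z. F z j)"
      unfolding continuous_on_def
    proof
      fix z assume z: "z \<in> closed_strip"
      have lim: "((\<lambda>w. nrm \<Sigma>X (F w - F z)) \<longlongrightarrow> 0) (at z within closed_strip)"
        using F z by (auto simp: calderon_def seq_continuous_on_def)
      have "((\<lambda>w. F w j - F z j) \<longlongrightarrow> 0) (at z within closed_strip)"
      proof (rule Lim_null_comparison[OF _ lim])
        show "\<forall>\<^sub>F w in at z within closed_strip. norm (F w j - F z j) \<le> nrm \<Sigma>X (F w - F z)"
        proof (rule eventually_at_filter[THEN iffD2], intro always_eventually allI impI)
          fix w assume "w \<noteq> z" "w \<in> closed_strip"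
          then have G: "F w - F z \<in> vecs X0" using l_sum_minus[OF p0 vec vec] z by blast
          show "norm (F w j - F z j) \<le> nrm \<Sigma>X (F w - F z)"
            using cmod_le_nrm[OF p0 G, of j] by (simp add: sum_space_eq(2)[OF G])
        qed
      qed
      then show "((\<lambda>z. F z j) \<longlongrightarrow> F z j) (at z within closed_strip)" by (rule LIM_zero_cancel)
    qed
    show "(\<lambda>z. F z j) holomorphic_on open_strip"
      unfolding holomorphic_on_open[OF open_open_strip]
    proof
      fix z assume z: "z \<in> open_strip"
      then obtain D where D: "has_seq_derivative \<Sigma>X F D z" using der by blast
      show "\<exists>f'. ((\<lambda>z. F z j) has_field_derivative f') (at z)"
        by (rule exI[of _ "D j"]) (rule has_seq_derivative_coordinate[OF vec' z D])
    qed
    show "\<exists>K. \<forall>z\<in>closed_strip. cmod (F z j) \<le> K"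
    proof -
      obtain K where "\<And>z. z \<in> closed_strip \<Longrightarrow> nrm \<Sigma>X (F z) \<le> K"
        using F by (auto simp: calderon_def seq_bounded_on_def)
      then have "cmod (F z j) \<le> K" if "z \<in> closed_strip" for z
        using cmod_le_nrm[OF p0 vec[OF that], of j] sum_space_eq(2)[OF vec[OF that]] that by fastforce
      then show ?thesis by blast
    qed
  next
    fix t
    have b: "seq_bounded_on X0 UNIV (\<lambda>t. F (Complex 0 t))" "seq_bounded_on X1 UNIV (\<lambda>t. F (Complex 1 t))"
      using F by (simp_all add: calderon_def)
    then have 0: "F (Complex 0 t) \<in> vecs X0" and b0: "bdd_above (range (\<lambda>t. nrm X0 (F (Complex 0 t))))"
      and 1: "F (Complex 1 t) \<in> vecs X1" and b1: "bdd_above (range (\<lambda>t. nrm X1 (F (Complex 1 t))))"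
      unfolding seq_bounded_on_def by (fastforce intro: bdd_aboveI2)+
    have "nrm X0 (F (Complex 0 t)) \<le> calderon_norm X0 X1 F" "nrm X1 (F (Complex 1 t)) \<le> calderon_norm X0 X1 F"
      unfolding calderon_norm_def
      using cSUP_upper[OF UNIV_I b0, of t] cSUP_upper[OF UNIV_I b1, of t] by linarith+
    then show "lq_le p0 (block_norm (F (Complex 0 t))) (calderon_norm X0 X1 F)"
      "lq_le p1 (block_norm (F (Complex 1 t))) (calderon_norm X0 X1 F)"
      using 0 1 by (auto simp: lq_le_iff p0 p1)
  qed
qed

end

section \<open>Extremal functions\<close>

text \<open>The weights \<open>v\<close> tend to 0 while dividing \<open>c\<close> by them raises its sum at most to \<open>B\<close>. The bound \<open>c k \<le> v k\<close> keeps the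
quotients at most 1; it also forces \<open>c k = 0\<close> where \<open>v k = 0\<close>, so that \<open>c k / v k = 0\<close> there is the right value.\<close>

definition vanishing_weight :: "real \<Rightarrow> (nat \<Rightarrow> real) \<Rightarrow> (nat \<Rightarrow> real) \<Rightarrow> bool" where
  "vanishing_weight B c v \<longleftrightarrow> v \<longlonglongrightarrow> 0 \<and> (\<forall>k. 0 \<le> v k \<and> v k \<le> 1 \<and> c k \<le> v k) \<and>
     (\<forall>N. (\<Sum>k<N. c k / v k) \<le> B)"

text \<open>Take \<open>v k\<close> to be the power \<open>\<delta> = 1 - 1 / B\<close> of the tail \<open>T k\<close> of the series of \<open>c\<close>. Then the sum of
\<open>c k / v k = (T k - T (k + 1)) / T k powr \<delta>\<close> is a lower Riemann sum for the integral of \<open>t powr (- \<delta>)\<close> over \<open>[0, 1]\<close>,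
which is \<open>1 / (1 - \<delta>) = B\<close>.\<close>

lemma vanishing_weight_exists:
  fixes c :: "nat \<Rightarrow> real"
  assumes c0: "\<And>k. 0 \<le> c k" and c1: "\<And>N. (\<Sum>k<N. c k) \<le> 1" and B: "1 < B"
  shows "\<exists>v. vanishing_weight B c v"
proof -
  define \<delta> where "\<delta> = 1 - 1 / B"
  have \<delta>: "0 < \<delta>" "\<delta> < 1" "1 / (1 - \<delta>) = B" using B by (auto simp: \<delta>_def)
  have s: "summable c"
    using c0 c1 by (intro bounded_imp_summable[of _ 1])
      (auto simp: lessThan_Suc_atMost[symmetric] simp del: sum.lessThan_Suc)
  \<comment> \<open>\<open>T k\<close> is the tail of the series starting at \<open>k\<close>.\<close>
  define T where "T = (\<lambda>k. suminf c - (\<Sum>i<k. c i))"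
  have T0: "0 \<le> T k" for k
    using sum_le_suminf[OF s, of "{..<k}"] c0 by (simp add: T_def)
  have T1: "T k \<le> 1" for k
  proof -
    have "suminf c \<le> 1" using c1 by (intro suminf_le_const s) auto
    then show ?thesis using c0 sum_nonneg[of "{..<k}" c] by (simp add: T_def)
  qed
  have T_Suc: "c k = T k - T (Suc k)" for k by (simp add: T_def)
  have T_lim: "T \<longlonglongrightarrow> 0"
    using tendsto_diff[OF tendsto_const summable_LIMSEQ[OF s], of "suminf c"] by (simp add: T_def)
  define v where "v = (\<lambda>k. T k powr \<delta>)"
  have v: "0 \<le> v k \<and> v k \<le> 1 \<and> c k \<le> v k" for k
  proof -
    have "T k powr 1 \<le> T k powr \<delta>" using \<delta> T0 T1 by (intro powr_mono') auto
    then show ?thesis using T0[of k] T1[of k] T0[of "Suc k"] \<delta> T_Suc[of k] by (auto simp: v_def powr_le1)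
  qed
  \<comment> \<open>The tangent inequality for the concave function \<open>t powr (1 - \<delta>)\<close>, in the form of Young's inequality.\<close>
  have step: "c k / v k \<le> (T k powr (1 - \<delta>) - T (Suc k) powr (1 - \<delta>)) / (1 - \<delta>)" for k
  proof (cases "T k = 0")
    case True
    then have "c k = 0" "T (Suc k) = 0" using T_Suc[of k] T0[of "Suc k"] c0[of k] by auto
    then show ?thesis using True by simp
  next
    case False
    then have t: "0 < T k" using T0[of k] by simp
    have "T (Suc k) powr (1 - \<delta>) * T k powr \<delta> \<le> (1 - \<delta>) * T (Suc k) + \<delta> * T k"
    proof (cases "T (Suc k) = 0")
      case False
      then show ?thesis
        using \<delta> t T0[of "Suc k"] by (intro Youngs_inequality_0) auto
    qed (use \<delta> t in auto)
    moreover have "T k powr (1 - \<delta>) * T k powr \<delta> = T k"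
      using t by (simp flip: powr_add)
    ultimately have "(1 - \<delta>) * c k \<le> (T k powr (1 - \<delta>) - T (Suc k) powr (1 - \<delta>)) * v k"
      unfolding T_Suc v_def by (simp add: algebra_simps)
    then show ?thesis using \<delta> t by (simp add: v_def field_simps)
  qed
  have "(\<Sum>k<N. c k / v k) \<le> B" for N
  proof -
    have "(\<Sum>k<N. c k / v k) \<le> (\<Sum>k<N. (T k powr (1 - \<delta>) - T (Suc k) powr (1 - \<delta>)) / (1 - \<delta>))"
      by (intro sum_mono step)
    also have "\<dots> = (T 0 powr (1 - \<delta>) - T N powr (1 - \<delta>)) / (1 - \<delta>)"
      unfolding sum_divide_distrib[symmetric] using sum_lessThan_telescope'[of "\<lambda>k. T k powr (1 - \<delta>)" N] by simp
    also have "\<dots> \<le> 1 / (1 - \<delta>)"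
    proof (rule divide_right_mono)
      have "T 0 powr (1 - \<delta>) \<le> 1" using T0 T1 \<delta> by (intro powr_le1) auto
      then show "T 0 powr (1 - \<delta>) - T N powr (1 - \<delta>) \<le> 1" using powr_ge_zero[of "T N" "1 - \<delta>"] by linarith
    qed (use \<delta> in auto)
    finally show ?thesis using \<delta> by simp
  qed
  moreover have "v \<longlonglongrightarrow> 0"
    unfolding v_def using tendsto_powr'[OF T_lim tendsto_const[of \<delta>]] \<delta> T0 by (auto intro: always_eventually)
  ultimately have "vanishing_weight B c v" using v by (auto simp: vanishing_weight_def)
  then show ?thesis by blast
qed

context interpolation_exponents
begin

definition \<beta> :: real where "\<beta> = recip p1 - recip p0"

lemma \<beta>_pos: "0 < \<beta>"
  using recip_less by (simp add: \<beta>_def)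

lemma recip_P_eq: "1 / P = recip p0 + \<beta> * \<theta>" "recip p1 = 1 / P + \<beta> * (1 - \<theta>)"
  unfolding P \<beta>_def by (auto simp: algebra_simps)

text \<open>If the norm is 0, then division by zero makes all masses 0, so the zero vector needs no special treatment.\<close>

definition mass :: "(basis_index \<Rightarrow> complex) \<Rightarrow> nat \<Rightarrow> real" where
  "mass x k = (block_norm x k / nrm XP x) powr P"

lemma mass_nonneg [simp]: "0 \<le> mass x k"
  by (simp add: mass_def)

lemma nrm_XP_nonneg: "x \<in> vecs XP \<Longrightarrow> 0 \<le> nrm XP x"
  by (rule l_sum_nrm_nonneg[OF P_ereal])

lemma sum_mass_le: "x \<in> vecs XP \<Longrightarrow> (\<Sum>k<N. mass x k) \<le> 1"
proof (cases "nrm XP x = 0")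
  case False
  assume x: "x \<in> vecs XP"
  have "(\<Sum>k<N. block_norm x k powr P) \<le> nrm XP x powr P"
    using lq_le_nrm[OF P_ereal x] by (simp add: lq_le_ereal)
  then show ?thesis using False nrm_XP_nonneg[OF x]
    by (simp add: mass_def powr_divide sum_divide_distrib[symmetric])
qed (simp add: mass_def)

lemma block_norm_eq_mass:
  assumes "x \<in> vecs XP"
  shows "block_norm x k = nrm XP x * mass x k powr (1 / P)"
proof (cases "nrm XP x = 0")
  case True
  then show ?thesis
    using lq_le_component[OF P_ereal lq_le_nrm[OF P_ereal assms], of k] block_norm_nonneg[of x k] by simp
next
  case False
  then show ?thesis
    using P_gt_1 nrm_XP_nonneg[OF assms] by (simp add: mass_def powr_powr)
qed

text \<open>The block \<open>k\<close> of \<open>x\<close> times \<open>r k powr (\<beta> (z - \<theta>))\<close>. With \<open>r = mass x\<close> it is the optimal extension of \<open>x\<close>; other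
\<open>r\<close> are used to gain continuity. Where \<open>r k = 0\<close>, the block of \<open>x\<close> vanishes in all applications.\<close>

definition extremal :: "(nat \<Rightarrow> real) \<Rightarrow> (basis_index \<Rightarrow> complex) \<Rightarrow> complex \<Rightarrow> basis_index \<Rightarrow> complex" where
  "extremal r x z = (\<lambda>j. x j * exp (of_real \<beta> * (z - of_real \<theta>) * of_real (ln (r (block j)))))"

lemma extremal_theta: "extremal r x (of_real \<theta>) = x"
  by (simp add: extremal_def)

lemma extremal_derivative:
  "((\<lambda>z. extremal r x z j) has_field_derivative
     of_real (\<beta> * ln (r (block j))) * extremal r x z j) (at z within S)"
  unfolding extremal_def by (auto intro!: derivative_eq_intros)

lemma extremal_holomorphic: "(\<lambda>z. extremal r x z j) holomorphic_on S"
  unfolding extremal_def by (intro holomorphic_intros)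

lemma extremal_continuous: "continuous_on S (\<lambda>z. extremal r x z j)"
  by (intro holomorphic_on_imp_continuous_on extremal_holomorphic)

lemma block_norm_extremal:
  "block_norm (extremal r x z) k = block_norm x k * exp (\<beta> * (Re z - \<theta>) * ln (r k))"
  by (subst mult.commute, rule block_norm_scaled) (auto simp: extremal_def norm_mult)

text \<open>The admissible replacements for the masses in the extremal function: being at least the mass and at most 1 controls
the left edge, the bound on the sum controls the right edge.\<close>

definition weight_for :: "(basis_index \<Rightarrow> complex) \<Rightarrow> real \<Rightarrow> (nat \<Rightarrow> real) \<Rightarrow> bool" where
  "weight_for x B r \<longleftrightarrow> x \<in> vecs XP \<and> 1 \<le> B \<and> (\<forall>k. mass x k \<le> r k \<and> r k \<le> 1) \<and> (\<forall>N. (\<Sum>k<N. r k) \<le> B)"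

lemma weight_forD:
  assumes "weight_for x B r"
  shows "x \<in> vecs XP" "0 \<le> nrm XP x" "1 \<le> B" "mass x k \<le> r k" "r k \<le> 1" "(\<Sum>k<N. r k) \<le> B"
  using assms nrm_XP_nonneg by (auto simp: weight_for_def)

text \<open>The block norm is at most \<open>nrm x\<close> times \<open>c powr (1 / P) * r powr (- \<beta> \<theta>)\<close>, and \<open>1 / P = 1 / p0 + \<beta> \<theta>\<close>. The factor
\<open>v\<close> between the mass and \<open>r\<close> survives to the power \<open>\<beta> \<theta>\<close>; for \<open>p0 = \<infinity>\<close> it is the only source of decay. As \<open>r \<le> 1\<close>,
the bound holds on the whole right half plane and so majorizes the function on the strip.\<close>

lemma extremal_left_bound:
  assumes r: "weight_for x B r" and v: "\<And>k. mass x k \<le> r k * v k" "\<And>k. 0 \<le> v k" and z: "0 \<le> Re z"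
  shows "block_norm (extremal r x z) k \<le> nrm XP x * (mass x k powr recip p0 * v k powr (\<beta> * \<theta>))"
proof (cases "mass x k = 0")
  case True
  then show ?thesis
    using block_norm_eq_mass[OF weight_forD(1)[OF r], of k] weight_forD(2)[OF r] P_gt_1
    by (simp add: block_norm_extremal)
next
  case False
  then have m: "0 < mass x k" using mass_nonneg[of x k] by linarith
  have rk: "0 < r k" "r k \<le> 1" using weight_forD(4,5)[OF r, of k] m by linarith+
  have "exp (\<beta> * (Re z - \<theta>) * ln (r k)) \<le> exp (- (\<beta> * \<theta> * ln (r k)))"
  proof -
    have "\<beta> * Re z * ln (r k) \<le> 0" using \<beta>_pos z rk by (simp add: mult_nonneg_nonpos)
    then show ?thesis by (simp add: algebra_simps)
  qed
  also have "\<dots> = inverse (r k powr (\<beta> * \<theta>))" using rk by (simp add: powr_def exp_minus)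
  finally have e: "exp (\<beta> * (Re z - \<theta>) * ln (r k)) \<le> inverse (r k powr (\<beta> * \<theta>))" .
  have "mass x k powr (\<beta> * \<theta>) \<le> (r k * v k) powr (\<beta> * \<theta>)"
    using v[of k] \<beta>_pos \<theta> by (intro powr_mono2) auto
  also have "\<dots> = r k powr (\<beta> * \<theta>) * v k powr (\<beta> * \<theta>)"
    using rk v by (simp add: powr_mult)
  finally have "mass x k powr (\<beta> * \<theta>) * inverse (r k powr (\<beta> * \<theta>)) \<le> v k powr (\<beta> * \<theta>)"
    using rk by (simp only: divide_inverse[symmetric] pos_divide_le_eq powr_gt_zero
        mult.commute[of "v k powr (\<beta> * \<theta>)"] simp_thms)
  then have m': "nrm XP x * mass x k powr recip p0 * (mass x k powr (\<beta> * \<theta>) * inverse (r k powr (\<beta> * \<theta>)))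
      \<le> nrm XP x * mass x k powr recip p0 * v k powr (\<beta> * \<theta>)"
    using weight_forD(2)[OF r] by (intro mult_left_mono) auto
  have "block_norm (extremal r x z) k \<le> block_norm x k * inverse (r k powr (\<beta> * \<theta>))"
    unfolding block_norm_extremal by (intro mult_left_mono e) simp
  also have "block_norm x k = nrm XP x * (mass x k powr recip p0 * mass x k powr (\<beta> * \<theta>))"
    unfolding powr_add[symmetric] recip_P_eq(1)[symmetric] by (rule block_norm_eq_mass[OF weight_forD(1)[OF r]])
  finally show ?thesis using m' by (simp only: mult.assoc)
qed

text \<open>Here the mass is estimated by \<open>r\<close>, and the exponents add up the other way: \<open>1 / P + \<beta> (1 - \<theta>) = 1 / p1\<close>.\<close>

lemma extremal_right_bound:
  assumes r: "weight_for x B r" and z: "Re z = 1"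
  shows "block_norm (extremal r x z) k \<le> nrm XP x * r k powr recip p1"
proof (cases "mass x k = 0")
  case True
  then show ?thesis
    using block_norm_eq_mass[OF weight_forD(1)[OF r], of k] weight_forD(2)[OF r] P_gt_1
    by (simp add: block_norm_extremal)
next
  case False
  then have m: "0 < mass x k" using mass_nonneg[of x k] by linarith
  have rk: "0 < r k" "mass x k \<le> r k" using weight_forD(4)[OF r, of k] m by linarith+
  have "block_norm (extremal r x z) k = nrm XP x * mass x k powr (1 / P) * r k powr (\<beta> * (1 - \<theta>))"
    unfolding block_norm_extremal block_norm_eq_mass[OF weight_forD(1)[OF r]] using z rk by (simp add: powr_def)
  also have "\<dots> \<le> nrm XP x * r k powr (1 / P) * r k powr (\<beta> * (1 - \<theta>))"
    using rk weight_forD(2)[OF r] P_gt_1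
    by (intro mult_left_mono mult_right_mono powr_mono2) auto
  finally show ?thesis by (simp only: recip_P_eq(2) powr_add mult.assoc)
qed

lemma weight_for_nonneg: "weight_for x B r \<Longrightarrow> 0 \<le> r k"
  using mass_nonneg[of x k] weight_forD(4)[of x B r k] by linarith

lemma extremal_lq_bounds:
  assumes r: "weight_for x B r"
  shows "0 \<le> Re z \<Longrightarrow> lq_le p0 (block_norm (extremal r x z)) (nrm XP x)"
    and "Re z = 1 \<Longrightarrow> lq_le p1 (block_norm (extremal r x z)) (nrm XP x * B powr recip p1)"
proof -
  note x = weight_forD(1)[OF r] and N = weight_forD(2)[OF r]
  show "lq_le p0 (block_norm (extremal r x z)) (nrm XP x)" if z: "0 \<le> Re z"
  proof (rule lq_le_mono[OF p0 lq_le_scale[OF p0 lq_le_powr_recip[OF p0, of "mass x" 1] N]])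
    show "block_norm (extremal r x z) k \<le> nrm XP x * mass x k powr recip p0" for k
      using extremal_left_bound[OF r, of "\<lambda>_. 1" z k] weight_forD(4)[OF r] z by simp
  qed (use sum_mass_le[OF x] in auto)
  show "lq_le p1 (block_norm (extremal r x z)) (nrm XP x * B powr recip p1)" if z: "Re z = 1"
    by (rule lq_le_mono[OF p1 lq_le_scale[OF p1 lq_le_powr_recip[OF p1, of r B] N]])
       (use weight_forD(3,6)[OF r] weight_for_nonneg[OF r] extremal_right_bound[OF r z] in auto)
qed

lemma extremal_strip_bounded:
  assumes r: "weight_for x B r"
  shows "strip_bounded (nrm XP x * B powr recip p1) (extremal r x)"
proof -
  have B: "1 \<le> B powr recip p1" using weight_forD(3)[OF r] recip_less by (auto intro: ge_one_powr_ge_zero)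
  note N = weight_forD(2)[OF r]
  have le: "nrm XP x \<le> nrm XP x * B powr recip p1" using mult_left_mono[OF B N] by simp
  have "cmod (extremal r x z j) \<le> nrm XP x" if "z \<in> closed_strip" for z j
  proof -
    have "lq_le p0 (block_norm (extremal r x z)) (nrm XP x)"
      using that by (intro extremal_lq_bounds(1)[OF r]) (auto simp: closed_strip_def)
    then show ?thesis using cmod_le_nrm[OF p0, of "extremal r x z" j] by (auto simp: lq_le_iff[OF p0])
  qed
  moreover have "lq_le p0 (block_norm (extremal r x (Complex 0 t))) (nrm XP x * B powr recip p1)" for t
    by (rule lq_le_mono[OF p0 extremal_lq_bounds(1)[OF r, of "Complex 0 t"]]) (use le in auto)
  ultimately show ?thesis
    unfolding strip_bounded_def
    by (auto intro: extremal_continuous extremal_holomorphic extremal_lq_bounds(2)[OF r])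
qed

end

section \<open>The interpolation space\<close>

lemma seq_continuous_on_dominated:
  assumes q: "1 \<le> q" and d: "lq_vanishing_tails q d" "\<And>k. 0 \<le> d k"
    and vec: "\<And>z. z \<in> S \<Longrightarrow> F z \<in> vecs (l_sum q)"
    and dom: "\<And>z k. z \<in> S \<Longrightarrow> block_norm (F z) k \<le> d k"
    and cont: "\<And>j. continuous_on S (\<lambda>z. F z j)"
  shows "seq_continuous_on (l_sum q) S F"
  unfolding seq_continuous_on_def
proof (intro conjI ballI)
  show "F ` S \<subseteq> vecs (l_sum q)" using vec by blast
  fix z assume z: "z \<in> S"
  show "((\<lambda>w. nrm (l_sum q) (F w - F z)) \<longlongrightarrow> 0) (at z within S)"
  proof (rule l_sum_dominated_tendsto_0[OF q lq_vanishing_tails_scale[OF q d(1), of 2]])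
    show "\<forall>\<^sub>F w in at z within S. \<forall>k. block_norm (F w - F z) k \<le> 2 * d k"
    proof (rule eventually_at_filter[THEN iffD2], intro always_eventually allI impI)
      fix w k assume "w \<in> S"
      then show "block_norm (F w - F z) k \<le> 2 * d k"
        using block_norm_triangle_diff[of "F w" "F z" k] dom[of w k] dom[OF z, of k] by simp
    qed
    show "((\<lambda>w. (F w - F z) j) \<longlongrightarrow> 0) (at z within S)" for j
    proof -
      have "((\<lambda>w. F w j) \<longlongrightarrow> F z j) (at z within S)"
        using cont[of j] z by (simp add: continuous_on_def)
      then have "((\<lambda>w. F w j - F z j) \<longlongrightarrow> 0) (at z within S)" by (rule LIM_zero)
      then show ?thesis by simp
    qed
  qed (use d in auto)
qed

lemma mult_exp_le:
  fixes u s :: real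
  assumes "0 < s"
  shows "u * exp (- (u * s)) \<le> 1 / s"
proof -
  have "u * s \<le> exp (u * s)" using exp_ge_add_one_self[of "u * s"] by linarith
  then show ?thesis using assms by (simp add: exp_minus field_simps)
qed

context interpolation_exponents
begin

lemma strip_bounded_calderon_norm_le:
  assumes "strip_bounded M F"
  shows "calderon_norm X0 X1 F \<le> M"
    and "seq_bounded_on X0 UNIV (\<lambda>t. F (Complex 0 t))" and "seq_bounded_on X1 UNIV (\<lambda>t. F (Complex 1 t))"
proof -
  have *: "F (Complex 0 t) \<in> vecs X0 \<and> nrm X0 (F (Complex 0 t)) \<le> M"
    "F (Complex 1 t) \<in> vecs X1 \<and> nrm X1 (F (Complex 1 t)) \<le> M" for t
    using assms unfolding strip_bounded_def by (simp_all add: lq_le_iff p0 p1)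
  show "calderon_norm X0 X1 F \<le> M"
    unfolding calderon_norm_def using * by (intro max.boundedI cSUP_least) auto
  show "seq_bounded_on X0 UNIV (\<lambda>t. F (Complex 0 t))" "seq_bounded_on X1 UNIV (\<lambda>t. F (Complex 1 t))"
    unfolding seq_bounded_on_def using * by blast+
qed

lemma vanishing_weight_weight_for:
  assumes x: "x \<in> vecs XP" and B: "1 \<le> B" and v: "vanishing_weight B (mass x) v"
  shows "weight_for x B (\<lambda>k. mass x k / v k)" and "mass x k = mass x k / v k * v k"
proof -
  have v': "0 \<le> v k" "v k \<le> 1" "mass x k \<le> v k" "(\<Sum>k<N. mass x k / v k) \<le> B" for k N
    using v by (auto simp: vanishing_weight_def)
  show "mass x k = mass x k / v k * v k"
    using v'(1,3)[of k] mass_nonneg[of x k] by (cases "v k = 0") auto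
  have "mass x k \<le> mass x k / v k \<and> mass x k / v k \<le> 1" for k
  proof (cases "v k = 0")
    case True
    then show ?thesis using v'(3)[of k] by simp
  next
    case False
    then have "0 < v k" using v'(1)[of k] by simp
    moreover have "mass x k * v k \<le> mass x k * 1" using v'(2)[of k] by (intro mult_left_mono) auto
    ultimately show ?thesis using v'(3)[of k] by (simp add: field_simps)
  qed
  then show "weight_for x B (\<lambda>k. mass x k / v k)"
    using x B v'(4) by (simp add: weight_for_def)
qed

text \<open>For finite \<open>p0\<close> the summability of the masses suffices, for \<open>p0 = \<infinity>\<close> the decay comes from \<open>v\<close>.\<close>

lemma left_majorant_vanishing:
  assumes x: "x \<in> vecs XP" and v: "vanishing_weight B (mass x) v"
  shows "lq_vanishing_tails p0 (\<lambda>k. nrm XP x * (mass x k powr recip p0 * v k powr (\<beta> * \<theta>)))"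
proof -
  have N: "0 \<le> nrm XP x" by (rule nrm_XP_nonneg[OF x])
  have v': "0 \<le> v k" "v k \<le> 1" "v \<longlonglongrightarrow> 0" for k
    using v by (auto simp: vanishing_weight_def)
  have b: "0 < \<beta> * \<theta>" using \<beta>_pos \<theta> by simp
  show ?thesis
    using p0
  proof (cases rule: exponent_cases)
    case 1
    have "(\<lambda>k. nrm XP x * v k powr (\<beta> * \<theta>)) \<longlonglongrightarrow> nrm XP x * 0"
      using tendsto_powr'[OF v'(3) tendsto_const[of "\<beta> * \<theta>"]] b v'(1)
      by (intro tendsto_mult tendsto_const) (auto intro: always_eventually)
    then have tails: "lq_vanishing_tails p0 (\<lambda>k. nrm XP x * v k powr (\<beta> * \<theta>))"
      unfolding 1 by (intro lq_vanishing_tails_infty) simp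
    show ?thesis
    proof (rule lq_vanishing_tails_mono[OF p0 tails])
      fix k
      have "mass x k powr recip p0 * v k powr (\<beta> * \<theta>) \<le> 1 * v k powr (\<beta> * \<theta>)"
        by (intro mult_right_mono) (auto simp: 1)
      then show "nrm XP x * (mass x k powr recip p0 * v k powr (\<beta> * \<theta>)) \<le> nrm XP x * v k powr (\<beta> * \<theta>)"
        using N by (intro mult_left_mono) auto
    qed (use N in auto)
  next
    case (2 r)
    have "lq_le p0 (\<lambda>k. nrm XP x * mass x k powr recip p0) (nrm XP x * 1 powr recip p0)"
      by (intro lq_le_scale lq_le_powr_recip p0 N sum_mass_le x) auto
    then have "lq_vanishing_tails p0 (\<lambda>k. nrm XP x * mass x k powr recip p0)"
      unfolding 2 by (rule lq_vanishing_tails_ereal[OF 2(2)])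
    then show ?thesis
    proof (rule lq_vanishing_tails_mono[OF p0])
      fix k
      have "v k powr (\<beta> * \<theta>) \<le> 1" using v' b by (intro powr_le1) auto
      then have "mass x k powr recip p0 * v k powr (\<beta> * \<theta>) \<le> mass x k powr recip p0"
        by (simp add: mult_left_le)
      then show "nrm XP x * (mass x k powr recip p0 * v k powr (\<beta> * \<theta>)) \<le> nrm XP x * mass x k powr recip p0"
        using N by (rule mult_left_mono)
    qed (use N in auto)
  qed
qed

lemma right_majorant_vanishing:
  assumes "weight_for x B r"
  shows "lq_vanishing_tails p1 (\<lambda>k. nrm XP x * r k powr recip p1)"
proof -
  obtain s where s: "p1 = ereal s" "1 \<le> s" by (rule p1_finite)
  have "lq_le p1 (\<lambda>k. nrm XP x * r k powr recip p1) (nrm XP x * B powr recip p1)"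
    using weight_forD(3)[OF assms]
    by (intro lq_le_scale lq_le_powr_recip p1 weight_forD[OF assms] weight_for_nonneg[OF assms]) auto
  then show ?thesis unfolding s by (rule lq_vanishing_tails_ereal[OF s(2)])
qed

text \<open>Put \<open>u = - \<beta> ln (r k) \<ge> 0\<close>, which is unbounded in \<open>k\<close>. Differentiation costs the factor \<open>u\<close>, but at distance
\<open>s = Re z / 2\<close> from the left edge there is a gain of \<open>exp (- u s)\<close>, and \<open>u exp (- u s) \<le> 1 / s\<close> uniformly. So the
majorant of the function itself, the one at the point 0, serves for the difference quotients too.\<close>

lemma extremal_lipschitz:
  assumes r: "weight_for x B r" and z: "0 < Re z" and w: "Re z / 2 \<le> Re w"
  shows "cmod (extremal r x w j - extremal r x z j) \<le>
      2 / Re z * cmod (extremal r x 0 j) * cmod (w - z)"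
    and "cmod (of_real (\<beta> * ln (r (block j))) * extremal r x z j) \<le> 2 / Re z * cmod (extremal r x 0 j)"
proof -
  define H where "H = {\<zeta>::complex. Re z / 2 \<le> Re \<zeta>}"
  have deriv: "cmod (of_real (\<beta> * ln (r (block j))) * extremal r x \<zeta> j) \<le> 2 / Re z * cmod (extremal r x 0 j)"
    if "\<zeta> \<in> H" for \<zeta>
  proof (cases "r (block j) = 0")
    case False
    then have rk: "0 < r (block j)" "r (block j) \<le> 1"
      using weight_for_nonneg[OF r, of "block j"] weight_forD(5)[OF r, of "block j"] by auto
    define u where "u = - (\<beta> * ln (r (block j)))"
    have u: "0 \<le> u" using rk \<beta>_pos by (simp add: u_def mult_nonneg_nonpos)
    have ext: "cmod (extremal r x \<xi> j) = cmod (x j) * exp (u * (\<theta> - Re \<xi>))" for \<xi>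
      by (simp add: extremal_def norm_mult u_def algebra_simps)
    have "u * exp (u * (\<theta> - Re \<zeta>)) \<le> u * exp (- (u * (Re z / 2)) + u * \<theta>)"
    proof -
      have "u * (Re z / 2) \<le> u * Re \<zeta>" using that u by (intro mult_left_mono) (auto simp: H_def)
      then have "u * (\<theta> - Re \<zeta>) \<le> - (u * (Re z / 2)) + u * \<theta>" by (simp add: algebra_simps)
      then show ?thesis using u by (intro mult_left_mono) auto
    qed
    also have "\<dots> = u * exp (- (u * (Re z / 2))) * exp (u * \<theta>)" by (simp only: exp_add mult.assoc)
    also have "\<dots> \<le> 1 / (Re z / 2) * exp (u * \<theta>)"
      using z by (intro mult_right_mono mult_exp_le) auto
    finally have main: "u * exp (u * (\<theta> - Re \<zeta>)) \<le> 2 / Re z * exp (u * \<theta>)" by simp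
    have "cmod (of_real (\<beta> * ln (r (block j))) * extremal r x \<zeta> j) = cmod (x j) * (u * exp (u * (\<theta> - Re \<zeta>)))"
    proof -
      have "cmod (of_real (\<beta> * ln (r (block j)))) = u"
        using u unfolding u_def norm_of_real by simp
      then show ?thesis unfolding norm_mult ext by (simp only: mult_ac)
    qed
    also have "\<dots> \<le> cmod (x j) * (2 / Re z * exp (u * \<theta>))"
      by (intro mult_left_mono main) simp
    also have "\<dots> = 2 / Re z * cmod (extremal r x 0 j)" by (simp add: ext)
    finally show ?thesis .
  qed (use z in simp)
  have "z \<in> H" "w \<in> H" using z w by (auto simp: H_def)
  then show "cmod (of_real (\<beta> * ln (r (block j))) * extremal r x z j) \<le> 2 / Re z * cmod (extremal r x 0 j)"
    by (intro deriv)
  have "convex H" unfolding H_def by (rule convex_halfspace_Re_ge)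
  show "cmod (extremal r x w j - extremal r x z j) \<le> 2 / Re z * cmod (extremal r x 0 j) * cmod (w - z)"
    by (rule field_differentiable_bound[OF \<open>convex H\<close> _ deriv \<open>w \<in> H\<close> \<open>z \<in> H\<close>])
       (rule extremal_derivative)
qed

lemma extremal_has_seq_derivative:
  assumes r: "weight_for x B r" and d: "lq_vanishing_tails p0 (block_norm (extremal r x 0))"
    and z: "z \<in> open_strip"
  shows "has_seq_derivative \<Sigma>X (extremal r x) (\<lambda>j. of_real (\<beta> * ln (r (block j))) * extremal r x z j) z"
proof -
  let ?D = "\<lambda>j. of_real (\<beta> * ln (r (block j))) * extremal r x z j"
  let ?C = "2 / Re z"
  let ?Q = "\<lambda>w. cscale (inverse (w - z)) (extremal r x w - extremal r x z)"
  have Re: "0 < Re z" using z by (simp add: open_strip_def)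
  have vec: "extremal r x w \<in> vecs X0" if "0 \<le> Re w" for w
    using extremal_lq_bounds(1)[OF r that] by (simp add: lq_le_iff[OF p0])
  have cs: "cmod (cscale (of_real ?C) y j) = ?C * cmod (y j)" for y :: "basis_index \<Rightarrow> complex" and j
    using Re by (simp only: cscale_def norm_mult norm_of_real) simp
  have bnC: "block_norm (cscale (of_real ?C) (extremal r x 0)) k = ?C * block_norm (extremal r x 0) k" for k
    using Re by (simp add: block_norm_cscale del: of_real_divide)
  have bnD: "block_norm ?D k \<le> ?C * block_norm (extremal r x 0) k" for k
    unfolding bnC[symmetric]
  proof (rule block_norm_mono)
    show "cmod (?D j) \<le> cmod (cscale (of_real ?C) (extremal r x 0) j)" for j
      unfolding cs by (rule extremal_lipschitz(2)[OF r Re, of z]) (use Re in simp)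
  qed
  have D: "?D \<in> vecs X0"
  proof -
    have "lq_le p0 (\<lambda>k. ?C * block_norm (extremal r x 0) k) (?C * nrm XP x)"
      using Re by (intro lq_le_scale p0 extremal_lq_bounds(1)[OF r]) auto
    then have "lq_le p0 (block_norm ?D) (?C * nrm XP x)"
      by (rule lq_le_mono[OF p0]) (use bnD in auto)
    then show ?thesis by (simp add: lq_le_iff[OF p0])
  qed
  have near: "\<forall>\<^sub>F w in at z. Re z / 2 \<le> Re w"
  proof -
    have "open {w. Re z / 2 < Re w}" by (rule open_halfspace_Re_gt)
    then have "\<forall>\<^sub>F w in at z. w \<in> {w. Re z / 2 < Re w}"
      using Re by (intro eventually_at_in_open') auto
    then show ?thesis by (rule eventually_mono) auto
  qed
  have lim: "((\<lambda>w. nrm X0 (?Q w - ?D)) \<longlongrightarrow> 0) (at z)"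
  proof (rule l_sum_dominated_tendsto_0[OF p0 lq_vanishing_tails_scale[OF p0 d, of "2 * ?C"]])
    show "\<forall>\<^sub>F w in at z. \<forall>k. block_norm (?Q w - ?D) k \<le> 2 * ?C * block_norm (extremal r x 0) k"
      using near
    proof eventually_elim
      case (elim w)
      show ?case
      proof
        fix k
        have "block_norm (?Q w) k \<le> ?C * block_norm (extremal r x 0) k"
          unfolding bnC[symmetric]
        proof (rule block_norm_mono)
          fix j
          have "cmod (extremal r x w j - extremal r x z j) / cmod (w - z) \<le> ?C * cmod (extremal r x 0 j)"
          proof (cases "w = z")
            case False
            then show ?thesis
              using extremal_lipschitz(1)[OF r Re elim, of j] by (simp only: pos_divide_le_eq zero_less_norm_iff right_minus_eq not_False_eq_True)
          qed (use Re in simp)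
          then show "cmod (?Q w j) \<le> cmod (cscale (of_real ?C) (extremal r x 0) j)"
            unfolding cs by (simp add: cscale_def norm_mult norm_inverse divide_inverse mult.commute)
        qed
        then show "block_norm (?Q w - ?D) k \<le> 2 * ?C * block_norm (extremal r x 0) k"
          using block_norm_triangle_diff[of "?Q w" ?D k] bnD[of k] by simp
      qed
    qed
    show "((\<lambda>w. (?Q w - ?D) j) \<longlongrightarrow> 0) (at z)" for j
    proof -
      have "((\<lambda>w. (extremal r x w j - extremal r x z j) / (w - z)) \<longlongrightarrow> ?D j) (at z)"
        using extremal_derivative[of r x j z UNIV] by (simp add: has_field_derivative_iff)
      then have "((\<lambda>w. (extremal r x w j - extremal r x z j) / (w - z) - ?D j) \<longlongrightarrow> 0) (at z)"
        by (rule LIM_zero)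
      moreover have "(extremal r x w j - extremal r x z j) / (w - z) - ?D j = (?Q w - ?D) j" for w
        by (simp add: cscale_def divide_inverse mult.commute)
      ultimately show ?thesis by (simp only:)
    qed
  qed (use Re in auto)
  have "((\<lambda>w. nrm \<Sigma>X (?Q w - ?D)) \<longlongrightarrow> 0) (at z)"
  proof (rule Lim_transform_eventually[OF lim])
    show "\<forall>\<^sub>F w in at z. nrm X0 (?Q w - ?D) = nrm \<Sigma>X (?Q w - ?D)"
      using near
    proof eventually_elim
      case (elim w)
      have "?Q w - ?D \<in> vecs X0"
        by (intro l_sum_minus[OF p0, THEN conjunct1] l_sum_cscale_le[OF p0, THEN conjunct1] vec D)
           (use elim Re in auto)
      then show ?case by (simp only: sum_space_eq(2))
    qed
  qed
  then show ?thesis unfolding has_seq_derivative_def sum_space_eq(1) using D by simp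
qed

lemma extremal_in_calderon:
  assumes x: "x \<in> vecs XP" and B: "1 \<le> B" and v: "vanishing_weight B (mass x) v"
  defines "r \<equiv> \<lambda>k. mass x k / v k"
  shows "extremal r x \<in> calderon X0 X1" and "calderon_norm X0 X1 (extremal r x) \<le> nrm XP x * B powr recip p1"
proof -
  let ?F = "extremal r x"
  let ?d = "\<lambda>k. nrm XP x * (mass x k powr recip p0 * v k powr (\<beta> * \<theta>))"
  let ?e = "\<lambda>k. nrm XP x * r k powr recip p1"
  have r: "weight_for x B r" unfolding r_def by (rule vanishing_weight_weight_for(1)[OF x B v])
  have v0: "0 \<le> v k" for k using v by (simp add: vanishing_weight_def)
  have N: "0 \<le> nrm XP x" by (rule nrm_XP_nonneg[OF x])
  have left: "block_norm (?F z) k \<le> ?d k" if "0 \<le> Re z" for z k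
    by (rule extremal_left_bound[OF r _ v0 that])
       (use vanishing_weight_weight_for(2)[OF x B v] in \<open>simp add: r_def\<close>)
  have vec0: "?F z \<in> vecs X0 \<and> nrm X0 (?F z) \<le> nrm XP x" if "0 \<le> Re z" for z
    using extremal_lq_bounds(1)[OF r that] by (simp add: lq_le_iff[OF p0])
  have vec1: "?F z \<in> vecs X1" if "Re z = 1" for z
    using extremal_lq_bounds(2)[OF r that] by (simp add: lq_le_iff[OF p1])
  have dv: "lq_vanishing_tails p0 ?d" by (rule left_majorant_vanishing[OF x v])
  have sb: "strip_bounded (nrm XP x * B powr recip p1) ?F" by (rule extremal_strip_bounded[OF r])
  show "calderon_norm X0 X1 ?F \<le> nrm XP x * B powr recip p1"
    by (rule strip_bounded_calderon_norm_le(1)[OF sb])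
  have c_line: "continuous_on UNIV (\<lambda>t. ?F (Complex a t) j)" for a j
  proof -
    have "continuous_on UNIV (\<lambda>t. ?F (of_real a + \<i> * of_real t) j)"
      by (rule continuous_on_compose2[OF extremal_continuous[of UNIV r x j]])
         (auto intro!: continuous_intros)
    then show ?thesis by (simp add: Complex_eq)
  qed
  have strip0: "0 \<le> Re z" if "z \<in> closed_strip" for z using that by (simp add: closed_strip_def)
  have c0: "seq_continuous_on X0 closed_strip ?F"
    by (rule seq_continuous_on_dominated[OF p0 dv _ _ _ extremal_continuous])
       (use N v0 left vec0 strip0 in auto)
  show "?F \<in> calderon X0 X1"
    unfolding calderon_def mem_Collect_eq
  proof (intro conjI ballI)
    show "seq_continuous_on \<Sigma>X closed_strip ?F"
      unfolding seq_continuous_on_def sum_space_eq(1)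
    proof (intro conjI ballI)
      show "?F ` closed_strip \<subseteq> vecs X0" using vec0 strip0 by blast
      fix z assume z: "z \<in> closed_strip"
      have "((\<lambda>w. nrm X0 (?F w - ?F z)) \<longlongrightarrow> 0) (at z within closed_strip)"
        using c0 z by (simp add: seq_continuous_on_def)
      then show "((\<lambda>w. nrm \<Sigma>X (?F w - ?F z)) \<longlongrightarrow> 0) (at z within closed_strip)"
      proof (rule Lim_transform_eventually)
        show "\<forall>\<^sub>F w in at z within closed_strip. nrm X0 (?F w - ?F z) = nrm \<Sigma>X (?F w - ?F z)"
        proof (rule eventually_at_filter[THEN iffD2], intro always_eventually allI impI)
          fix w assume "w \<in> closed_strip"
          then have "?F w - ?F z \<in> vecs X0"
            using vec0 strip0 z by (intro l_sum_minus[OF p0, THEN conjunct1]) auto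
          then show "nrm X0 (?F w - ?F z) = nrm \<Sigma>X (?F w - ?F z)" by (simp only: sum_space_eq(2))
        qed
      qed
    qed
    show "seq_bounded_on \<Sigma>X closed_strip ?F"
      unfolding seq_bounded_on_def sum_space_eq(1)
    proof (intro conjI exI[of _ "nrm XP x"] ballI)
      show "?F ` closed_strip \<subseteq> vecs X0" using vec0 strip0 by blast
      show "nrm \<Sigma>X (?F z) \<le> nrm XP x" if "z \<in> closed_strip" for z
        using vec0[OF strip0[OF that]] sum_space_eq(2)[of "?F z"] by simp
    qed
    show "\<exists>D. has_seq_derivative \<Sigma>X ?F D z" if "z \<in> open_strip" for z
    proof -
      have "lq_vanishing_tails p0 (block_norm (?F 0))"
        by (rule lq_vanishing_tails_mono[OF p0 dv]) (use left[of 0] in auto)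
      then show ?thesis using extremal_has_seq_derivative[OF r _ that] by blast
    qed
    show "seq_continuous_on X0 UNIV (\<lambda>t. ?F (Complex 0 t))"
      by (rule seq_continuous_on_dominated[OF p0 dv _ _ _ c_line]) (use N v0 left vec0 in auto)
    show "seq_continuous_on X1 UNIV (\<lambda>t. ?F (Complex 1 t))"
      by (rule seq_continuous_on_dominated[OF p1 right_majorant_vanishing[OF r] _ _ _ c_line])
         (use N extremal_right_bound[OF r] vec1 in auto)
  qed (rule strip_bounded_calderon_norm_le[OF sb])+
qed

abbreviation "X\<theta> \<equiv> interp_space (l_sum p0) (l_sum p1) \<theta>"

lemma calderon_value:
  assumes "F \<in> calderon X0 X1"
  shows "F (of_real \<theta>) \<in> vecs XP" "nrm XP (F (of_real \<theta>)) \<le> calderon_norm X0 X1 F"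
  using interpolation_estimate[OF calderon_coordinatewise(4)[OF assms]] by (simp_all add: lq_le_iff[OF P_ereal])

text \<open>\<open>B\<close> can be taken arbitrarily close to 1, so the two norms will agree exactly and not just up to a constant.\<close>

lemma almost_optimal_extension:
  assumes x: "x \<in> vecs XP" and B: "1 < B"
  obtains F where "F \<in> calderon X0 X1" "F (of_real \<theta>) = x" "calderon_norm X0 X1 F \<le> nrm XP x * B powr recip p1"
proof -
  obtain v where v: "vanishing_weight B (mass x) v"
    using vanishing_weight_exists[OF mass_nonneg sum_mass_le[OF x] B] by blast
  show thesis
    by (rule that[OF extremal_in_calderon(1)[OF x _ v] extremal_theta extremal_in_calderon(2)[OF x _ v]])
       (use B in auto)
qed

lemma vecs_interp_space: "vecs X\<theta> = vecs XP"
proof (intro equalityI subsetI)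
  show "x \<in> vecs XP" if "x \<in> vecs X\<theta>" for x
    using that calderon_value(1) by (auto simp: interp_space_def)
  show "x \<in> vecs X\<theta>" if "x \<in> vecs XP" for x
    by (rule almost_optimal_extension[OF that, of 2]) (auto simp: interp_space_def)
qed

lemma nrm_interp_space:
  assumes x: "x \<in> vecs XP"
  shows "nrm X\<theta> x = nrm XP x"
proof -
  let ?A = "{calderon_norm X0 X1 F |F. F \<in> calderon X0 X1 \<and> F (of_real \<theta>) = x}"
  have lb: "nrm XP x \<le> a" if "a \<in> ?A" for a
    using that calderon_value(2) by blast
  have ub: "Inf ?A \<le> nrm XP x * B powr recip p1" if B: "1 < B" for B
  proof -
    obtain F where F: "F \<in> calderon X0 X1" "F (of_real \<theta>) = x" "calderon_norm X0 X1 F \<le> nrm XP x * B powr recip p1"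
      by (rule almost_optimal_extension[OF x B])
    have "Inf ?A \<le> calderon_norm X0 X1 F"
      using F lb by (intro cInf_lower bdd_belowI[of _ "nrm XP x"]) blast+
    then show ?thesis using F by simp
  qed
  have "Inf ?A \<le> nrm XP x"
  proof (rule tendsto_lowerbound[OF _ _ trivial_limit_at_right_real])
    show "((\<lambda>B. nrm XP x * B powr recip p1) \<longlongrightarrow> nrm XP x) (at_right 1)"
      by (auto intro!: tendsto_eq_intros)
    show "\<forall>\<^sub>F B in at_right 1. Inf ?A \<le> nrm XP x * B powr recip p1"
      using ub by (auto simp: eventually_at_filter)
  qed
  moreover have "nrm XP x \<le> Inf ?A"
  proof (rule cInf_greatest[OF _ lb])
    show "?A \<noteq> {}" by (rule almost_optimal_extension[OF x, of 2]) auto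
  qed
  ultimately show ?thesis by (simp add: interp_space_def)
qed

theorem interp_space_eq: "same_space X\<theta> XP"
  by (simp add: same_space_def vecs_interp_space nrm_interp_space)

end

section \<open>The associated centralizer\<close>

context interpolation_exponents
begin

abbreviation "\<Omega> \<equiv> Omega p0 p1 (ereal P)"

lemma Omega_coefficient: "real_of_ereal (ereal P / p1 - ereal P / p0) = P * \<beta>"
proof -
  obtain s where s: "p1 = ereal s" "1 \<le> s" by (rule p1_finite)
  show ?thesis
    using p0
  proof (cases rule: exponent_cases)
    case 1
    then show ?thesis unfolding \<beta>_def using s by simp
  next
    case (2 r)
    then show ?thesis unfolding \<beta>_def using s by (simp add: right_diff_distrib)
  qed
qed

lemma Omega_apply: "\<Omega> x j = of_real (P * \<beta> * ln (block_norm x (block j) / nrm XP x)) * x j"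
  unfolding Omega_def Omega_coefficient ..

lemma Omega_eq_mass:
  assumes "x \<in> vecs XP"
  shows "\<Omega> x j = of_real (\<beta> * ln (mass x (block j))) * x j"
proof (cases "x j = 0")
  case False
  then have "0 < block_norm x (block j)"
    using cmod_le_block_norm[of x j] by (meson less_le_trans zero_less_norm_iff)
  moreover have "block_norm x (block j) \<le> nrm XP x"
    using lq_le_component[OF P_ereal lq_le_nrm[OF P_ereal assms]] by simp
  ultimately show ?thesis by (simp add: Omega_apply mass_def ln_powr)
qed (simp add: Omega_apply)

lemma Omega_cscale:
  assumes "x \<in> vecs XP"
  shows "\<Omega> (cscale c x) = cscale c (\<Omega> x)"
proof
  fix j
  have "block_norm (cscale c x) k / nrm XP (cscale c x) = block_norm x k / nrm XP x" if "c \<noteq> 0" for k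
    using that by (simp add: block_norm_cscale l_sum_cscale[OF P_ereal assms])
  moreover have "cscale c y j = c * y j" for y :: "basis_index \<Rightarrow> complex" by (simp add: cscale_def)
  ultimately show "\<Omega> (cscale c x) j = cscale c (\<Omega> x) j"
    by (cases "c = 0") (simp_all add: Omega_apply)
qed

lemma mass_cscale:
  assumes "x \<in> vecs XP" "c \<noteq> 0"
  shows "mass (cscale c x) = mass x"
  using assms by (auto simp: mass_def block_norm_cscale l_sum_cscale[OF P_ereal] fun_eq_iff)

lemma strip_bounded_diff:
  assumes f: "strip_bounded A f" and g: "strip_bounded B g"
  shows "strip_bounded (A + B) (\<lambda>z. f z - g z)"
  unfolding strip_bounded_def
proof (intro allI conjI)
  fix j
  show "continuous_on closed_strip (\<lambda>z. (f z - g z) j)" "(\<lambda>z. (f z - g z) j) holomorphic_on open_strip"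
    using f g by (auto simp: strip_bounded_def intro!: continuous_intros holomorphic_intros)
  obtain K K' where "\<And>z. z \<in> closed_strip \<Longrightarrow> cmod (f z j) \<le> K" "\<And>z. z \<in> closed_strip \<Longrightarrow> cmod (g z j) \<le> K'"
    using f g unfolding strip_bounded_def by metis
  then have "cmod ((f z - g z) j) \<le> K + K'" if "z \<in> closed_strip" for z
    using norm_triangle_ineq4[of "f z j" "g z j"] that by (force intro: order_trans)
  then show "\<exists>K. \<forall>z\<in>closed_strip. cmod ((f z - g z) j) \<le> K" by blast
next
  fix t
  have *: "lq_le q (block_norm (v - w)) (A + B)"
    if "1 \<le> q" "lq_le q (block_norm v) A" "lq_le q (block_norm w) B" for q v w
    by (rule lq_le_mono[OF that(1) lq_le_add[OF that]]) (auto simp: block_norm_triangle_diff)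
  show "lq_le p0 (block_norm (f (Complex 0 t) - g (Complex 0 t))) (A + B)"
    "lq_le p1 (block_norm (f (Complex 1 t) - g (Complex 1 t))) (A + B)"
    using f g by (auto simp: strip_bounded_def intro!: * p0 p1)
qed

text \<open>The function \<open>F\<close> and the optimal extension of \<open>x\<close> agree at \<open>\<theta>\<close>, and the latter has derivative \<open>\<Omega> x\<close>; the
derivative of their difference is therefore controlled by \<open>derivative_estimate\<close>.\<close>

lemma selection_derivative_estimate:
  assumes F: "F \<in> calderon X0 X1"
  defines "x \<equiv> F (of_real \<theta>)"
  shows "lq_le (ereal P) (block_norm (\<Omega> x - seq_deriv \<Sigma>X F (of_real \<theta>)))
    ((calderon_norm X0 X1 F + nrm XP x) / min \<theta> (1 - \<theta>))"
proof -
  have x: "x \<in> vecs XP" unfolding x_def by (rule calderon_value[OF F])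
  have "mass x k \<le> 1" for k
    using member_le_sum[of k "{..<Suc k}" "mass x"] sum_mass_le[OF x, of "Suc k"] by (simp del: sum.lessThan_Suc)
  then have w: "weight_for x 1 (mass x)"
    using x sum_mass_le[OF x] by (simp add: weight_for_def)
  let ?E = "extremal (mass x) x"
  have E: "strip_bounded (nrm XP x) ?E"
    using extremal_strip_bounded[OF w] by simp
  note Fb = calderon_coordinatewise(4)[OF F]
  have zero: "F (of_real \<theta>) - ?E (of_real \<theta>) = 0" by (simp add: extremal_theta x_def)
  have "deriv (\<lambda>z. (F z - ?E z) j) (of_real \<theta>) = deriv (\<lambda>z. F z j) (of_real \<theta>) - \<Omega> x j" for j
  proof -
    have "((\<lambda>z. F z j) has_field_derivative deriv (\<lambda>z. F z j) (of_real \<theta>)) (at (of_real \<theta>))"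
      using Fb open_open_strip theta_in_strip(1)
      by (intro holomorphic_derivI[of _ open_strip]) (auto simp: strip_bounded_def)
    from DERIV_diff[OF this extremal_derivative[of "mass x" x j "of_real \<theta>" UNIV]]
    show ?thesis
      by (auto simp: extremal_theta Omega_eq_mass[OF x] intro!: DERIV_imp_deriv)
  qed
  then have eq: "(\<lambda>j. deriv (\<lambda>z. (F z - ?E z) j) (of_real \<theta>)) = - (\<Omega> x - seq_deriv \<Sigma>X F (of_real \<theta>))"
    by (auto simp: calderon_coordinatewise(3)[OF F])
  show ?thesis
    using derivative_estimate[OF strip_bounded_diff[OF Fb E] zero] unfolding eq block_norm_uminus .
qed

text \<open>The weight is chosen as a function of the masses. A nonzero scalar does not change these, so the selection is
homogeneous although the choice is arbitrary.\<close>

lemma selection_exists: "\<exists>B. bounded_homogeneous_selection X0 X1 \<theta> B"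
proof -
  define V where "V = (\<lambda>c. SOME v. vanishing_weight 2 c v)"
  define B where "B = (\<lambda>x. extremal (\<lambda>k. mass x k / V (mass x) k) x)"
  have V: "vanishing_weight 2 (mass x) (V (mass x))" if "x \<in> vecs XP" for x
    unfolding V_def by (rule someI_ex[OF vanishing_weight_exists[OF mass_nonneg sum_mass_le[OF that]]]) simp
  have "bounded_homogeneous_selection X0 X1 \<theta> B"
    unfolding bounded_homogeneous_selection_def vecs_interp_space
  proof (intro conjI ballI allI exI[of _ "2 powr recip p1"])
    fix x assume x: "x \<in> vecs XP"
    show "B x \<in> calderon X0 X1" unfolding B_def by (rule extremal_in_calderon(1)[OF x _ V[OF x]]) simp
    show "B x (of_real \<theta>) = x" by (simp add: B_def extremal_theta)
    show "calderon_norm X0 X1 (B x) \<le> 2 powr recip p1 * nrm X\<theta> x"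
      unfolding B_def nrm_interp_space[OF x] using extremal_in_calderon(2)[OF x _ V[OF x]] by (simp add: mult.commute)
    show "B (cscale c x) z = cscale c (B x z)" for c z
    proof (cases "c = 0")
      case False
      show ?thesis unfolding B_def mass_cscale[OF x False] by (simp add: extremal_def cscale_def mult.assoc)
    qed (simp add: B_def extremal_def cscale_def)
  qed
  then show ?thesis by blast
qed

lemma seq_deriv_homogeneous:
  assumes B: "bounded_homogeneous_selection X0 X1 \<theta> B" and x: "x \<in> vecs XP"
  shows "seq_deriv \<Sigma>X (B (cscale c x)) (of_real \<theta>) = cscale c (seq_deriv \<Sigma>X (B x) (of_real \<theta>))"
proof
  fix j
  have cx: "cscale c x \<in> vecs XP" using l_sum_cscale_le[OF P_ereal x] by blast
  have cal: "B y \<in> calderon X0 X1" if "y \<in> vecs XP" for y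
    using B that by (simp add: bounded_homogeneous_selection_def vecs_interp_space)
  have hom: "B (cscale c x) z = cscale c (B x z)" if "z \<in> open_strip" for z
    using B x that open_strip_subset by (auto simp: bounded_homogeneous_selection_def vecs_interp_space)
  have "deriv (\<lambda>w. B (cscale c x) w j) (of_real \<theta>) = deriv (\<lambda>w. c * B x w j) (of_real \<theta>)"
  proof (rule deriv_cong_ev)
    show "\<forall>\<^sub>F w in nhds (of_real \<theta>). B (cscale c x) w j = c * B x w j"
      using eventually_nhds_in_open[OF open_open_strip theta_in_strip(1)]
      by (rule eventually_mono) (simp only: hom, simp add: cscale_def)
  qed simp
  also have "\<dots> = c * deriv (\<lambda>w. B x w j) (of_real \<theta>)"
    using calderon_coordinatewise(4)[OF cal[OF x]] open_open_strip theta_in_strip(1)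
    by (intro deriv_cmult holomorphic_on_imp_differentiable_at[of _ open_strip]) (auto simp: strip_bounded_def)
  finally show "seq_deriv \<Sigma>X (B (cscale c x)) (of_real \<theta>) j = cscale c (seq_deriv \<Sigma>X (B x) (of_real \<theta>)) j"
    unfolding calderon_coordinatewise(3)[OF cal[OF x]] calderon_coordinatewise(3)[OF cal[OF cx]] by (simp add: cscale_def)
qed

theorem Omega_is_associated_centralizer: "associated_centralizer X0 X1 \<theta> \<Omega>"
  unfolding associated_centralizer_def
proof (intro conjI allI impI)
  show "\<exists>B. bounded_homogeneous_selection X0 X1 \<theta> B" by (rule selection_exists)
  fix B assume B: "bounded_homogeneous_selection X0 X1 \<theta> B"
  let ?T = "\<lambda>x. \<Omega> x - seq_deriv \<Sigma>X (B x) (of_real \<theta>)"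
  let ?\<rho> = "min \<theta> (1 - \<theta>)"
  obtain K where K: "\<And>x. x \<in> vecs XP \<Longrightarrow> calderon_norm X0 X1 (B x) \<le> K * nrm XP x"
  proof -
    obtain K where "\<forall>x\<in>vecs XP. calderon_norm X0 X1 (B x) \<le> K * nrm X\<theta> x"
      using B unfolding bounded_homogeneous_selection_def vecs_interp_space by blast
    then show thesis using that[of K] nrm_interp_space by simp
  qed
  have est: "?T x \<in> vecs XP \<and> nrm XP (?T x) \<le> (K + 1) / ?\<rho> * nrm XP x" if x: "x \<in> vecs XP" for x
  proof -
    have F: "B x \<in> calderon X0 X1" "B x (of_real \<theta>) = x"
      using B x by (auto simp: bounded_homogeneous_selection_def vecs_interp_space)
    have T: "?T x \<in> vecs XP \<and> nrm XP (?T x) \<le> (calderon_norm X0 X1 (B x) + nrm XP x) / ?\<rho>"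
      using selection_derivative_estimate[OF F(1)] unfolding F(2) lq_le_iff[OF P_ereal] .
    have "(calderon_norm X0 X1 (B x) + nrm XP x) / ?\<rho> \<le> (K * nrm XP x + nrm XP x) / ?\<rho>"
      using K[OF x] \<theta> by (intro divide_right_mono) auto
    then show ?thesis using T by (simp add: algebra_simps)
  qed
  show "bounded_homogeneous_map X\<theta> ?T"
    unfolding bounded_homogeneous_map_def vecs_interp_space
  proof (intro conjI ballI allI exI[of _ "(K + 1) / ?\<rho>"])
    fix x assume x: "x \<in> vecs XP"
    show "?T x \<in> vecs XP" using est[OF x] by blast
    show "nrm X\<theta> (?T x) \<le> (K + 1) / ?\<rho> * nrm X\<theta> x"
      using est[OF x] nrm_interp_space x by simp
    show "?T (cscale c x) = cscale c (?T x)" for c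
      unfolding Omega_cscale[OF x] seq_deriv_homogeneous[OF B x]
      by (simp add: cscale_def fun_eq_iff right_diff_distrib)
  qed
qed

end

section \<open>Triviality on single blocks\<close>

context interpolation_exponents
begin

lemma nrm_single_block:
  assumes "\<And>j. block j \<noteq> n \<Longrightarrow> x j = 0"
  shows "nrm XP x = block_norm x n"
proof -
  have "block_norm x k = 0" if "k \<noteq> n" for k
    using assms that by (auto simp: block_norm_eq_0_iff)
  then have "(\<lambda>k. block_norm x k powr P) sums (block_norm x n powr P)"
    using sums_single[of n "\<lambda>k. block_norm x k powr P"] by (auto intro: sums_cong[THEN iffD1, rotated])
  then have "(\<Sum>k. block_norm x k powr P) = block_norm x n powr P" by (simp add: sums_iff)
  then show ?thesis using P_gt_1 by (simp add: l_sum_def powr_powr)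
qed

lemma Omega_single_block:
  assumes "\<And>j. block j \<noteq> n \<Longrightarrow> x j = 0"
  shows "\<Omega> x = 0"
proof
  fix j
  show "\<Omega> x j = 0 j"
  proof (cases "block j = n \<and> x j \<noteq> 0")
    case True
    then have "block_norm x n \<noteq> 0" by (auto simp: block_norm_eq_0_iff)
    then show ?thesis using True by (simp add: Omega_apply nrm_single_block[of n x, OF assms])
  qed (use assms in \<open>auto simp: Omega_apply\<close>)
qed

text \<open>The block \<open>n\<close> itself is the subspace, with \<open>L = 0\<close>.\<close>

lemma superdisjoint_modulus_zero: "superdisjoint_modulus XP \<Omega> n = 0"
proof -
  define e :: "basis_index \<Rightarrow> basis_index \<Rightarrow> complex" where "e = (\<lambda>j i. if i = j then 1 else 0)"
  define U where "U = e ` {j. block j = n}"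
  let ?E = "cseq.span U"
  have inj: "inj e" by (auto simp: inj_def e_def fun_eq_iff split: if_splits)
  have fin: "finite U" by (simp add: U_def finite_block)
  have supp: "supp (e j) = {j}" for j by (auto simp: supp_def e_def)
  have indep: "cseq.independent U"
  proof (rule cseq.independent_if_scalars_zero[OF fin])
    fix f u assume s: "(\<Sum>x\<in>U. cscale (f x) x) = 0" and "u \<in> U"
    then obtain j where j: "u = e j" "block j = n" by (auto simp: U_def)
    have ev: "(\<Sum>x\<in>A. cscale (f x) x) i = (\<Sum>x\<in>A. f x * x i)" if "finite A" for A i
      using that by (induction rule: finite_induct) (auto simp: cscale_def)
    have "0 = (\<Sum>x\<in>U. f x * x j)" using ev[OF fin, of j] s by simp
    also have "\<dots> = (\<Sum>i | block i = n. f (e i) * e i j)"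
      unfolding U_def by (subst sum.reindex) (auto intro: inj_on_subset[OF inj])
    also have "\<dots> = (\<Sum>i \<in> {j}. f (e i) * e i j)"
      using j by (intro sum.mono_neutral_right) (auto simp: e_def finite_block)
    finally show "f u = 0" using j by (simp add: e_def)
  qed
  have E: "?E \<in> disjoint_subspaces XP n"
    unfolding disjoint_subspaces_def mem_Collect_eq
  proof (intro exI[of _ U] conjI fin refl)
    show "U \<subseteq> vecs XP"
      unfolding U_def by (auto intro!: finitely_supported_in_l_sum[OF P_ereal, of "Suc n"] simp: e_def)
    show "disjoint_family_on supp U"
      unfolding U_def disjoint_family_on_def by (auto simp: supp)
    show "cseq.dim ?E = n"
      using cseq.dim_eq_card_independent[OF indep] inj_on_subset[OF inj]
      by (simp add: U_def card_image card_block)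
  qed
  have block: "x j = 0" if "x \<in> ?E" "block j \<noteq> n" for x j
  proof -
    have "?E \<subseteq> {x. \<forall>j. block j \<noteq> n \<longrightarrow> x j = 0}"
      by (intro cseq.span_minimal cseq.subspaceI) (auto simp: U_def e_def cscale_def)
    then show ?thesis using that by blast
  qed
  have lin: "(\<lambda>_. 0) \<in> {L. linear_on_seq ?E L}"
    by (auto simp: linear_on_seq_def cscale_def fun_eq_iff)
  have ext: "extended_nrm XP (\<Omega> x - 0) = 0" if "x \<in> ?E" for x
    using Omega_single_block[of n x] block[OF that] l_sum_zero[OF P_ereal] by (simp add: extended_nrm_def)
  have "superdisjoint_modulus XP \<Omega> n \<le> (SUP x \<in> {x \<in> ?E. nrm XP x \<le> 1}. extended_nrm XP (\<Omega> x - 0))"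
    unfolding superdisjoint_modulus_def by (rule INF_lower2[OF E], rule INF_lower2[OF lin]) simp
  also have "\<dots> \<le> 0" by (intro SUP_least) (simp only: ext mem_Collect_eq order_refl)
  finally show ?thesis by simp
qed

theorem not_super_disjointly_singular: "\<not> super_disjointly_singular XP \<Omega>"
proof
  assume "super_disjointly_singular XP \<Omega>"
  then have "(\<lambda>n. 0 :: ennreal) \<longlonglongrightarrow> \<infinity>"
    by (simp add: super_disjointly_singular_def superdisjoint_modulus_zero[abs_def])
  then show False using LIMSEQ_unique[OF tendsto_const] by fastforce
qed

end

section \<open>Spans of disjointly supported sequences\<close>

lemma sum_cscale_apply: "(\<Sum>i\<in>A. cscale (c i) (x i)) j = (\<Sum>i\<in>A. c i * x i j)"
  by (induction A rule: infinite_finite_induct) (auto simp: cscale_def)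

lemma l_sum_subspace: "1 \<le> q \<Longrightarrow> cseq.subspace (vecs (l_sum q))"
  by (intro cseq.subspaceI) (auto simp: l_sum_zero l_sum_add l_sum_cscale_le)

lemma span_subset_closed_span:
  assumes "1 \<le> q" "U \<subseteq> vecs (l_sum q)"
  shows "cseq.span U \<subseteq> closed_span (l_sum q) U"
proof
  fix x assume x: "x \<in> cseq.span U"
  have "cseq.span U \<subseteq> vecs (l_sum q)"
    by (rule cseq.span_minimal[OF assms(2) l_sum_subspace[OF assms(1)]])
  then have "x \<in> vecs (l_sum q)" using x by blast
  moreover have "nrm (l_sum q) (x - x) < e" if "0 < e" for e
    using that l_sum_zero(2)[OF assms(1)] by simp
  ultimately show "x \<in> closed_span (l_sum q) U" using x unfolding closed_span_def by blast
qed

lemma linear_on_seq_sum: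
  assumes L: "linear_on_seq H L" and H: "cseq.subspace S" "S \<subseteq> H" and u: "\<And>i. i \<in> A \<Longrightarrow> u i \<in> S"
  shows "L (\<Sum>i\<in>A. cscale (c i) (u i)) = (\<Sum>i\<in>A. cscale (c i) (L (u i)))"
proof -
  have add: "L (x + y) = L x + L y" if "x \<in> H" "y \<in> H" for x y
    using L that unfolding linear_on_seq_def by blast
  have scale: "L (cscale c x) = cscale c (L x)" if "x \<in> H" for x c
    using L that unfolding linear_on_seq_def by blast
  have "0 \<in> H" using cseq.subspace_0[OF H(1)] H(2) by blast
  then have zero: "L 0 = 0" using scale[of 0 0] by (simp only: cseq.scale_zero_left)
  show ?thesis
    using u
  proof (induction A rule: infinite_finite_induct)
  case (insert a A)
  have "cscale (c a) (u a) \<in> H" "(\<Sum>i\<in>A. cscale (c i) (u i)) \<in> H" "u a \<in> H"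
    using insert.prems H(2)
    by (auto intro!: subsetD[OF H(2)] cseq.subspace_scale[OF H(1)] cseq.subspace_sum[OF H(1)])
  then have "L (cscale (c a) (u a) + (\<Sum>i\<in>A. cscale (c i) (u i)))
      = cscale (c a) (L (u a)) + L (\<Sum>i\<in>A. cscale (c i) (u i))"
    using add scale \<open>cscale (c a) (u a) \<in> H\<close> \<open>(\<Sum>i\<in>A. cscale (c i) (u i)) \<in> H\<close> \<open>u a \<in> H\<close> by presburger
  moreover have "L (\<Sum>i\<in>A. cscale (c i) (u i)) = (\<Sum>i\<in>A. cscale (c i) (L (u i)))"
    using insert by blast
  ultimately show ?case using insert.hyps by (simp only: sum.insert not_False_eq_True)
qed (simp_all add: zero)
qed

text \<open>If only finitely many \<open>u n\<close> were nonzero, their span would be closed: pick a coordinate \<open>g n\<close> in the support of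
each. By disjointness the coefficients of a combination are read off at these coordinates, and the identity
expressing this passes to limits.\<close>

lemma infinitely_many_nonzero:
  fixes u :: "nat \<Rightarrow> basis_index \<Rightarrow> complex"
  assumes q: "1 \<le> q" and disj: "disjoint_family (\<lambda>n. supp (u n))"
    and inf: "infinite_dimensional (closed_span (l_sum q) (range u))"
  shows "infinite {n. u n \<noteq> 0}"
proof
  define I where "I = {n. u n \<noteq> 0}"
  assume "finite {n. u n \<noteq> 0}"
  then have fin: "finite I" by (simp add: I_def)
  have "\<forall>n\<in>I. \<exists>j. u n j \<noteq> 0" by (auto simp: I_def fun_eq_iff)
  then obtain g where g: "\<And>n. n \<in> I \<Longrightarrow> u n (g n) \<noteq> 0" by metis
  \<comment> \<open>The defect of the identity that recovers a vector from its coordinates at the points \<open>g n\<close>.\<close>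
  define \<phi> where "\<phi> = (\<lambda>(s :: basis_index \<Rightarrow> complex) j. s j - (\<Sum>n\<in>I. s (g n) / u n (g n) * u n j))"
  have \<phi>_add: "\<phi> (s + t) j = \<phi> s j + \<phi> t j" and \<phi>_diff: "\<phi> (s - t) j = \<phi> s j - \<phi> t j"
    and \<phi>_scale: "\<phi> (cscale c s) j = c * \<phi> s j" for s t c j
    unfolding \<phi>_def cscale_def plus_fun_apply minus_apply
    by (simp_all only: add_divide_distrib diff_divide_distrib distrib_right left_diff_distrib
        sum.distrib sum_subtractf sum_distrib_left right_diff_distrib times_divide_eq_right mult.assoc)
      (simp_all only: times_divide_eq_left mult.assoc, simp_all)
  have zero: "u m i = 0" if "u n i \<noteq> 0" "m \<noteq> n" for m n i
    using disj that unfolding disjoint_family_on_def supp_def by blast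
  have \<phi>_u: "\<phi> (u m) j = 0" for m j
  proof (cases "m \<in> I")
    case True
    have "(\<Sum>n\<in>I. u m (g n) / u n (g n) * u n j) = (\<Sum>n\<in>{m}. u m (g n) / u n (g n) * u n j)"
      using fin True zero g by (intro sum.mono_neutral_right) auto
    then show ?thesis using g[OF True] by (simp add: \<phi>_def)
  qed (simp add: \<phi>_def I_def)
  have \<phi>_span: "\<phi> s j = 0" if "s \<in> cseq.span (range u)" for s j
  proof -
    have "cseq.subspace {s. \<forall>j. \<phi> s j = 0}"
      by (intro cseq.subspaceI) (auto simp: \<phi>_add \<phi>_scale, simp add: \<phi>_def)
    then have "cseq.span (range u) \<subseteq> {s. \<forall>j. \<phi> s j = 0}"
      by (rule cseq.span_minimal[rotated]) (auto simp: \<phi>_u)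
    then show ?thesis using that by blast
  qed
  have \<phi>_closed: "\<phi> y j = 0" if y: "y \<in> closed_span (l_sum q) (range u)" for y j
  proof -
    define C where "C = 1 + (\<Sum>n\<in>I. cmod (u n j) / cmod (u n (g n)))"
    have C: "1 \<le> C" by (auto simp: C_def intro!: sum_nonneg)
    have "cmod (\<phi> y j) \<le> e" if "0 < e" for e
    proof -
      have "0 < e / C" using that C by simp
      then obtain s where s: "s \<in> cseq.span (range u)" "s \<in> vecs (l_sum q)" "nrm (l_sum q) (y - s) < e / C"
        and yv: "y \<in> vecs (l_sum q)"
        using y unfolding closed_span_def by blast
      have ys: "y - s \<in> vecs (l_sum q)" using l_sum_minus[OF q yv s(2)] by blast
      have small: "cmod ((y - s) i) \<le> e / C" for i
        using cmod_le_nrm[OF q ys, of i] s(3) by linarith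
      have "cmod (\<phi> y j) = cmod (\<phi> (y - s) j)" using \<phi>_span[OF s(1)] by (simp add: \<phi>_diff)
      also have "\<dots> \<le> cmod ((y - s) j) + (\<Sum>n\<in>I. cmod ((y - s) (g n) / u n (g n) * u n j))"
        unfolding \<phi>_def by (rule order_trans[OF norm_triangle_ineq4]) (intro add_mono norm_sum order_refl)
      also have "\<dots> \<le> e / C + (\<Sum>n\<in>I. e / C * (cmod (u n j) / cmod (u n (g n))))"
      proof (intro add_mono sum_mono small)
        fix n
        have "cmod ((y - s) (g n) / u n (g n) * u n j) = cmod ((y - s) (g n)) * (cmod (u n j) / cmod (u n (g n)))"
          by (simp add: norm_mult norm_divide)
        also have "\<dots> \<le> e / C * (cmod (u n j) / cmod (u n (g n)))"
          by (intro mult_right_mono small) simp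
        finally show "cmod ((y - s) (g n) / u n (g n) * u n j) \<le> e / C * (cmod (u n j) / cmod (u n (g n)))" .
      qed
      also have "\<dots> = e / C * C" unfolding C_def sum_distrib_left[symmetric] by (simp only: distrib_left mult_1_right)
      finally show ?thesis using C by simp
    qed
    then have "cmod (\<phi> y j) \<le> 0" by (rule field_le_epsilon[of _ 0, simplified])
    then show ?thesis by simp
  qed
  have "y \<in> cseq.span (u ` I)" if y: "y \<in> closed_span (l_sum q) (range u)" for y
  proof -
    have "y = (\<Sum>n\<in>I. cscale (y (g n) / u n (g n)) (u n))"
    proof
      fix j
      show "y j = (\<Sum>n\<in>I. cscale (y (g n) / u n (g n)) (u n)) j"
        using \<phi>_closed[OF y, of j] unfolding sum_cscale_apply \<phi>_def right_minus_eq .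
    qed
    also have "\<dots> \<in> cseq.span (u ` I)"
      by (intro cseq.span_sum cseq.span_scale cseq.span_base) auto
    finally show ?thesis .
  qed
  then show False using inf fin unfolding infinite_dimensional_def by blast
qed

text \<open>There are finitely many coordinates in the first \<open>M\<close> blocks, and each lies in at most one support.\<close>

lemma vanishing_on_initial_blocks:
  fixes u :: "nat \<Rightarrow> basis_index \<Rightarrow> complex"
  assumes disj: "disjoint_family (\<lambda>n. supp (u n))" and inf: "infinite {n. u n \<noteq> 0}"
  shows "\<exists>n. u n \<noteq> 0 \<and> (\<forall>j. block j < M \<longrightarrow> u n j = 0)"
proof (rule ccontr)
  assume contra: "\<not> ?thesis"
  have "\<forall>n\<in>{n. u n \<noteq> 0}. \<exists>j. block j < M \<and> u n j \<noteq> 0" using contra by blast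
  then obtain g where g: "\<And>n. u n \<noteq> 0 \<Longrightarrow> block (g n) < M \<and> u n (g n) \<noteq> 0"
    unfolding bchoice_iff by blast
  have "inj_on g {n. u n \<noteq> 0}"
  proof (rule inj_onI)
    fix m n assume m: "m \<in> {n. u n \<noteq> 0}" and n: "n \<in> {n. u n \<noteq> 0}" and e: "g m = g n"
    show "m = n"
    proof (rule ccontr)
      assume "m \<noteq> n"
      then have "supp (u m) \<inter> supp (u n) = {}" using disj by (simp add: disjoint_family_on_def)
      moreover have "g m \<in> supp (u m) \<inter> supp (u n)" using g[of m] g[of n] m n e by (simp add: supp_def)
      ultimately show False by blast
    qed
  qed
  moreover have "g ` {n. u n \<noteq> 0} \<subseteq> {j. block j < M}" using g by auto
  ultimately show False using finite_blocks_below inf inj_on_finite by blast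
qed

section \<open>Choice of signs and gliding humps\<close>

lemma powr_add_le:
  fixes x y q :: real
  assumes "0 \<le> x" "0 \<le> y" "0 < q" "q \<le> 1"
  shows "(x + y) powr q \<le> x powr q + y powr q"
proof (cases "x + y = 0")
  case False
  then have S: "0 < x + y" using assms by simp
  have le: "a \<le> a powr q" if "0 \<le> a" "a \<le> 1" for a :: real
    using powr_mono'[of q 1 a] that assms by simp
  have "1 = x / (x + y) + y / (x + y)" using S by (simp add: add_divide_distrib[symmetric])
  also have "\<dots> \<le> (x / (x + y)) powr q + (y / (x + y)) powr q"
    using S assms by (intro add_mono le) auto
  also have "\<dots> = (x powr q + y powr q) / (x + y) powr q"
    using S assms by (simp add: powr_divide add_divide_distrib)
  finally show ?thesis using S by (simp add: field_simps)
qed (use assms in auto)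

lemma powr_sum_subadditive:
  fixes f :: "'a \<Rightarrow> real"
  assumes "finite A" "\<And>i. i \<in> A \<Longrightarrow> 0 \<le> f i" "0 < q" "q \<le> 1"
  shows "(\<Sum>i\<in>A. f i) powr q \<le> (\<Sum>i\<in>A. f i powr q)"
  using assms(1,2)
proof (induction rule: finite_induct)
  case (insert a A)
  have "(f a + (\<Sum>i\<in>A. f i)) powr q \<le> f a powr q + (\<Sum>i\<in>A. f i) powr q"
    using insert assms by (intro powr_add_le sum_nonneg) auto
  then show ?case using insert by force
qed simp

text \<open>Concavity of \<open>t powr (p / 2)\<close> bounds the mean of \<open>s powr p\<close> and \<open>t powr p\<close> by \<open>(A\<^sup>2 + B\<^sup>2) powr (p / 2)\<close>, which is
at most \<open>A powr p + B powr p\<close> by subadditivity. Both need \<open>p \<le> 2\<close>.\<close>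

lemma parallelogram_powr:
  fixes s t A B p :: real
  assumes nonneg: "0 \<le> s" "0 \<le> t" "0 \<le> A" "0 \<le> B" and p: "0 < p" "p \<le> 2"
    and par: "s\<^sup>2 + t\<^sup>2 = 2 * (A\<^sup>2 + B\<^sup>2)"
  shows "s powr p + t powr p \<le> 2 * (A powr p + B powr p)"
proof -
  define q where "q = p / 2"
  have q: "0 < q" "q \<le> 1" using p by (auto simp: q_def)
  have sq: "a powr p = (a\<^sup>2) powr q" if "0 \<le> a" for a :: real
    using that powr_powr[of a 2 q] by (cases "a = 0") (auto simp: q_def)
  define m where "m = (1/2) * (s\<^sup>2) powr q + (1/2) * (t\<^sup>2) powr q"
  have "m powr (1/q) \<le> (1/2) * ((s\<^sup>2) powr q) powr (1/q) + (1/2) * ((t\<^sup>2) powr q) powr (1/q)"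
    unfolding m_def using q by (intro powr_convex_combination) auto
  then have "m powr (1/q) \<le> A\<^sup>2 + B\<^sup>2" using q par by (simp add: powr_powr)
  then have "(m powr (1/q)) powr q \<le> (A\<^sup>2 + B\<^sup>2) powr q"
    using q by (intro powr_mono2) auto
  moreover have "(m powr (1/q)) powr q = m" using q by (simp add: powr_powr m_def)
  moreover have "(A\<^sup>2 + B\<^sup>2) powr q \<le> (A\<^sup>2) powr q + (B\<^sup>2) powr q"
    using q by (intro powr_add_le) auto
  ultimately show ?thesis using nonneg sq by (simp add: m_def)
qed

lemma block_norm_parallelogram:
  "(block_norm (x + y) k)\<^sup>2 + (block_norm (x - y) k)\<^sup>2 = 2 * ((block_norm x k)\<^sup>2 + (block_norm y k)\<^sup>2)"
proof -
  have "(cmod (a + b))\<^sup>2 + (cmod (a - b))\<^sup>2 = 2 * ((cmod a)\<^sup>2 + (cmod b)\<^sup>2)" for a b :: complex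
    unfolding cmod_power2 by (simp add: power2_eq_square algebra_simps)
  then show ?thesis
    unfolding block_norm_power2 sum.distrib[symmetric] sum_distrib_left by simp
qed

lemma sum_consecutive_intervals:
  fixes f :: "nat \<Rightarrow> real"
  assumes N: "\<And>i. N i < N (Suc i)" and f: "\<And>k. 0 \<le> f k"
  shows "(\<Sum>i<n. \<Sum>k\<in>{N i..<N (Suc i)}. f k) \<le> (\<Sum>k<N n. f k)"
proof -
  have mono: "N 0 \<le> N n" for n
    by (induction n) (use N order.strict_implies_order order_trans in blast)+
  have "(\<Sum>i<n. \<Sum>k\<in>{N i..<N (Suc i)}. f k) = (\<Sum>k\<in>{N 0..<N n}. f k)"
  proof (induction n)
    case (Suc n)
    then show ?case
      using sum.atLeastLessThan_concat[OF mono[of n] less_imp_le[OF N[of n]], of f] by simp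
  qed simp
  also have "\<dots> \<le> (\<Sum>k<N n. f k)" using f by (intro sum_mono2) auto
  finally show ?thesis .
qed

text \<open>\<open>a i\<close> is the sequence of block norms of the \<open>i\<close>-th hump, which starts at \<open>N i\<close> and has all but \<open>2 powr (- i - 2)\<close> of its
mass before \<open>N (i + 1)\<close>; \<open>b\<close> is that of a signed sum of the first \<open>n\<close> humps. On the \<open>i\<close>-th interval later humps
vanish, so in a block where \<open>b > 2 a i\<close> the \<open>i\<close>-th hump has no more mass than the leaks of the earlier ones together. All leaks
up to the \<open>i\<close>-th amount to at most \<open>1 / 2\<close>, so mass at least \<open>1 / 2\<close> of the hump lies where it dominates.\<close>

lemma dominant_blocks:
  fixes a :: "nat \<Rightarrow> nat \<Rightarrow> real" and b :: "nat \<Rightarrow> real"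
  assumes p: "1 \<le> p" and N: "\<And>i. N i < N (Suc i)"
    and a0: "\<And>i k. 0 \<le> a i k" and b0: "\<And>k. 0 \<le> b k"
    and early: "\<And>i k. k < N i \<Longrightarrow> a i k = 0"
    and total: "\<And>i M. (\<Sum>k<M. a i k powr p) \<le> 1"
    and hump: "\<And>i. 1 - (1/2)^(i+2) \<le> (\<Sum>k\<in>{N i..<N (Suc i)}. a i k powr p)"
    and b: "\<And>k. b k powr p \<le> (\<Sum>m<n. a m k powr p)"
    and i: "i < n"
  shows "1 / 2 \<le> (\<Sum>k | k \<in> {N i..<N (Suc i)} \<and> b k \<le> 2 * a i k. a i k powr p)"
proof -
  define A where "A = (\<lambda>i. {N i..<N (Suc i)})"
  have finA: "finite (A i)" for i by (simp add: A_def)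
  have mono: "N i \<le> N j" if "i \<le> j" for i j
    using lift_Suc_mono_le[of N, OF less_imp_le[OF N] that] .
  have leak: "(\<Sum>k\<in>A i. a m k powr p) \<le> (1/2)^(m+2)" if "m < i" for m
  proof -
    have "Suc m \<le> i" using that by simp
    have dis: "A m \<inter> A i = {}" using mono[OF \<open>Suc m \<le> i\<close>] by (auto simp: A_def)
    have "(\<Sum>k\<in>A m. a m k powr p) + (\<Sum>k\<in>A i. a m k powr p) = (\<Sum>k\<in>A m \<union> A i. a m k powr p)"
      by (rule sum.union_disjoint[symmetric]) (use finA dis in auto)
    also have "\<dots> \<le> (\<Sum>k<N (Suc i). a m k powr p)"
      using mono[of "Suc m" "Suc i"] that by (intro sum_mono2) (auto simp: A_def)
    also have "\<dots> \<le> 1" by (rule total)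
    finally show ?thesis using hump[of m] by (simp add: A_def)
  qed
  have bad: "a i k powr p \<le> (\<Sum>m<i. a m k powr p)" if k: "k \<in> A i" "\<not> b k \<le> 2 * a i k" for k
  proof -
    have "2 * a i k powr p \<le> 2 powr p * a i k powr p"
      using powr_mono[of 1 p 2] p by (intro mult_right_mono) auto
    also have "\<dots> = (2 * a i k) powr p" using a0 by (simp add: powr_mult)
    also have "\<dots> \<le> b k powr p" using k(2) a0 p by (intro powr_mono2) auto
    also have "\<dots> \<le> (\<Sum>m<n. a m k powr p)" by (rule b)
    also have "\<dots> = (\<Sum>m<Suc i. a m k powr p)"
    proof (rule sum.mono_neutral_right)
      show "\<forall>m\<in>{..<n} - {..<Suc i}. a m k powr p = 0"
      proof
        fix m assume "m \<in> {..<n} - {..<Suc i}"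
        then have "k < N m" using k(1) mono[of "Suc i" m] by (auto simp: A_def)
        then show "a m k powr p = 0" by (simp add: early)
      qed
    qed (use i in auto)
    finally show ?thesis by simp
  qed
  \<comment> \<open>The good blocks, where the hump dominates, and the bad ones.\<close>
  let ?G = "{k \<in> A i. b k \<le> 2 * a i k}" and ?B = "{k \<in> A i. \<not> b k \<le> 2 * a i k}"
  have "(\<Sum>k\<in>?B. a i k powr p) \<le> (\<Sum>k\<in>?B. \<Sum>m<i. a m k powr p)"
    by (intro sum_mono bad) auto
  also have "\<dots> \<le> (\<Sum>k\<in>A i. \<Sum>m<i. a m k powr p)"
    using finA by (intro sum_mono2) (auto intro: sum_nonneg)
  also have "\<dots> = (\<Sum>m<i. \<Sum>k\<in>A i. a m k powr p)" by (rule sum.swap)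
  also have "\<dots> \<le> (\<Sum>m<i. (1/2)^(m+2))" by (intro sum_mono leak) auto
  finally have B: "(\<Sum>k\<in>?B. a i k powr p) \<le> (\<Sum>m<i. (1/2)^(m+2))" .
  have geo: "(\<Sum>m<Suc i. (1/2)^(m+2)) \<le> (1/2 :: real)"
  proof -
    have "(\<Sum>m<j. (1/2)^(m+2)) = 1/2 - (1/2 :: real)^(j+1)" for j
      by (induction j) (auto simp: field_simps)
    then show ?thesis by simp
  qed
  have "(\<Sum>k\<in>A i. a i k powr p) = (\<Sum>k\<in>?G. a i k powr p) + (\<Sum>k\<in>?B. a i k powr p)"
    using finA by (subst sum.union_disjoint[symmetric]) (auto intro!: sum.cong)
  then show ?thesis using B geo hump[of i] by (simp add: A_def)
qed

text \<open>Inside a block, disjoint supports mean orthogonality.\<close>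

lemma block_norm_disjoint_sum:
  assumes A: "finite A" and disj: "disjoint_family_on (\<lambda>i. supp (u i)) A" and c: "\<And>i. i \<in> A \<Longrightarrow> cmod (c i) = 1"
  shows "(block_norm (\<Sum>i\<in>A. cscale (c i) (u i)) k)\<^sup>2 = (\<Sum>i\<in>A. (block_norm (u i) k)\<^sup>2)"
proof -
  have "(cmod ((\<Sum>i\<in>A. cscale (c i) (u i)) j))\<^sup>2 = (\<Sum>i\<in>A. (cmod (u i j))\<^sup>2)" for j
  proof (cases "\<exists>i\<in>A. u i j \<noteq> 0")
    case True
    then obtain i where i: "i \<in> A" "u i j \<noteq> 0" by blast
    have z: "u m j = 0" if "m \<in> A" "m \<noteq> i" for m
      using disj i that unfolding disjoint_family_on_def supp_def by blast
    have "(\<Sum>m\<in>A. c m * u m j) = c i * u i j"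
      using A i z by (subst sum.remove[of A i]) auto
    moreover have "(\<Sum>m\<in>A. (cmod (u m j))\<^sup>2) = (cmod (u i j))\<^sup>2"
      using A i z by (subst sum.remove[of A i]) auto
    ultimately show ?thesis using c[OF i(1)] by (simp add: sum_cscale_apply norm_mult)
  qed (simp add: sum_cscale_apply)
  then have "(block_norm (\<Sum>i\<in>A. cscale (c i) (u i)) k)\<^sup>2 = (\<Sum>j | block j = k. \<Sum>i\<in>A. (cmod (u i j))\<^sup>2)"
    by (simp only: block_norm_power2)
  also have "\<dots> = (\<Sum>i\<in>A. (block_norm (u i) k)\<^sup>2)"
    unfolding block_norm_power2 by (rule sum.swap)
  finally show ?thesis .
qed

context interpolation_exponents
begin

text \<open>The \<open>P\<close>-th power of the norm. Unlike the norm it is additive over blocks.\<close>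

definition energy :: "(basis_index \<Rightarrow> complex) \<Rightarrow> real" where
  "energy x = (\<Sum>k. block_norm x k powr P)"

lemma energy:
  assumes "x \<in> vecs XP"
  shows "summable (\<lambda>k. block_norm x k powr P)" "energy x = nrm XP x powr P"
proof -
  show s: "summable (\<lambda>k. block_norm x k powr P)" using assms by (simp add: l_sum_def)
  show "energy x = nrm XP x powr P"
    using P_gt_1 suminf_nonneg[OF s] by (simp add: l_sum_def energy_def powr_powr)
qed

lemma energy_partial_sum_le:
  assumes "x \<in> vecs XP"
  shows "(\<Sum>k<M. block_norm x k powr P) \<le> energy x"
  unfolding energy_def by (rule sum_le_suminf[OF energy(1)[OF assms]]) auto

lemma energy_parallelogram:
  assumes x: "x \<in> vecs XP" and y: "y \<in> vecs XP" and P2: "P \<le> 2"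
  shows "energy (x + y) + energy (x - y) \<le> 2 * (energy x + energy y)"
proof -
  have s: "summable (\<lambda>k. block_norm z k powr P)" if "z \<in> {x, y, x + y, x - y}" for z
    using that x y l_sum_add[OF P_ereal x y] l_sum_minus[OF P_ereal x y] by (auto intro!: energy(1))
  have "energy (x + y) + energy (x - y) = (\<Sum>k. block_norm (x + y) k powr P + block_norm (x - y) k powr P)"
    unfolding energy_def by (rule suminf_add) (use s in auto)
  also have "\<dots> \<le> (\<Sum>k. 2 * (block_norm x k powr P + block_norm y k powr P))"
    using P_gt_1 P2
    by (intro suminf_le summable_add summable_mult s parallelogram_powr block_norm_parallelogram) auto
  also have "\<dots> = 2 * (\<Sum>k. block_norm x k powr P + block_norm y k powr P)"
    by (rule suminf_mult[OF summable_add]) (use s in auto)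
  also have "\<dots> = 2 * (energy x + energy y)"
    unfolding energy_def by (subst suminf_add) (use s in auto)
  finally show ?thesis .
qed

text \<open>The space has type \<open>P\<close>. Signs are chosen greedily: by \<open>energy_parallelogram\<close> one of the two signs of the next vector
adds at most its own energy.\<close>

lemma sign_choice:
  assumes d: "\<And>i. d i \<in> vecs XP" and P2: "P \<le> 2"
  obtains \<epsilon> :: "nat \<Rightarrow> complex" where "\<And>i. cmod (\<epsilon> i) = 1"
    "energy (\<Sum>i<n. cscale (\<epsilon> i) (d i)) \<le> (\<Sum>i<n. energy (d i))"
proof -
  have "\<exists>\<epsilon> :: nat \<Rightarrow> complex. (\<forall>i. cmod (\<epsilon> i) = 1) \<and>
      energy (\<Sum>i<n. cscale (\<epsilon> i) (d i)) \<le> (\<Sum>i<n. energy (d i))"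
  proof (induction n)
    case 0
    have "energy 0 = 0" using energy(2)[OF l_sum_zero(1)[OF P_ereal]] l_sum_zero(2)[OF P_ereal] by simp
    then show ?case
      by (intro exI[of _ "\<lambda>_. 1"]) (simp only: lessThan_0 sum.empty norm_one order_refl simp_thms)
  next
    case (Suc n)
    then obtain \<epsilon> :: "nat \<Rightarrow> complex" where \<epsilon>: "\<And>i. cmod (\<epsilon> i) = 1"
      "energy (\<Sum>i<n. cscale (\<epsilon> i) (d i)) \<le> (\<Sum>i<n. energy (d i))" by blast
    define y where "y = (\<Sum>i<n. cscale (\<epsilon> i) (d i))"
    have y: "y \<in> vecs XP"
      unfolding y_def
      by (intro cseq.subspace_sum[OF l_sum_subspace[OF P_ereal]] cseq.subspace_scale[OF l_sum_subspace[OF P_ereal]] d)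
    define c :: complex where "c = (if energy (y + d n) \<le> energy y + energy (d n) then 1 else -1)"
    have c: "cmod c = 1" by (simp add: c_def)
    have "energy (y + cscale c (d n)) \<le> energy y + energy (d n)"
    proof (cases "energy (y + d n) \<le> energy y + energy (d n)")
      case True
      then show ?thesis by (simp add: c_def cscale_def)
    next
      case False
      moreover have "b \<le> e" if "a + b \<le> 2 * e" "\<not> a \<le> e" for a b e :: real
        using that by linarith
      ultimately have "energy (y - d n) \<le> energy y + energy (d n)"
        using energy_parallelogram[OF y d[of n] P2] by blast
      moreover have "y + cscale (-1) (d n) = y - d n" by (simp add: cscale_def fun_eq_iff)
      ultimately show ?thesis using False by (simp add: c_def)
    qed
    moreover have "(\<Sum>i<Suc n. cscale ((\<epsilon>(n := c)) i) (d i)) = y + cscale c (d n)"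
      unfolding y_def by (simp add: add.commute)
    ultimately have "energy (\<Sum>i<Suc n. cscale ((\<epsilon>(n := c)) i) (d i)) \<le> (\<Sum>i<Suc n. energy (d i))"
      using \<epsilon>(2) by (simp add: y_def)
    moreover have "\<forall>i. cmod ((\<epsilon>(n := c)) i) = 1" using \<epsilon> c by simp
    ultimately show ?case by blast
  qed
  then show thesis using that by blast
qed

text \<open>At a coordinate in the support of \<open>u i\<close>, lying in the block \<open>k\<close>, the vector \<open>R\<close> equals the corresponding coordinate
of \<open>x\<close> times \<open>P \<beta> (ln (block_norm x k / block_norm (u i) k) - ln (nrm x))\<close>. In the blocks of \<open>dominant_blocks\<close> the
first logarithm is at most \<open>ln 2\<close>, while \<open>nrm x powr P \<ge> n / 2\<close>; so there \<open>R\<close> is at least \<open>\<tau>\<close> times \<open>u i\<close>, and these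
blocks carry at least half of the mass of every \<open>u i\<close>.\<close>

lemma Omega_sum_deviation_lower_bound:
  fixes u :: "nat \<Rightarrow> basis_index \<Rightarrow> complex"
  assumes P2: "P \<le> 2"
    and u: "\<And>i. u i \<in> vecs XP" "\<And>i. nrm XP (u i) = 1" and disj: "disjoint_family (\<lambda>i. supp (u i))"
    and N: "\<And>i. N i < N (Suc i)" and early: "\<And>i k. k < N i \<Longrightarrow> block_norm (u i) k = 0"
    and hump: "\<And>i. 1 - (1/2)^(i+2) \<le> (\<Sum>k\<in>{N i..<N (Suc i)}. block_norm (u i) k powr P)"
    and \<epsilon>: "\<And>i. cmod (\<epsilon> i) = 1" and n: "0 < n"
    and \<tau>: "\<tau> = P * \<beta> * (ln (real n / 2) / P - ln 2)" "0 \<le> \<tau>"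
  defines "x \<equiv> \<Sum>i<n. cscale (\<epsilon> i) (u i)"
  defines "R \<equiv> \<Omega> x - (\<Sum>i<n. cscale (\<epsilon> i) (\<Omega> (u i)))"
  assumes R: "R \<in> vecs XP"
  shows "\<tau> powr P * (real n / 2) \<le> energy R" and "energy x \<le> real n"
proof -
  have x: "x \<in> vecs XP"
    unfolding x_def
    by (intro cseq.subspace_sum[OF l_sum_subspace[OF P_ereal]] cseq.subspace_scale[OF l_sum_subspace[OF P_ereal]] u)
  let ?a = "\<lambda>i k. block_norm (u i) k" and ?b = "block_norm x"
  have disj_n: "disjoint_family_on (\<lambda>i. supp (u i)) {..<n}"
    using disj by (auto simp: disjoint_family_on_def)
  have sq: "(?b k)\<^sup>2 = (\<Sum>i<n. (?a i k)\<^sup>2)" for k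
    unfolding x_def by (rule block_norm_disjoint_sum[OF _ disj_n \<epsilon>]) simp
  have powr_sq: "a powr P = (a\<^sup>2) powr (P/2)" if "0 \<le> a" for a :: real
    using that powr_powr[of a 2 "P/2"] P_gt_1 by (cases "a = 0") auto
  have b_le: "?b k powr P \<le> (\<Sum>i<n. ?a i k powr P)" for k
  proof -
    have "?b k powr P = (\<Sum>i<n. (?a i k)\<^sup>2) powr (P/2)" by (simp add: powr_sq sq)
    also have "\<dots> \<le> (\<Sum>i<n. ((?a i k)\<^sup>2) powr (P/2))"
      using P_gt_1 P2 by (intro powr_sum_subadditive) auto
    finally show ?thesis by (simp add: powr_sq)
  qed
  have a_le: "?a i k \<le> ?b k" if "i < n" for i k
  proof (rule power2_le_imp_le)
    show "(?a i k)\<^sup>2 \<le> (?b k)\<^sup>2"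
      unfolding sq using that by (intro member_le_sum[of i]) auto
  qed simp
  have Eu: "energy (u i) = 1" for i using energy(2)[OF u(1)] u(2) by simp
  have total: "(\<Sum>k<M. ?a i k powr P) \<le> 1" for i M
    using energy_partial_sum_le[OF u(1), where M = M] Eu by metis
  have good: "1 / 2 \<le> (\<Sum>k | k \<in> {N i..<N (Suc i)} \<and> ?b k \<le> 2 * ?a i k. ?a i k powr P)" if "i < n" for i
    by (rule dominant_blocks[OF _ N _ _ early total hump b_le that]) (use P_gt_1 in auto)
  show Ex: "energy x \<le> real n"
  proof -
    have "energy x \<le> (\<Sum>k. \<Sum>i<n. ?a i k powr P)"
      unfolding energy_def by (intro suminf_le b_le energy(1)[OF x] summable_sum energy(1)[OF u(1)])
    also have "\<dots> = (\<Sum>i<n. energy (u i))"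
      unfolding energy_def by (rule suminf_sum) (rule energy(1)[OF u(1)])
    finally show ?thesis using Eu by simp
  qed
  have goodsum: "(\<Sum>k | k \<in> {N i..<N (Suc i)} \<and> ?b k \<le> 2 * ?a i k. ?a i k powr P)
      \<le> (\<Sum>k\<in>{N i..<N (Suc i)}. ?a i k powr P)" for i
    by (intro sum_mono2) auto
  have nx: "real n / 2 \<le> nrm XP x powr P"
  proof -
    have "real n / 2 = (\<Sum>i<n. 1 / 2)" by simp
    also have "\<dots> \<le> (\<Sum>i<n. \<Sum>k\<in>{N i..<N (Suc i)}. ?b k powr P)"
    proof (rule sum_mono)
      fix i assume "i \<in> {..<n}"
      then have i: "i < n" by simp
      have "1 / 2 \<le> (\<Sum>k\<in>{N i..<N (Suc i)}. ?a i k powr P)" using good[OF i] goodsum[of i] by linarith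
      also have "\<dots> \<le> (\<Sum>k\<in>{N i..<N (Suc i)}. ?b k powr P)"
        using a_le[OF i] P_gt_1 by (intro sum_mono powr_mono2) auto
      finally show "1 / 2 \<le> (\<Sum>k\<in>{N i..<N (Suc i)}. ?b k powr P)" .
    qed
    also have "\<dots> \<le> (\<Sum>k<N n. ?b k powr P)" by (rule sum_consecutive_intervals[of N, OF N]) simp
    also have "\<dots> \<le> energy x" by (rule energy_partial_sum_le[OF x])
    finally show ?thesis using energy(2)[OF x] by simp
  qed
  then have nx_pos: "0 < nrm XP x"
    using n nrm_XP_nonneg[OF x] by (cases "nrm XP x = 0") auto
  have ln_nx: "ln (real n / 2) / P \<le> ln (nrm XP x)"
  proof -
    have "ln (real n / 2) \<le> ln (nrm XP x powr P)" using nx n nx_pos by (subst ln_le_cancel_iff) auto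
    then show ?thesis using nx_pos P_gt_1 by (simp add: ln_powr field_simps)
  qed
  have R_coord: "R j = \<epsilon> i * u i j * of_real (P * \<beta> * (ln (?b (block j) / nrm XP x) - ln (?a i (block j))))"
    if i: "i < n" "u i j \<noteq> 0" for i j
  proof -
    have z: "u m j = 0" if "m \<noteq> i" for m
      using disj i that unfolding disjoint_family_on_def supp_def by blast
    have "x j = \<epsilon> i * u i j"
      unfolding x_def sum_cscale_apply using i z by (subst sum.remove[of _ i]) auto
    moreover have "(\<Sum>m<n. \<epsilon> m * \<Omega> (u m) j) = \<epsilon> i * \<Omega> (u i) j"
      using i z by (subst sum.remove[of _ i]) (auto simp: Omega_apply)
    ultimately show ?thesis
      unfolding R_def by (simp add: sum_cscale_apply Omega_apply u(2) algebra_simps)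
  qed
  have R_block: "\<tau> * ?a i k \<le> block_norm R k" if i: "i < n" and k: "?b k \<le> 2 * ?a i k" for i k
  proof -
    have "\<tau> * ?a i k = block_norm (cscale (of_real \<tau>) (u i)) k"
      using \<tau>(2) by (simp add: block_norm_cscale)
    also have "\<dots> \<le> block_norm R k"
    proof (rule block_norm_mono)
      fix j assume j: "block j = k"
      show "cmod (cscale (of_real \<tau>) (u i) j) \<le> cmod (R j)"
      proof (cases "u i j = 0")
        case False
        then have a: "0 < ?a i k" using cmod_le_block_norm[of "u i" j] j by (meson less_le_trans zero_less_norm_iff)
        then have b: "0 < ?b k" using a_le[OF i, of k] by linarith
        have "ln (?b k) \<le> ln (2 * ?a i k)" using a b k by (subst ln_le_cancel_iff) auto
        then have "ln (?b k / nrm XP x) - ln (?a i k) \<le> - (ln (real n / 2) / P - ln 2)"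
          using ln_nx a b nx_pos by (simp add: ln_mult ln_div)
        then have "P * \<beta> * (ln (?b k / nrm XP x) - ln (?a i k)) \<le> P * \<beta> * - (ln (real n / 2) / P - ln 2)"
          using P_gt_1 \<beta>_pos by (intro mult_left_mono) auto
        then have "\<tau> \<le> \<bar>P * \<beta> * (ln (?b k / nrm XP x) - ln (?a i k))\<bar>"
          unfolding \<tau>(1) by linarith
        then have "\<tau> * cmod (u i j) \<le> \<bar>P * \<beta> * (ln (?b k / nrm XP x) - ln (?a i k))\<bar> * cmod (u i j)"
          by (rule mult_right_mono) simp
        also have "\<dots> = cmod (R j)"
          unfolding R_coord[OF i False] norm_mult norm_of_real j using \<epsilon>[of i] by (simp only: mult_1_left mult.commute)
        finally show ?thesis using \<tau>(2) by (simp add: cscale_def norm_mult)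
      qed (simp add: cscale_def)
    qed
    finally show ?thesis .
  qed
  have "\<tau> powr P * (real n / 2) = (\<Sum>i<n. \<tau> powr P * (1 / 2))" by simp
  also have "\<dots> \<le> (\<Sum>i<n. \<Sum>k\<in>{N i..<N (Suc i)}. block_norm R k powr P)"
  proof (rule sum_mono)
    fix i assume "i \<in> {..<n}"
    then have i: "i < n" by simp
    let ?G = "{k. k \<in> {N i..<N (Suc i)} \<and> ?b k \<le> 2 * ?a i k}"
    have "\<tau> powr P * (1 / 2) \<le> \<tau> powr P * (\<Sum>k\<in>?G. ?a i k powr P)"
      by (intro mult_left_mono good[OF i]) simp
    also have "\<dots> = (\<Sum>k\<in>?G. (\<tau> * ?a i k) powr P)"
      using \<tau>(2) by (simp add: sum_distrib_left powr_mult)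
    also have "\<dots> \<le> (\<Sum>k\<in>?G. block_norm R k powr P)"
      using R_block[OF i] \<tau>(2) P_gt_1 by (intro sum_mono powr_mono2) auto
    also have "\<dots> \<le> (\<Sum>k\<in>{N i..<N (Suc i)}. block_norm R k powr P)"
      by (intro sum_mono2) auto
    finally show "\<tau> powr P * (1 / 2) \<le> (\<Sum>k\<in>{N i..<N (Suc i)}. block_norm R k powr P)" .
  qed
  also have "\<dots> \<le> (\<Sum>k<N n. block_norm R k powr P)" by (rule sum_consecutive_intervals[of N, OF N]) simp
  also have "\<dots> \<le> energy R" by (rule energy_partial_sum_le[OF R])
  finally show "\<tau> powr P * (real n / 2) \<le> energy R" .
qed

text \<open>Given the starting block \<open>M\<close>, take a member of the sequence that vanishes before \<open>M\<close>, normalize it, and cut where the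
required part of its mass has been collected; the cut is the next starting block. Members used at different stages are
different, as the later one vanishes where the earlier one has its mass.\<close>

lemma hump_extraction:
  fixes u :: "nat \<Rightarrow> basis_index \<Rightarrow> complex"
  assumes u: "range u \<subseteq> vecs XP" and disj: "disjoint_family (\<lambda>n. supp (u n))" and inf: "infinite {n. u n \<noteq> 0}"
  obtains w :: "nat \<Rightarrow> basis_index \<Rightarrow> complex" and N :: "nat \<Rightarrow> nat" where
    "\<And>i. w i \<in> cseq.span (range u)" "\<And>i. w i \<in> vecs XP" "\<And>i. nrm XP (w i) = 1" "disjoint_family (\<lambda>i. supp (w i))"
    "\<And>i. N i < N (Suc i)" "\<And>i k. k < N i \<Longrightarrow> block_norm (w i) k = 0"
    "\<And>i. 1 - (1/2)^(i+2) \<le> (\<Sum>k\<in>{N i..<N (Suc i)}. block_norm (w i) k powr P)"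
proof -
  define v where "v = (\<lambda>n. cscale (of_real (inverse (nrm XP (u n)))) (u n))"
  have uv: "u n \<in> vecs XP" for n using u by blast
  have v1: "nrm XP (v n) = 1" if nonzero: "u n \<noteq> 0" for n
  proof -
    obtain j where "u n j \<noteq> 0" using nonzero unfolding fun_eq_iff zero_fun_apply by blast
    then have "0 < nrm XP (u n)" using cmod_le_nrm[OF P_ereal uv, of n j] by (meson less_le_trans zero_less_norm_iff)
    then show ?thesis by (simp add: v_def l_sum_cscale[OF P_ereal uv] norm_inverse)
  qed
  have v: "v n \<in> vecs XP" "v n \<in> cseq.span (range u)" for n
    unfolding v_def using l_sum_cscale_le[OF P_ereal uv] by (blast, intro cseq.span_scale cseq.span_base rangeI)
  have v_supp: "supp (v n) \<subseteq> supp (u n)" for n by (auto simp: v_def supp_def cscale_def)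
  have "\<exists>n. u n \<noteq> 0 \<and> (\<forall>j. block j < M \<longrightarrow> u n j = 0)" for M
    by (rule vanishing_on_initial_blocks[OF disj inf])
  then obtain f where f: "\<And>M. u (f M) \<noteq> 0" "\<And>M j. block j < M \<Longrightarrow> u (f M) j = 0" by metis
  have f0: "block_norm (v (f M)) k = 0" if "k < M" for M k
    using f(2) that by (auto simp: block_norm_eq_0_iff v_def cscale_def)
  have "\<exists>M'>M. 1 - (1/2)^(i+2) \<le> (\<Sum>k\<in>{M..<M'}. block_norm (v (f M)) k powr P)" for M i
  proof -
    let ?g = "\<lambda>k. block_norm (v (f M)) k powr P"
    have "(\<lambda>m. \<Sum>k<m. ?g k) \<longlonglongrightarrow> energy (v (f M))"
      unfolding energy_def by (rule summable_LIMSEQ[OF energy(1)[OF v(1)]])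
    moreover have "1 - (1/2)^(i+2) < energy (v (f M))"
      using energy(2)[OF v(1)] v1[OF f(1)] by simp
    ultimately have "\<forall>\<^sub>F m in sequentially. 1 - (1/2)^(i+2) < (\<Sum>k<m. ?g k)"
      by (rule order_tendstoD(1))
    then obtain m where m: "\<And>m'. m \<le> m' \<Longrightarrow> 1 - (1/2)^(i+2) < (\<Sum>k<m'. ?g k)"
      by (auto simp: eventually_sequentially)
    define M' where "M' = max m (Suc M)"
    have "(\<Sum>k<M'. ?g k) = (\<Sum>k\<in>{M..<M'}. ?g k)"
      using f0 by (intro sum.mono_neutral_right) auto
    then show ?thesis using m[of M'] by (intro exI[of _ M']) (auto simp: M'_def)
  qed
  then obtain h where h: "\<And>M i. M < h M i"
    "\<And>M i. 1 - (1/2)^(i+2) \<le> (\<Sum>k\<in>{M..<h M i}. block_norm (v (f M)) k powr P)" by metis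
  define N where "N = rec_nat 0 (\<lambda>i M. h M i)"
  have NS: "N (Suc i) = h (N i) i" for i by (simp add: N_def)
  have N_less: "N i < N (Suc i)" for i unfolding NS by (rule h)
  have N_mono: "N i \<le> N j" if "i \<le> j" for i j
    using lift_Suc_mono_le[of N, OF less_imp_le[OF N_less] that] .
  have hump: "1 - (1/2)^(i+2) \<le> (\<Sum>k\<in>{N i..<N (Suc i)}. block_norm (v (f (N i))) k powr P)" for i
    unfolding NS by (rule h)
  have distinct: "f (N i) \<noteq> f (N j)" if "i < j" for i j
  proof
    assume eq: "f (N i) = f (N j)"
    have "(\<Sum>k\<in>{N i..<N (Suc i)}. block_norm (v (f (N i))) k powr P) = 0"
      unfolding eq using f0[of _ "N j"] N_mono[of "Suc i" j] that by (intro sum.neutral) auto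
    moreover have "(1/2 :: real)^(i+2) < 1" using power_strict_decreasing[of 0 "i + 2" "1/2 :: real"] by simp
    ultimately show False using hump[of i] by simp
  qed
  have "disjoint_family (\<lambda>i. supp (v (f (N i))))"
    unfolding disjoint_family_on_def
  proof (intro ballI impI)
    fix i j :: nat assume "i \<noteq> j"
    then have "f (N i) \<noteq> f (N j)" using distinct by (metis linorder_neqE_nat)
    then have "supp (u (f (N i))) \<inter> supp (u (f (N j))) = {}" using disj by (simp add: disjoint_family_on_def)
    then show "supp (v (f (N i))) \<inter> supp (v (f (N j))) = {}" using v_supp by blast
  qed
  then show thesis
    by (intro that[of "\<lambda>i. v (f (N i))" N]) (use v v1[OF f(1)] N_less f0 hump in auto)
qed

text \<open>The deviation of \<open>\<Omega>\<close> from additivity on signed sums of humps grows by the factor \<open>ln n\<close>, while a linear \<open>L\<close> at bounded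
distance from \<open>\<Omega>\<close> and well-chosen signs would keep it of the order \<open>n powr (1 / P)\<close>.\<close>

theorem Omega_disjointly_singular:
  assumes P2: "P \<le> 2"
  shows "disjointly_singular XP \<Omega>"
  unfolding disjointly_singular_def
proof (intro allI impI notI)
  fix u :: "nat \<Rightarrow> basis_index \<Rightarrow> complex"
  let ?H = "closed_span XP (range u)"
  assume "range u \<subseteq> vecs XP \<and> disjoint_family (\<lambda>n. supp (u n)) \<and> infinite_dimensional ?H"
  then have u: "range u \<subseteq> vecs XP" and disj: "disjoint_family (\<lambda>n. supp (u n))"
    and inf: "infinite_dimensional ?H" by auto
  assume "trivial_on XP \<Omega> ?H"
  then obtain L K where L: "linear_on_seq ?H L" "\<And>x. x \<in> ?H \<Longrightarrow> \<Omega> x - L x \<in> vecs XP"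
    "\<And>x. x \<in> ?H \<Longrightarrow> nrm XP x \<le> 1 \<Longrightarrow> nrm XP (\<Omega> x - L x) \<le> K"
    unfolding trivial_on_def by blast
  obtain w :: "nat \<Rightarrow> basis_index \<Rightarrow> complex" and N :: "nat \<Rightarrow> nat" where
    w: "\<And>i. w i \<in> cseq.span (range u)" "\<And>i. w i \<in> vecs XP" "\<And>i. nrm XP (w i) = 1" "disjoint_family (\<lambda>i. supp (w i))"
    "\<And>i. N i < N (Suc i)" "\<And>i k. k < N i \<Longrightarrow> block_norm (w i) k = 0"
    "\<And>i. 1 - (1/2)^(i+2) \<le> (\<Sum>k\<in>{N i..<N (Suc i)}. block_norm (w i) k powr P)"
    using hump_extraction[OF u disj infinitely_many_nonzero[OF P_ereal disj inf]] by blast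
  let ?S = "cseq.span (range u)"
  have S: "cseq.subspace ?S" "?S \<subseteq> ?H" by (auto simp: cseq.subspace_span span_subset_closed_span[OF P_ereal u])
  have wH: "w i \<in> ?H" for i using w(1) S(2) by blast
  define d where "d = (\<lambda>i. \<Omega> (w i) - L (w i))"
  have d: "d i \<in> vecs XP" "nrm XP (d i) \<le> K" for i
    unfolding d_def using L(2,3)[OF wH] w(3) by auto
  have K: "0 \<le> K" using nrm_XP_nonneg[OF d(1)] d(2) order_trans by blast
  have bound: "nrm XP (\<Omega> x - L x) \<le> K * nrm XP x" if x: "x \<in> ?S" "x \<in> vecs XP" "0 < nrm XP x" for x
  proof -
    let ?c = "of_real (inverse (nrm XP x)) :: complex"
    have y: "cscale ?c x \<in> ?H" using cseq.subspace_scale[OF S(1) x(1)] S(2) by blast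
    have Ly: "L (cscale ?c x) = cscale ?c (L x)" using L(1) x(1) S(2) unfolding linear_on_seq_def by blast
    have xH: "x \<in> ?H" using x(1) S(2) by blast
    have "\<Omega> (cscale ?c x) - L (cscale ?c x) = cscale ?c (\<Omega> x - L x)"
      unfolding Omega_cscale[OF x(2)] Ly by (rule cseq.scale_right_diff_distrib[symmetric])
    moreover have "nrm XP (cscale ?c x) \<le> 1" using x(3) by (simp add: l_sum_cscale[OF P_ereal x(2)] norm_inverse)
    ultimately have "nrm XP (cscale ?c (\<Omega> x - L x)) \<le> K" using L(3)[OF y] by simp
    then have "inverse (nrm XP x) * nrm XP (\<Omega> x - L x) \<le> K"
      unfolding l_sum_cscale[OF P_ereal L(2)[OF xH]] norm_of_real using x(3) by simp
    then show ?thesis using x(3) by (simp add: field_simps)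
  qed
  have main: "\<tau> powr P \<le> 2 * (2 * K) powr P"
    if n: "0 < n" and \<tau>: "\<tau> = P * \<beta> * (ln (real n / 2) / P - ln 2)" "0 \<le> \<tau>" for n \<tau>
  proof -
    obtain \<epsilon> :: "nat \<Rightarrow> complex" where \<epsilon>: "\<And>i. cmod (\<epsilon> i) = 1"
      "energy (\<Sum>i<n. cscale (\<epsilon> i) (d i)) \<le> (\<Sum>i<n. energy (d i))"
      using sign_choice[where d = d and n = n, OF d(1) P2] by blast
    define x where "x = (\<Sum>i<n. cscale (\<epsilon> i) (w i))"
    define y where "y = (\<Sum>i<n. cscale (\<epsilon> i) (d i))"
    define R where "R = \<Omega> x - (\<Sum>i<n. cscale (\<epsilon> i) (\<Omega> (w i)))"
    have xS: "x \<in> ?S" unfolding x_def by (intro cseq.span_sum cseq.span_scale w)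
    have xv: "x \<in> vecs XP" and yv: "y \<in> vecs XP"
      unfolding x_def y_def
      by (intro cseq.subspace_sum[OF l_sum_subspace[OF P_ereal]] cseq.subspace_scale[OF l_sum_subspace[OF P_ereal]] w d)+
    have xH: "x \<in> ?H" using xS S(2) by blast
    have Lx: "L x = (\<Sum>i<n. cscale (\<epsilon> i) (L (w i)))"
      unfolding x_def by (rule linear_on_seq_sum[OF L(1) S w(1)])
    have "y = (\<Sum>i<n. cscale (\<epsilon> i) (\<Omega> (w i))) - L x"
      unfolding y_def d_def Lx cseq.scale_right_diff_distrib by (rule sum_subtractf)
    then have R_eq: "R = (\<Omega> x - L x) - y" by (simp add: R_def)
    have Rv: "R \<in> vecs XP" and R_nrm: "nrm XP R \<le> nrm XP (\<Omega> x - L x) + nrm XP y"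
      unfolding R_eq using l_sum_minus[OF P_ereal L(2)[OF xH] yv] by auto
    have dev: "\<tau> powr P * (real n / 2) \<le> energy R" "energy x \<le> real n"
      unfolding R_def x_def
      by (rule Omega_sum_deviation_lower_bound[where N = N and \<epsilon> = \<epsilon> and u = w and \<tau> = \<tau>];
          (rule P2 w(2,3,4,5,7) \<epsilon>(1) n \<tau> Rv[unfolded R_def x_def] | erule w(6)))+
    have root: "nrm XP z \<le> c * real n powr (1/P)" if "z \<in> vecs XP" "energy z \<le> c powr P * real n" "0 \<le> c" for z c
    proof -
      have "nrm XP z = (nrm XP z powr P) powr (1/P)" using P_gt_1 nrm_XP_nonneg[OF that(1)] by (simp add: powr_powr)
      also have "\<dots> \<le> (c powr P * real n) powr (1/P)"
        using that energy(2)[OF that(1)] P_gt_1 by (intro powr_mono2) auto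
      finally show ?thesis using that P_gt_1 by (simp add: powr_mult powr_powr)
    qed
    have ny: "nrm XP y \<le> K * real n powr (1/P)"
    proof (rule root[OF yv _ K])
      have "energy (d i) \<le> K powr P" for i
        unfolding energy(2)[OF d(1)] using d nrm_XP_nonneg P_gt_1 by (intro powr_mono2) auto
      then have "(\<Sum>i<n. energy (d i)) \<le> (\<Sum>i<n. K powr P)" by (intro sum_mono)
      then show "energy y \<le> K powr P * real n" using \<epsilon>(2) by (simp add: y_def mult.commute)
    qed
    have nx: "nrm XP x \<le> 1 * real n powr (1/P)" by (rule root[OF xv]) (use dev in auto)
    have nO: "nrm XP (\<Omega> x - L x) \<le> K * real n powr (1/P)"
    proof (cases "nrm XP x = 0")
      case True
      have "x = 0"
      proof
        fix j show "x j = 0 j" using cmod_le_nrm[OF P_ereal xv, of j] True by simp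
      qed
      then have "cscale 0 x = x" by (simp add: cscale_def fun_eq_iff)
      then have "\<Omega> x - L x = 0"
        using Omega_cscale[OF xv, of 0] L(1) xH unfolding linear_on_seq_def
        by (metis cseq.scale_zero_left diff_0_right)
      then show ?thesis using K l_sum_zero(2)[OF P_ereal] by simp
    next
      case False
      then have "nrm XP (\<Omega> x - L x) \<le> K * nrm XP x"
        using nrm_XP_nonneg[OF xv] by (intro bound[OF xS xv]) auto
      also have "\<dots> \<le> K * real n powr (1/P)" using nx K by (intro mult_left_mono) auto
      finally show ?thesis .
    qed
    have "energy R \<le> (2 * K * real n powr (1/P)) powr P"
      unfolding energy(2)[OF Rv] using R_nrm ny nO nrm_XP_nonneg[OF Rv] P_gt_1 by (intro powr_mono2) auto
    also have "\<dots> = (2 * K) powr P * real n"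
      using K P_gt_1 n by (simp add: powr_mult powr_powr)
    finally have "\<tau> powr P * (real n / 2) \<le> (2 * K) powr P * real n" using dev(1) by linarith
    then show ?thesis using n by (simp add: field_simps)
  qed
  define \<tau> where "\<tau> = (\<lambda>n :: nat. P * \<beta> * (ln (real n / 2) / P - ln 2))"
  have "filterlim \<tau> at_top sequentially"
    unfolding \<tau>_def using P_gt_1 \<beta>_pos by real_asymp
  \<comment> \<open>Any number whose \<open>P\<close>-th power exceeds the bound in \<open>main\<close>.\<close>
  moreover define T where "T = 1 + (2 * (2 * K) powr P) powr (1/P)"
  ultimately have "\<forall>\<^sub>F n in sequentially. T \<le> \<tau> n" by (simp add: filterlim_at_top)
  then obtain n where n: "0 < n" "T \<le> \<tau> n"
    unfolding eventually_sequentially by (metis le_add1 le_add2 less_le_trans zero_less_one)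
  have T: "0 < T" "(2 * (2 * K) powr P) powr (1/P) < T" by (auto simp: T_def add_pos_nonneg)
  have "2 * (2 * K) powr P = ((2 * (2 * K) powr P) powr (1/P)) powr P" using P_gt_1 by (simp add: powr_powr)
  also have "\<dots> < T powr P" using T P_gt_1 by (intro powr_less_mono2) auto
  also have "\<dots> \<le> \<tau> n powr P" using T n P_gt_1 by (intro powr_mono2) auto
  also have "\<dots> \<le> 2 * (2 * K) powr P" by (rule main[OF n(1)]) (use T n in \<open>auto simp: \<tau>_def\<close>)
  finally show False by simp
qed

end

theorem proposition5p8:
  fixes p0 p1 p :: ereal and \<theta> :: real
  assumes "1 \<le> p1" and "p1 < p0" and "p0 \<le> \<infinity>"
    and "0 < \<theta>" and "\<theta> < 1"
    and "inverse p = ereal (1 - \<theta>) * inverse p0 + ereal \<theta> * inverse p1"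
  shows "same_space (interp_space (l_sum p0) (l_sum p1) \<theta>) (l_sum p) \<and>
    associated_centralizer (l_sum p0) (l_sum p1) \<theta> (Omega p0 p1 p) \<and>
    (p0 < 2 \<longrightarrow>
      disjointly_singular (l_sum p) (Omega p0 p1 p) \<and>
      \<not> super_disjointly_singular (l_sum p) (Omega p0 p1 p))"
proof -
  obtain b where b: "p1 = ereal b" "1 \<le> b" using assms by (cases p1) auto
  have fin: "inverse p0 = ereal (recip p0)" "inverse p1 = ereal (recip p1)" "0 \<le> recip p0" "0 < recip p1"
    using assms b by (cases p0; simp add: recip_def)+
  define s where "s = (1 - \<theta>) * recip p0 + \<theta> * recip p1"
  have s: "0 < s" using fin assms by (auto simp: s_def intro!: add_nonneg_pos)
  have inv_p: "inverse p = ereal s" unfolding assms(6) fin by (simp add: s_def)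
  then have p: "p = ereal (1 / s)"
    using s by (cases p) (auto simp: field_simps split: if_splits)
  interpret interpolation_exponents p0 p1 "1 / s" \<theta>
    by unfold_locales (use assms s in \<open>auto simp: s_def\<close>)
  have "1 / s \<le> 2" if "p0 < 2"
  proof -
    have "ereal (1 / s) < 2" using P_bounds(2) that by order
    then show ?thesis by simp
  qed
  then show ?thesis
    unfolding p
    using interp_space_eq Omega_is_associated_centralizer Omega_disjointly_singular not_super_disjointly_singular by blast
qed

end
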